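(* Let $\lambda>0$, and let $X_{\nu'_\lambda}(t)$ be the position at time $t$ of the tagged first-class particle that starts at $0$ in the Hammersley process with initial configuration $\nu'_\lambda=\nu_\lambda+\delta_0$, where $\nu_\lambda$ is a Poisson process on $\mathbb{R}$ of intensity $\lambda$. Let $\Phi$ denote the standard normal distribution function, and set $$\mu_1:=-\frac{1}{\lambda^2},\qquad \sigma_1:=\sqrt{\frac{2}{\lambda^3}}.$$ Then, for all $u\in\mathbb{R}$, $$\lim_{t\to\infty}\mathbb{P}\left(X_{\nu'_\lambda}(t)\le \mu_1 t+(\sigma_1\sqrt{t})u\right)=\Phi(u).$$
   Context: Hammersley process. Let $\nu$ be a (locally finite, simple) counting measure on $\mathbb{R}$ with a positive density of particles; write $z\in\nu$ if $\nu(\{z\})=1$; the atoms are called particles. Let $\mathbf{P}$ be a homogeneous Poisson point set of intensity one in $\mathbb{R}\times(0,\infty)$ (second coordinate is time), independent of $\nu$ if $\nu$ is random. The process $(M^t_\nu)_{t\ge 0}$ starts from $M^0_\nu=\nu$, and at each $(x,s)\in\mathbf{P}$, at time $s$ the nearest particle strictly to the right of $x$ is moved to $x$ (all other particles stay put). Equivalently, $M^t_\nu((x,y])=L_\nu(y,t)-L_\nu(x,t)$ for $x<y$, where $L_\nu(x,t)=\sup_{z\le x}\{\nu(z)+L((z,0),(x,t))\}$, with $\nu(x)=\nu((0,x])$ for $x>0$, $\nu(0)=0$, $\nu(x)=-\nu((x,0])$ for $x<0$, and $L((z,0),(x,t))$ the maximal number of points of $\mathbf{P}$ in $(z,x]\times(0,t]$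 that form a sequence increasing in both coordinates. For $z\in\nu$, $X^z_\nu(t)$ is the position at time $t$ of the particle initially at $z$ (so particles move only to the left and keep their order). For $\nu'_\lambda=\nu_\lambda+\delta_0$, $X_{\nu'_\lambda}(t):=X^{0}_{\nu'_\lambda}(t)$. *)

theory Defs
  imports "HOL-Probability.Probability"
begin

text \<open>A simple locally finite counting measure is represented by the set of its atoms.\<close>

definition configurations :: "'a::euclidean_space set set" where
  "configurations = {S. \<forall>A. bounded A \<longrightarrow> finite (S \<inter> A)}"

definition config_space :: "'a::euclidean_space set measure" where
  "config_space = sigma configurations
     {{S \<in> configurations. card (S \<inter> A) = k} | A k. A \<in> sets borel \<and> bounded A}"

text \<open>
  The Poisson law is written out because \<^const>\<open>poisson_pmf\<close> is only specified for a positive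
  rate, whereas bounded sets may have intensity zero.
\<close>

definition poisson_process ::
    "'w measure \<Rightarrow> 'a::euclidean_space measure \<Rightarrow> ('w \<Rightarrow> 'a set) \<Rightarrow> bool" where
  "poisson_process M m N \<longleftrightarrow>
     N \<in> measurable M config_space \<and>
     (\<forall>A k. A \<in> sets borel \<longrightarrow> bounded A \<longrightarrow>
        measure M {\<omega> \<in> space M. card (N \<omega> \<inter> A) = k} =
          measure m A ^ k / fact k * exp (- measure m A)) \<and>
     (\<forall>A :: nat \<Rightarrow> 'a set. (\<forall>i. A i \<in> sets borel \<and> bounded (A i)) \<longrightarrow> disjoint_family A \<longrightarrow>
        prob_space.indep_vars M (\<lambda>_. count_space UNIV) (\<lambda>i \<omega>. card (N \<omega> \<inter> A i)) UNIV)"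

definition indep_configs ::
    "'w measure \<Rightarrow> ('w \<Rightarrow> 'a::euclidean_space set) \<Rightarrow> ('w \<Rightarrow> 'b::euclidean_space set) \<Rightarrow> bool" where
  "indep_configs M N N' \<longleftrightarrow>
     prob_space.indep_set M
       (sets (vimage_algebra (space M) N config_space))
       (sets (vimage_algebra (space M) N' config_space))"

definition increasing_chain :: "(real \<times> real) set \<Rightarrow> bool" where
  "increasing_chain C \<longleftrightarrow>
     (\<forall>p\<in>C. \<forall>q\<in>C. p \<noteq> q \<longrightarrow>
        (fst p < fst q \<and> snd p < snd q) \<or> (fst q < fst p \<and> snd q < snd p))"

definition last_passage ::
    "(real \<times> real) set \<Rightarrow> real \<times> real \<Rightarrow> real \<times> real \<Rightarrow> nat" where
  "last_passage P p q =
     Sup {card C | C. finite C \<and> increasing_chain C \<and>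
            C \<subseteq> P \<inter> ({fst p<..fst q} \<times> {snd p<..snd q})}"

definition signed_count :: "real set \<Rightarrow> real \<Rightarrow> real" where
  "signed_count \<nu> x =
     (if x \<ge> 0 then real (card (\<nu> \<inter> {0<..x})) else - real (card (\<nu> \<inter> {x<..0})))"

definition hammersley_L :: "real set \<Rightarrow> (real \<times> real) set \<Rightarrow> real \<Rightarrow> real \<Rightarrow> real" where
  "hammersley_L \<nu> P x t =
     (SUP z\<in>{..x}. signed_count \<nu> z + real (last_passage P (z, 0) (x, t)))"

text \<open>
  The infinite system is constructed by the variational formula, i.e. the time-\<open>t\<close> measure
  of \<open>(x, y]\<close> is \<open>L(y, t) - L(x, t)\<close>. The jump rule alone would not determine the process:
  it also admits evolutions in which a disturbance enters instantaneously from \<open>-\<infinity>\<close>.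
\<close>

definition hammersley :: "real set \<Rightarrow> (real \<times> real) set \<Rightarrow> real \<Rightarrow> real measure" where
  "hammersley \<nu> P t = interval_measure (\<lambda>x. hammersley_L \<nu> P x t)"

definition particles :: "real measure \<Rightarrow> real set" where
  "particles N = {z. emeasure N {z} = 1}"

text \<open>
  \<open>jumps_to \<nu> P s y x\<close>: at time \<open>s\<close> the particle that sat at \<open>y\<close> just before \<open>s\<close> is moved
  to \<open>x\<close>, because \<open>(x, s)\<close> is a Poisson point and just before \<open>s\<close> the particle at \<open>y\<close> was
  the nearest one strictly to the right of \<open>x\<close>.
\<close>

definition jumps_to :: "real set \<Rightarrow> (real \<times> real) set \<Rightarrow> real \<Rightarrow> real \<Rightarrow> real \<Rightarrow> bool" where
  "jumps_to \<nu> P s y x \<longleftrightarrow>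
     (x, s) \<in> P \<and> x < y \<and>
     (\<forall>\<^sub>F r in at_left s.
        y \<in> particles (hammersley \<nu> P r) \<and> particles (hammersley \<nu> P r) \<inter> {x<..<y} = {})"

text \<open>
  Trajectory of the particle initially at \<open>z\<close>: a right-continuous step function on
  \<open>[0, \<infinity>)\<close> that moves exactly when the jump rule applies to it.
\<close>

definition particle_path ::
    "real set \<Rightarrow> (real \<times> real) set \<Rightarrow> real \<Rightarrow> (real \<Rightarrow> real) \<Rightarrow> bool" where
  "particle_path \<nu> P z f \<longleftrightarrow>
     f 0 = z \<and>
     (\<forall>t\<ge>0. f t \<in> particles (hammersley \<nu> P t)) \<and>
     (\<forall>t\<ge>0. \<forall>\<^sub>F r in at_right t. f r = f t) \<and>
     (\<forall>s>0. \<exists>y. (\<forall>\<^sub>F r in at_left s. f r = y) \<and>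
        (\<forall>x. jumps_to \<nu> P s y x \<longrightarrow> f s = x) \<and>
        ((\<nexists>x. jumps_to \<nu> P s y x) \<longrightarrow> f s = y))"

text \<open>Values at negative times are unconstrained, so uniqueness is asked of the position only.\<close>

definition particle_position ::
    "real set \<Rightarrow> (real \<times> real) set \<Rightarrow> real \<Rightarrow> real \<Rightarrow> real" where
  "particle_position \<nu> P z t = (THE y. \<exists>f. particle_path \<nu> P z f \<and> f t = y)"

end

theory Submission
  imports Defs
begin


text \<open>
  Write \<open>L\<close> for the variational function of the configuration with the extra particle at \<open>0\<close>.
  The tagged particle is the atom at which \<open>L(\<cdot>, t)\<close> steps from \<open>-1\<close> to \<open>0\<close>, so for \<open>x < 0\<close> it lies
  in \<open>(-\<infinity>, x]\<close> exactly if some \<open>z \<le> x\<close> admits an increasing chain of \<open>P\<close> in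
  \<open>(z, x] \<times> (0, t]\<close> with more points than \<open>\<nu>\<close> has atoms in \<open>(z, 0]\<close>. Splitting \<open>(z, 0]\<close> at
  \<open>x\<close>, this says that the flux \<open>J\<close> of particles through \<open>x\<close> up to time \<open>t\<close>, which is
  the supremum over \<open>z \<le> x\<close> of the chain length minus \<open>\<nu>((z, x])\<close>, exceeds \<open>\<nu>((x, 0])\<close>. Two
  facts determine the probability. The count \<open>\<nu>((x, 0])\<close> is Poisson with mean \<open>\<lambda>|x|\<close> and is
  independent of \<open>J\<close>, which involves only \<open>P\<close> and the part of \<open>\<nu>\<close> to the left of \<open>x\<close>. And,
  by a theorem of Burke type, \<open>J\<close> is Poisson with mean \<open>t/\<lambda>\<close>. So the probability is that of one
  Poisson variable exceeding another independent one (\<open>tagged_position_prob\<close>). For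
  \<open>x = \<mu>\<^sub>1 t + \<sigma>\<^sub>1 \<surd>t u\<close> and \<open>s = \<surd>(2t/\<lambda>)\<close> the two means are \<open>s\<^sup>2/2\<close> and
  \<open>s\<^sup>2/2 - s u\<close>, and characteristic functions give the Gaussian limit as \<open>s \<rightarrow> \<infinity>\<close>
  (\<open>poisson_difference_clt\<close>).

  The Burke property comes from an exactly solvable lattice model. Cut \<open>(x - R, x] \<times> (0, t]\<close> into
  \<open>n \<times> n\<close> cells. Outside an event of probability \<open>O(1/n)\<close> no row contains two points of \<open>P\<close> and no
  column two among the points of \<open>P\<close> and the atoms of \<open>\<nu>\<close>, and then the continuous supremum satisfies a local recursion with independent Bernoulli inputs
  (\<open>height_eq_last_passage\<close>). If, in addition, independent Bernoulli steps of suitable density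
  enter through the left side (the sinks), each cell maps its pair of independent incoming steps to a
  pair with the same law, so that the steps leaving on the right are again independent Bernoulli variables
  (\<open>burke_percolate\<close>), and the flux is exactly binomial. The sinks change the flux only if the path along
  the left side is optimal. That path loses all atoms of \<open>\<nu>\<close> in an interval of length \<open>R\<close>, whereas
  the chains in the box are much shorter: the same invariance, applied with a small source density,
  bounds them (\<open>bulk_height_tail\<close>). Letting \<open>n \<rightarrow> \<infinity>\<close> and then \<open>R \<rightarrow> \<infinity>\<close> yields the Poisson law
  (\<open>source_flux_law\<close>, \<open>overtaking_prob\<close>). The events involved need not be measurable a priori; they
  differ from events defined by counts on sets of arbitrarily small probability, which is enough in the
  completion (\<open>completion_approximation\<close>).

  That the trajectory exists is a deterministic statement about typical configurations: points with
  pairwise distinct coordinates, and chains that fall behind the number of atoms by any given amount when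
  they start far enough to the left (the locale \<open>hammersley_data\<close>). Only a bounded window then matters, and there everything is
  a finite step function (\<open>tagged_path\<close>). Uniqueness holds for every configuration
  (\<open>particle_path_unique\<close>), and Poisson configurations are typical almost surely
  (\<open>AE_hammersley_data\<close>).
\<close>

section \<open>Atoms of step functions and the geometry of chains\<close>

lemma eventually_at_right_avoids_finite:
  fixes F :: "real set" assumes "finite F"
  shows "\<forall>\<^sub>F r in at_right a. F \<inter> {a<..r} = {}"
proof -
  have "\<forall>\<^sub>F r in at_right a. \<not> (a < y \<and> y \<le> r)" for y
    using eventually_at_right_less[of a]
    by (cases "a < y") (auto simp: eventually_at_right_field intro: exI[of _ y])
  then have "\<forall>\<^sub>F r in at_right a. \<forall>y\<in>F. \<not> (a < y \<and> y \<le> r)"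
    using assms by (simp add: eventually_ball_finite)
  then show ?thesis by eventually_elim auto
qed

lemma eventually_at_left_avoids_finite:
  fixes F :: "real set" assumes "finite F"
  shows "\<forall>\<^sub>F r in at_left a. F \<inter> {r..<a} = {}"
proof -
  have "\<forall>\<^sub>F r in at_left a. \<not> (y < a \<and> r \<le> y)" for y
    by (cases "y < a") (auto simp: eventually_at_left_field intro: exI[of _ y])
  then have "\<forall>\<^sub>F r in at_left a. \<forall>y\<in>F. \<not> (y < a \<and> r \<le> y)"
    using assms by (simp add: eventually_ball_finite)
  then show ?thesis by eventually_elim auto
qed

lemma eventually_just_right: "0 < d \<Longrightarrow> \<forall>\<^sub>F y in at_right x. x < y \<and> y < x + d" for x d :: real
  using eventually_at_right_real[of x "x + d"] by (simp add: greaterThanLessThan_iff)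

lemma eventually_just_left: "0 < d \<Longrightarrow> \<forall>\<^sub>F y in at_left x. x - d < y \<and> y < x" for x d :: real
  using eventually_at_left_real[of "x - d" x] by (simp add: greaterThanLessThan_iff)

lemma emeasure_interval_measure_atom:
  fixes F :: "real \<Rightarrow> real"
  assumes "\<And>x y. x \<le> y \<Longrightarrow> F x \<le> F y" "\<And>a. continuous (at_right a) F"
    and "\<forall>\<^sub>F x in at_left y. F x = c"
  shows "emeasure (interval_measure F) {y} = ennreal (F y - c)"
proof -
  obtain a where a: "a < y" "\<And>x. a < x \<Longrightarrow> x < y \<Longrightarrow> F x = c"
    using assms(3) by (auto simp: eventually_at_left_field)
  define b where "b = (a + y) / 2"
  have b: "a < b" "b < y" using a(1) by (auto simp: b_def)
  define e where "e n = y - (y - b) / real (n + 2)" for n :: nat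
  have e: "b \<le> e n" "e n < y" for n
  proof -
    have "(y - b) / real (n + 2) \<le> (y - b) / 1" using b by (intro divide_left_mono) auto
    then show "b \<le> e n" by (simp add: e_def)
    show "e n < y" using b by (simp add: e_def)
  qed
  have lim: "e \<longlonglongrightarrow> y" unfolding e_def by real_asymp
  have un: "{b<..<y} = (\<Union>n. {b<..e n})"
  proof (intro equalityI subsetI)
    fix x assume "x \<in> {b<..<y}"
    then have "\<forall>\<^sub>F n in sequentially. x < e n" using lim by (auto dest: order_tendstoD)
    then obtain n where "x < e n" by (auto simp: eventually_sequentially)
    then show "x \<in> (\<Union>n. {b<..e n})" using \<open>x \<in> {b<..<y}\<close> by (auto intro: less_imp_le)
  next
    fix x assume "x \<in> (\<Union>n. {b<..e n})" then obtain n where "b < x" "x \<le> e n" by auto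
    then show "x \<in> {b<..<y}" using e(2)[of n] by auto
  qed
  let ?M = "interval_measure F"
  have "emeasure ?M {b<..e n} = 0" for n
    using e[of n] b a(2)[of b] a(2)[of "e n"]
    by (subst emeasure_interval_measure_Ioc) (auto intro: assms)
  then have "{b<..<y} \<in> null_sets ?M" unfolding un by (intro null_sets_UN) (auto simp: null_sets_def)
  then have "emeasure ?M ({y} \<union> {b<..<y}) = emeasure ?M {y}"
    by (intro emeasure_Un_null_set) auto
  also have "{y} \<union> {b<..<y} = {b<..y}" using b by auto
  also have "emeasure ?M {b<..y} = ennreal (F y - F b)"
    using b by (subst emeasure_interval_measure_Ioc) (auto intro: assms)
  finally show ?thesis using a(2)[of b] b by simp
qed

lemma increasing_chain_subset: "increasing_chain C \<Longrightarrow> D \<subseteq> C \<Longrightarrow> increasing_chain D"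
  unfolding increasing_chain_def by blast

lemma increasing_chainD:
  "increasing_chain C \<Longrightarrow> p \<in> C \<Longrightarrow> q \<in> C \<Longrightarrow>
    p = q \<or> fst p < fst q \<and> snd p < snd q \<or> fst q < fst p \<and> snd q < snd p"
  unfolding increasing_chain_def by blast

lemma increasing_chain_insert:
  assumes "increasing_chain C" "\<And>q. q \<in> C \<Longrightarrow> fst q < fst p \<and> snd q < snd p"
  shows "increasing_chain (insert p C)"
  using assms unfolding increasing_chain_def by blast

definition chain_in :: "(real \<times> real) set \<Rightarrow> real \<Rightarrow> real \<Rightarrow> real \<Rightarrow> (real \<times> real) set \<Rightarrow> bool" where
  "chain_in P z x t C \<longleftrightarrow>
     finite C \<and> increasing_chain C \<and> C \<subseteq> P \<inter> ({z<..x} \<times> {0<..t})"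

lemma chain_in_empty [simp]: "chain_in P z x t {}"
  by (simp add: chain_in_def increasing_chain_def)

lemma chain_inD:
  assumes "chain_in P z x t C" "q \<in> C"
  shows "q \<in> P" "z < fst q" "fst q \<le> x" "0 < snd q" "snd q \<le> t"
  using assms unfolding chain_in_def by auto

lemma mem_box: "q \<in> P \<Longrightarrow> a < fst q \<Longrightarrow> fst q \<le> b \<Longrightarrow> c < snd q \<Longrightarrow> snd q \<le> d
    \<Longrightarrow> q \<in> P \<inter> ({a<..b} \<times> {c<..d})" for a b c d :: real
  by (cases q) auto

lemma chain_in_mono: "chain_in P z x t C \<Longrightarrow> z' \<le> z \<Longrightarrow> x \<le> x' \<Longrightarrow> t \<le> t' \<Longrightarrow> chain_in P z' x' t' C"
  unfolding chain_in_def by fastforce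

lemma
  assumes "finite (P \<inter> ({z<..x} \<times> {0<..t}))"
  shows card_chain_le_last_passage: "chain_in P z x t C \<Longrightarrow> card C \<le> last_passage P (z, 0) (x, t)"
    and last_passage_attained: "\<exists>C. chain_in P z x t C \<and> card C = last_passage P (z, 0) (x, t)"
proof -
  define A where "A = {card C | C. chain_in P z x t C}"
  have A: "last_passage P (z, 0) (x, t) = Sup A"
    unfolding last_passage_def A_def chain_in_def by simp
  have "A \<subseteq> {..card (P \<inter> ({z<..x} \<times> {0<..t}))}"
    using assms unfolding A_def chain_in_def by (auto intro: card_mono)
  then have fin: "finite A" using finite_subset by blast
  have "0 \<in> A" unfolding A_def by (auto intro!: exI[of _ "{}"])
  then have "Sup A \<in> A" "Sup A = Max A" using fin by (auto simp: Sup_nat_def)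
  then show "\<exists>C. chain_in P z x t C \<and> card C = last_passage P (z, 0) (x, t)"
    unfolding A by (auto simp: A_def)
  show "chain_in P z x t C \<Longrightarrow> card C \<le> last_passage P (z, 0) (x, t)"
    using fin unfolding A \<open>Sup A = Max A\<close> by (intro Max_ge) (auto simp: A_def)
qed

section \<open>The interface function of a typical configuration\<close>

text \<open>
  \<open>reach N P k x t\<close> says that \<open>L(x, t) \<ge> k\<close>, with the supremum replaced by an explicit witness. All
  arguments about the process are made for this relation.
\<close>

definition reach :: "real set \<Rightarrow> (real \<times> real) set \<Rightarrow> int \<Rightarrow> real \<Rightarrow> real \<Rightarrow> bool" where
  "reach N P k x t \<longleftrightarrow>
     (\<exists>z\<le>x. \<exists>C. chain_in P z x t C \<and> real_of_int k \<le> signed_count N z + real (card C))"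

lemma reachI:
  "z \<le> x \<Longrightarrow> chain_in P z x t C \<Longrightarrow> real_of_int k \<le> signed_count N z + real (card C)
    \<Longrightarrow> reach N P k x t"
  unfolding reach_def by blast

lemma reach_mono: "reach N P k x t \<Longrightarrow> k' \<le> k \<Longrightarrow> x \<le> x' \<Longrightarrow> t \<le> t' \<Longrightarrow> reach N P k' x' t'"
  unfolding reach_def by (meson chain_in_mono of_int_le_iff order_refl order_trans)

lemma card_Int_Ioc_split:
  assumes "\<And>a b. finite (V \<inter> {a<..b :: real})" "a \<le> b" "b \<le> c"
  shows "card (V \<inter> {a<..c}) = card (V \<inter> {a<..b}) + card (V \<inter> {b<..c})"
proof -
  have "V \<inter> {a<..c} = (V \<inter> {a<..b}) \<union> (V \<inter> {b<..c})" using assms(2,3) by auto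
  then show ?thesis by (simp only:) (rule card_Un_disjoint, auto simp: assms(1))
qed

lemma signed_count_diff:
  assumes "\<And>A. bounded A \<Longrightarrow> finite (N \<inter> A)" "x \<le> y"
  shows "signed_count N y - signed_count N x = real (card (N \<inter> {x<..y}))"
proof -
  have fin: "finite (N \<inter> {a<..b})" for a b by (rule assms) simp
  have split: "card (N \<inter> {a<..c}) = card (N \<inter> {a<..b}) + card (N \<inter> {b<..c})" if "a \<le> b" "b \<le> c" for a b c
    by (rule card_Int_Ioc_split[OF fin that])
  consider "0 \<le> x" | "x < 0" "0 \<le> y" | "y < 0" by linarith
  then show ?thesis
  proof cases
    case 1 then show ?thesis using assms(2) split[of 0 x y] by (simp add: signed_count_def)
  next
    case 2 then show ?thesis using split[of x 0 y] by (simp add: signed_count_def)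
  next
    case 3 then show ?thesis using assms(2) split[of x y 0] by (simp add: signed_count_def)
  qed
qed

lemma signed_count_integer: "\<exists>i. signed_count N x = real_of_int i"
proof -
  have "signed_count N x = real_of_int (if x \<ge> 0 then int (card (N \<inter> {0<..x})) else - int (card (N \<inter> {x<..0})))"
    by (simp add: signed_count_def)
  then show ?thesis by blast
qed

text \<open>
  The growth condition makes chains that start far to the left useless for reaching a given level. It bounds
  the supremum in the variational formula and, what is more, localises it: \<open>reach_window\<close>.
\<close>

locale hammersley_data =
  fixes N :: "real set" and P :: "(real \<times> real) set"
  assumes finite_N: "bounded A \<Longrightarrow> finite (N \<inter> A)"
    and finite_P: "bounded B \<Longrightarrow> finite (P \<inter> B)"
    and distinct_times: "(x, s) \<in> P \<Longrightarrow> (y, s) \<in> P \<Longrightarrow> 0 < s \<Longrightarrow> x = y"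
    and distinct_positions: "(x, s) \<in> P \<Longrightarrow> (x, r) \<in> P \<Longrightarrow> 0 < s \<Longrightarrow> 0 < r \<Longrightarrow> s = r"
    and positions_not_initial: "(x, s) \<in> P \<Longrightarrow> 0 < s \<Longrightarrow> x \<notin> N"
    and growth: "\<exists>Z. \<forall>z\<le>Z. \<forall>C. chain_in P z X T C \<longrightarrow>
                   signed_count N z + real (card C) < real_of_int K"
begin

lemma finite_P_box: "finite (P \<inter> ({a<..b} \<times> {c<..d}))"
  by (intro finite_P bounded_Times) auto

lemma signed_count_mono: "x \<le> y \<Longrightarrow> signed_count N x \<le> signed_count N y"
  using signed_count_diff[OF finite_N, of x y] by simp

lemma reach_window:
  obtains Z where "\<And>k x t z C. K \<le> k \<Longrightarrow> x \<le> X \<Longrightarrow> t \<le> T \<Longrightarrow> chain_in P z x t C \<Longrightarrow>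
      real_of_int k \<le> signed_count N z + real (card C) \<Longrightarrow> Z < z"
proof -
  obtain Z where Z: "\<And>z C. z \<le> Z \<Longrightarrow> chain_in P z X T C \<Longrightarrow>
      signed_count N z + real (card C) < real_of_int K"
    using growth by metis
  have "Z < z" if "K \<le> k" "x \<le> X" "t \<le> T" "chain_in P z x t C"
    "real_of_int k \<le> signed_count N z + real (card C)" for k x t z C
  proof (rule ccontr)
    assume "\<not> Z < z"
    then have "signed_count N z + real (card C) < real_of_int K"
      using that by (intro Z) (auto intro: chain_in_mono)
    then show False using that(1,5) by linarith
  qed
  then show ?thesis by (rule that)
qed

text \<open>
  The supremum is attained and integral, so nothing is lost by rounding.
\<close>

definition level :: "real \<Rightarrow> real \<Rightarrow> int" where
  "level x t = \<lfloor>hammersley_L N P x t\<rfloor>"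

lemma
  shows hammersley_L_level: "hammersley_L N P x t = real_of_int (level x t)"
    and reach_iff_level: "reach N P k x t \<longleftrightarrow> k \<le> level x t"
proof -
  define v where "v z = signed_count N z + real (last_passage P (z, 0) (x, t))" for z
  have L: "hammersley_L N P x t = (SUP z\<in>{..x}. v z)" by (simp add: hammersley_L_def v_def)
  obtain Z where Z: "\<And>k z C. 0 \<le> k \<Longrightarrow> chain_in P z x t C \<Longrightarrow>
      real_of_int k \<le> signed_count N z + real (card C) \<Longrightarrow> Z < z"
    using reach_window[of 0 x t] by (metis order_refl)
  have "v z \<le> \<bar>signed_count N x\<bar> + real (card (P \<inter> ({Z<..x} \<times> {0<..t})))" if "z \<le> x" for z
  proof -
    obtain C where C: "chain_in P z x t C" "card C = last_passage P (z, 0) (x, t)"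
      using last_passage_attained[OF finite_P_box] by blast
    show ?thesis
    proof (cases "0 \<le> v z")
      case True
      then have "Z < z" using Z[of 0 z C] C by (simp add: v_def)
      then have "card C \<le> card (P \<inter> ({Z<..x} \<times> {0<..t}))"
        using C(1) by (intro card_mono finite_P_box) (auto simp: chain_in_def)
      then show ?thesis using signed_count_mono[OF that] C(2) by (simp add: v_def)
    qed linarith
  qed
  then have bdd: "bdd_above (v ` {..x})" by (auto intro!: bdd_aboveI)
  have int: "\<exists>i. v z = real_of_int i" for z
  proof -
    obtain i where "signed_count N z = real_of_int i" using signed_count_integer by blast
    then have "v z = real_of_int (i + int (last_passage P (z, 0) (x, t)))" by (simp add: v_def)
    then show ?thesis by blast
  qed
  have reach: "reach N P k x t \<longleftrightarrow> real_of_int k \<le> hammersley_L N P x t" for k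
  proof
    assume "reach N P k x t"
    then obtain z C where z: "z \<le> x" "chain_in P z x t C" "real_of_int k \<le> signed_count N z + real (card C)"
      unfolding reach_def by blast
    then have "real_of_int k \<le> v z"
      using card_chain_le_last_passage[OF finite_P_box z(2)] unfolding v_def by linarith
    also have "\<dots> \<le> hammersley_L N P x t" unfolding L using z(1) bdd by (intro cSUP_upper) auto
    finally show "real_of_int k \<le> hammersley_L N P x t" .
  next
    assume "real_of_int k \<le> hammersley_L N P x t"
    then have "real_of_int k - 1 < (SUP z\<in>{..x}. v z)" unfolding L by linarith
    then obtain z where z: "z \<le> x" "real_of_int k - 1 < v z"
      using less_cSUP_iff[OF _ bdd] by auto
    obtain i where "v z = real_of_int i" using int by blast
    then have "real_of_int (k - 1) < real_of_int i" using z(2) by simp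
    then have "k \<le> i" unfolding of_int_less_iff by simp
    then have "real_of_int k \<le> v z" using \<open>v z = real_of_int i\<close> by simp
    obtain C where C: "chain_in P z x t C" "card C = last_passage P (z, 0) (x, t)"
      using last_passage_attained[OF finite_P_box] by blast
    then show "reach N P k x t" using z(1) \<open>real_of_int k \<le> v z\<close>
      by (auto simp: v_def intro: reachI)
  qed
  then show "reach N P k x t \<longleftrightarrow> k \<le> level x t" by (simp add: level_def le_floor_iff)
  have "(SUP z\<in>{..x}. v z) \<le> real_of_int (level x t)"
  proof (rule cSUP_least)
    fix z assume "z \<in> {..x}"
    then have "v z \<le> hammersley_L N P x t" unfolding L using bdd by (intro cSUP_upper)
    then show "v z \<le> real_of_int (level x t)" using int[of z] by (auto simp: level_def le_floor_iff)
  qed auto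
  then have "hammersley_L N P x t \<le> real_of_int (level x t)" by (simp only: L)
  then show "hammersley_L N P x t = real_of_int (level x t)"
    using of_int_floor_le[of "hammersley_L N P x t"] unfolding level_def by linarith
qed

lemma level_mono: "x \<le> y \<Longrightarrow> s \<le> t \<Longrightarrow> level x s \<le> level y t"
  using reach_iff_level reach_mono by (meson order_refl)

text \<open>
  Immediately to the right of \<open>x\<close> the window contains no further atom and no further point, so a witness for a
  larger abscissa either fits below \<open>x\<close> already or starts to the right of \<open>x\<close> with an empty chain.
\<close>

lemma eventually_level_at_right: "\<forall>\<^sub>F y in at_right x. level y t = level x t"
proof -
  define K where "K = level x t + 1"
  obtain Z where Z: "\<And>y z C. y \<le> x + 1 \<Longrightarrow> chain_in P z y t C \<Longrightarrow>
      real_of_int K \<le> signed_count N z + real (card C) \<Longrightarrow> Z < z"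
    using reach_window[of K "x + 1" t] by (metis order_refl)
  define F where "F = fst ` (P \<inter> ({Z<..x + 1} \<times> {0<..t})) \<union> N \<inter> {x<..x + 1}"
  have "finite F" unfolding F_def by (intro finite_UnI finite_imageI finite_P_box finite_N) auto
  from eventually_at_right_avoids_finite[OF this, of x] eventually_just_right[of 1 x, OF zero_less_one]
  have "\<forall>\<^sub>F y in at_right x. F \<inter> {x<..y} = {} \<and> x < y \<and> y < x + 1"
    by eventually_elim auto
  then show ?thesis
  proof eventually_elim
    case (elim y)
    have "reach N P K x t" if "reach N P K y t"
    proof -
      obtain z C where z: "z \<le> y" "chain_in P z y t C" "real_of_int K \<le> signed_count N z + real (card C)"
        using \<open>reach N P K y t\<close> unfolding reach_def by blast
      have "Z < z" using Z[OF _ z(2,3)] elim by linarith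
      have F: "fst q \<in> F" if "q \<in> C" for q
        unfolding F_def using chain_inD[OF z(2) that] \<open>Z < z\<close> elim
        by (intro UnI1 imageI mem_box) linarith+
      have *: "C \<subseteq> {z<..x} \<times> UNIV"
      proof
        fix q assume "q \<in> C"
        then have "fst q \<in> F" "z < fst q" "fst q \<le> y" using F chain_inD[OF z(2)] by auto
        moreover have "\<not> (x < fst q \<and> fst q \<le> y)" using elim \<open>fst q \<in> F\<close> by auto
        ultimately show "q \<in> {z<..x} \<times> UNIV" by (cases q) auto
      qed
      show ?thesis
      proof (cases "z \<le> x")
        case True
        then show ?thesis using z * unfolding chain_in_def
          by (intro reachI[of z _ _ _ C]) (auto simp: chain_in_def)
      next
        case False
        then have "C = {}" using * by fastforce
        moreover have "N \<inter> {x<..z} = {}" using elim z(1) by (auto simp: F_def)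
        then have "signed_count N z = signed_count N x"
          using signed_count_diff[OF finite_N, of x z] False by simp
        ultimately show ?thesis using z(3) by (intro reachI[of x _ _ _ "{}"]) auto
      qed
    qed
    then have "\<not> K \<le> level y t" by (auto simp: reach_iff_level K_def)
    then show ?case using level_mono[of x y t t] elim by (simp add: K_def)
  qed
qed

text \<open>
  Steps have height at most one: a chain meets a vertical line in at most one point, and a path that starts on
  the line has an empty chain and gains at most the one atom that can sit there.
\<close>

lemma eventually_level_at_left: "\<forall>\<^sub>F x in at_left y. level y t - 1 \<le> level x t"
proof -
  define k where "k = level y t"
  obtain z C where z: "z \<le> y" "chain_in P z y t C" "real_of_int k \<le> signed_count N z + real (card C)"
    using reach_iff_level[of k y t] unfolding reach_def k_def by auto
  show ?thesis
  proof (cases "z = y")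
    case True
    have "C = {}" using z(2) True by (auto simp: chain_in_def)
    have "finite (N \<inter> {y - 1..y})" by (intro finite_N) auto
    from eventually_at_left_avoids_finite[OF this, of y] eventually_just_left[of 1 y, OF zero_less_one]
    have "\<forall>\<^sub>F x in at_left y. N \<inter> {x..<y} = {} \<and> x < y"
      by eventually_elim auto
    then show ?thesis
    proof eventually_elim
      case (elim x)
      then have "N \<inter> {x<..y} \<subseteq> {y}" by force
      then have "card (N \<inter> {x<..y}) \<le> 1" using card_mono[of "{y}"] by simp
      then have "signed_count N y - signed_count N x \<le> 1"
        using signed_count_diff[OF finite_N, of x y] elim by simp
      then have "reach N P (k - 1) x t" using z(3) True \<open>C = {}\<close>
        by (intro reachI[of x _ _ _ "{}"]) auto
      then show ?case by (simp add: reach_iff_level k_def)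
    qed
  next
    case False
    define D where "D = {q \<in> C. fst q < y}"
    have CD: "C - D \<subseteq> {q}" if "q \<in> C - D" for q
    proof
      fix p assume "p \<in> C - D"
      then have "fst p = y" "fst q = y" "p \<in> C" "q \<in> C" using that z(2) by (auto simp: D_def chain_in_def)
      moreover have "increasing_chain C" using z(2) by (simp add: chain_in_def)
      ultimately show "p \<in> {q}" using increasing_chainD[of C p q] by auto
    qed
    have fin: "finite C" using z(2) by (simp add: chain_in_def)
    have "card (C - D) \<le> 1"
    proof (cases "C - D = {}")
      case True then show ?thesis by (simp only: card.empty)
    next
      case False
      then obtain q where "q \<in> C - D" by blast
      from CD[OF this] show ?thesis using card_mono[of "{q}" "C - D"] by simp
    qed
    then have card: "card C \<le> card D + 1" using fin by (subst (asm) card_Diff_subset) (auto simp: D_def)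
    have "finite (insert z (fst ` D))" using fin by (simp add: D_def)
    from eventually_at_left_avoids_finite[OF this, of y] eventually_just_left[of 1 y, OF zero_less_one]
    have "\<forall>\<^sub>F x in at_left y. insert z (fst ` D) \<inter> {x..<y} = {} \<and> x < y"
      by eventually_elim auto
    then show ?thesis
    proof eventually_elim
      case (elim x)
      then have "z \<le> x" using z(1) False by force
      moreover have "chain_in P z x t D"
      proof -
        have "fst q \<le> x" if "q \<in> D" for q
        proof -
          have "fst q \<notin> {x..<y}" using elim that by blast
          then show ?thesis using that by (auto simp: D_def)
        qed
        then show ?thesis using z(2) increasing_chain_subset[of C D] fin
          unfolding chain_in_def by (auto simp: D_def)
      qed
      ultimately have "reach N P (k - 1) x t" using z(3) card by (intro reachI[of z _ _ _ D]) auto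
      then show ?case by (simp add: reach_iff_level k_def)
    qed
  qed
qed

lemma particles_iff: "y \<in> particles (hammersley N P t) \<longleftrightarrow> (\<forall>x<y. level x t < level y t)"
proof -
  let ?F = "\<lambda>x. hammersley_L N P x t"
  have mono: "x \<le> y \<Longrightarrow> ?F x \<le> ?F y" for x y by (simp add: hammersley_L_level level_mono)
  have cont: "continuous (at_right a) ?F" for a
    unfolding continuous_within hammersley_L_level
    by (rule tendsto_eventually) (use eventually_level_at_right[of t a] in \<open>eventually_elim, simp\<close>)
  show ?thesis
  proof (cases "\<forall>x<y. level x t < level y t")
    case True
    have "\<forall>\<^sub>F x in at_left y. ?F x = real_of_int (level y t) - 1"
      using eventually_level_at_left[where y=y and t=t] eventually_just_left[of 1 y, OF zero_less_one]
      by eventually_elim (use True in \<open>force simp: hammersley_L_level\<close>)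
    from emeasure_interval_measure_atom[OF mono cont this] show ?thesis using True
      by (simp add: particles_def hammersley_def hammersley_L_level)
  next
    case False
    then obtain x0 where "x0 < y" "level x0 t \<ge> level y t" by (auto simp: not_less)
    then have "?F x = real_of_int (level y t)" if "x0 < x" "x < y" for x
      using that level_mono[of x0 x t t] level_mono[of x y t t] by (simp add: hammersley_L_level)
    then have "\<forall>\<^sub>F x in at_left y. ?F x = real_of_int (level y t)"
      using eventually_just_left[of "y - x0" y] \<open>x0 < y\<close> by (auto elim: eventually_mono)
    from emeasure_interval_measure_atom[OF mono cont this] show ?thesis using False
      by (simp add: particles_def hammersley_def hammersley_L_level)
  qed
qed

lemma level_threshold:
  assumes "level p t < k" "k \<le> level w t"
  obtains c where "p < c" "c \<le> w" "\<And>v. k \<le> level v t \<longleftrightarrow> c \<le> v"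
proof -
  define A where "A = {v. k \<le> level v t}"
  have lower: "p < v" if "v \<in> A" for v
    using that assms(1) level_mono[of v p t t] by (force simp: A_def not_le[symmetric])
  have bdd: "bdd_below A" using lower by (meson bdd_belowI less_imp_le)
  have w: "w \<in> A" using assms by (simp add: A_def)
  define c where "c = Inf A"
  have above: "v \<in> A" if "c < v" for v
  proof -
    obtain a where "a \<in> A" "a < v" using cInf_lessD[of A v] w \<open>c < v\<close> unfolding c_def by blast
    then show ?thesis using level_mono[of a v t t] by (auto simp: A_def)
  qed
  obtain v where "c < v" "level v t = level c t"
    using eventually_happens[OF eventually_conj[OF eventually_level_at_right eventually_at_right_less]]
    by (auto simp: trivial_limit_at_right_real)
  then have c: "c \<in> A" using above[of v] by (simp add: A_def)
  have "k \<le> level v t \<longleftrightarrow> c \<le> v" for v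
    using above[of v] c cInf_lower[OF _ bdd, of v] by (cases "v = c") (auto simp: A_def c_def)
  then show ?thesis using that[of c] lower[OF c] cInf_lower[OF w bdd] by (simp add: c_def)
qed

lemma level_constant_without_particles:
  assumes "particles (hammersley N P t) \<inter> {p<..<y} = {}" "p \<le> w" "w < y"
  shows "level w t = level p t"
proof (rule ccontr)
  assume "level w t \<noteq> level p t"
  then have "level p t < level p t + 1" "level p t + 1 \<le> level w t"
    using level_mono[OF assms(2) order_refl, of t] by auto
  from level_threshold[OF this] obtain c where
    c: "p < c" "c \<le> w" "\<And>v. level p t + 1 \<le> level v t \<longleftrightarrow> c \<le> v" by blast
  then have "level x t < level c t" if "x < c" for x
    using that by (metis le_less_trans not_less order_refl zless_imp_add1_zle not_le)
  then have "c \<in> particles (hammersley N P t)" by (simp add: particles_iff)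
  then show False using assms c by auto
qed

lemma eventually_reach_at_right:
  "\<forall>\<^sub>F r in at_right t. \<forall>k\<ge>K. \<forall>x\<le>X. reach N P k x r \<longleftrightarrow> reach N P k x t"
proof -
  obtain Z where Z: "\<And>k x r z C. K \<le> k \<Longrightarrow> x \<le> X \<Longrightarrow> r \<le> t + 1 \<Longrightarrow> chain_in P z x r C \<Longrightarrow>
      real_of_int k \<le> signed_count N z + real (card C) \<Longrightarrow> Z < z"
    using reach_window[of K X "t + 1"] by metis
  define F where "F = snd ` (P \<inter> ({Z<..X} \<times> {0<..t + 1}))"
  have "finite F" unfolding F_def by (intro finite_imageI finite_P_box)
  from eventually_at_right_avoids_finite[OF this, of t] eventually_just_right[of 1 t, OF zero_less_one]
  have "\<forall>\<^sub>F r in at_right t. F \<inter> {t<..r} = {} \<and> t < r \<and> r < t + 1"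
    by eventually_elim auto
  then show ?thesis
  proof eventually_elim
    case (elim r)
    have "reach N P k x t" if k: "K \<le> k" "x \<le> X" and R: "reach N P k x r" for k x
    proof -
      obtain z C where z: "z \<le> x" "chain_in P z x r C" "real_of_int k \<le> signed_count N z + real (card C)"
        using R unfolding reach_def by blast
      have "Z < z" using Z[OF k _ z(2,3)] elim by auto
      have "snd q \<le> t" if "q \<in> C" for q
      proof -
        have "q \<in> P \<inter> ({Z<..X} \<times> {0<..t + 1})"
          using chain_inD[OF z(2) that] \<open>Z < z\<close> elim k by (intro mem_box) linarith+
        then have "snd q \<in> F" unfolding F_def by blast
        moreover have "snd q \<le> r" using chain_inD[OF z(2) that] by simp
        ultimately have "\<not> t < snd q" using elim by auto
        then show ?thesis by simp
      qed
      then have "chain_in P z x t C" using z(2) by (fastforce simp: chain_in_def)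
      then show ?thesis using z by (auto intro: reachI)
    qed
    then show ?case using elim reach_mono[of N P _ _ t _ _ r] by auto
  qed
qed

text \<open>
  The jump rule in terms of levels: a point \<open>(p, s)\<close> raises by one the level at every \<open>x \<ge> p\<close> that equals the
  level at \<open>p\<close>. The bound \<open>r0\<close> is uniform over \<open>x \<le> X\<close> and \<open>k \<ge> K\<close>, because only the finitely many points
  of a window are involved.
\<close>

lemma reach_update:
  assumes "0 < s"
  shows "\<exists>r0>0. r0 < s \<and>
    (\<forall>k\<ge>K. \<forall>x\<le>X. \<forall>r. r0 < r \<longrightarrow> r < s \<longrightarrow>
       (reach N P k x s \<longleftrightarrow> reach N P k x r \<or> (\<exists>p\<le>x. (p, s) \<in> P \<and> reach N P (k - 1) p r))) \<and>
    (\<forall>k\<ge>K. \<forall>x\<le>X. \<forall>r r'. r0 < r \<longrightarrow> r < s \<longrightarrow> r0 < r' \<longrightarrow> r' < s \<longrightarrow>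
       (reach N P k x r \<longleftrightarrow> reach N P k x r'))"
proof -
  obtain Z where Z: "\<And>k x r z C. K \<le> k \<Longrightarrow> x \<le> X \<Longrightarrow> r \<le> s \<Longrightarrow> chain_in P z x r C \<Longrightarrow>
      real_of_int k \<le> signed_count N z + real (card C) \<Longrightarrow> Z < z"
    using reach_window[of K X s] by metis
  define F where "F = snd ` (P \<inter> ({Z<..X} \<times> {0<..s}))"
  have "finite F" unfolding F_def by (intro finite_imageI finite_P_box)
  from eventually_conj[OF eventually_at_left_avoids_finite[OF this, of s] eventually_at_left_real[OF assms]]
  obtain r0 where r0: "F \<inter> {r0..<s} = {}" "0 < r0" "r0 < s"
    using eventually_happens by (force simp: trivial_limit_at_left_real)
  have inF: "snd q \<in> F" if "K \<le> k" "x \<le> X" "r \<le> s" "chain_in P z x r C"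
      "real_of_int k \<le> signed_count N z + real (card C)" "q \<in> C" for k x r z C q
  proof -
    have "q \<in> P \<inter> ({Z<..X} \<times> {0<..s})"
      using Z[OF that(1-5)] chain_inD[OF that(4,6)] that(2,3) by (intro mem_box) linarith+
    then show ?thesis unfolding F_def by blast
  qed
  have early: "reach N P k x r'" if prem: "K \<le> k" "x \<le> X" "r0 < r'" "r \<le> s" "z \<le> x" "chain_in P z x r C"
      "real_of_int k \<le> signed_count N z + real (card C)" "\<And>q. q \<in> C \<Longrightarrow> snd q < s" for k x r r' z C
  proof -
    have "snd q \<le> r'" if "q \<in> C" for q
    proof -
      have "snd q \<in> F" by (rule inF[OF prem(1,2,4,6,7) that])
      then have "\<not> (r0 \<le> snd q \<and> snd q < s)" using r0(1) by auto
      then show ?thesis using prem(8)[OF that] prem(3) by auto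
    qed
    then have "chain_in P z x r' C" using prem(6) by (fastforce simp: chain_in_def)
    then show ?thesis using that by (auto intro: reachI)
  qed
  have const: "reach N P k x r'" if "K \<le> k" "x \<le> X" "r0 < r" "r < s" "r0 < r'" "r' < s" "reach N P k x r" for k x r r'
  proof -
    obtain z C where z: "z \<le> x" "chain_in P z x r C" "real_of_int k \<le> signed_count N z + real (card C)"
      using \<open>reach N P k x r\<close> unfolding reach_def by blast
    show ?thesis using that z by (intro early[of k x r' r z C]) (auto simp: chain_in_def)
  qed
  have upd: "reach N P k x s \<longleftrightarrow> reach N P k x r \<or> (\<exists>p\<le>x. (p, s) \<in> P \<and> reach N P (k - 1) p r)"
    if k: "K \<le> k" "x \<le> X" "r0 < r" "r < s" for k x r
  proof
    assume "reach N P k x s"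
    then obtain z C where z: "z \<le> x" "chain_in P z x s C" "real_of_int k \<le> signed_count N z + real (card C)"
      unfolding reach_def by blast
    show "reach N P k x r \<or> (\<exists>p\<le>x. (p, s) \<in> P \<and> reach N P (k - 1) p r)"
    proof (cases "\<exists>p. (p, s) \<in> C")
      case False
      then have "snd q < s" if "q \<in> C" for q
        using False that chain_inD[OF z(2) that] by (cases q) (auto simp: less_le)
      then show ?thesis using early[of k x r s z C] k z by auto
    next
      case True
      then obtain p where p: "(p, s) \<in> C" by blast
      have other: "fst q < p \<and> snd q \<le> r" if "q \<in> C - {(p, s)}" for q
      proof -
        have "snd q \<le> s" using chain_inD[OF z(2), of q] that by simp
        then have "fst q < p \<and> snd q < s" using increasing_chainD[of C q "(p, s)"] that p z(2)
          unfolding chain_in_def by auto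
        moreover have "snd q \<in> F" using inF[of k x s z C q] that k z by auto
        moreover have "\<not> (r0 \<le> snd q \<and> snd q < s)" using r0(1) \<open>snd q \<in> F\<close> by auto
        ultimately show ?thesis using k by auto
      qed
      have "q \<in> P \<inter> ({z<..p} \<times> {0<..r})" if "q \<in> C - {(p, s)}" for q
        using chain_inD[OF z(2), of q] other[OF that] that by (intro mem_box) auto
      then have "chain_in P z p r (C - {(p, s)})"
        using z(2) increasing_chain_subset[of C "C - {(p, s)}"]
        unfolding chain_in_def by blast
      moreover have "card C = Suc (card (C - {(p, s)}))"
        using p z(2) by (intro card.remove) (auto simp: chain_in_def)
      moreover have "z \<le> p" "p \<le> x" "(p, s) \<in> P" using p z(2) by (auto simp: chain_in_def)
      ultimately have "reach N P (k - 1) p r" using z(3) by (intro reachI[of z _ _ _ "C - {(p, s)}"]) auto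
      then show ?thesis using \<open>p \<le> x\<close> \<open>(p, s) \<in> P\<close> by blast
    qed
  next
    assume "reach N P k x r \<or> (\<exists>p\<le>x. (p, s) \<in> P \<and> reach N P (k - 1) p r)"
    then show "reach N P k x s"
    proof (elim disjE exE conjE)
      assume "reach N P k x r" then show ?thesis using k by (auto intro: reach_mono)
    next
      fix p assume p: "p \<le> x" "(p, s) \<in> P" and "reach N P (k - 1) p r"
      then obtain z C where z: "z \<le> p" "chain_in P z p r C"
          "real_of_int (k - 1) \<le> signed_count N z + real (card C)"
        unfolding reach_def by blast
      have before: "fst q < p \<and> snd q < s" if "q \<in> C" for q
      proof -
        note q = chain_inD[OF z(2) that]
        then have "fst q \<noteq> p" using distinct_positions[of p s "snd q"] p(2) k assms by (cases q) auto
        then show ?thesis using q k by auto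
      qed
      obtain z' where z': "z' \<le> z" "z' < p" "signed_count N z' = signed_count N z"
      proof (cases "z = p")
        case True
        have "finite (N \<inter> {p - 1..p})" by (intro finite_N) auto
        from eventually_conj[OF eventually_at_left_avoids_finite[OF this, of p] eventually_at_left_real[of "p - 1" p]]
        obtain z' where w: "N \<inter> {p - 1..p} \<inter> {z'..<p} = {}" "p - 1 < z'" "z' < p"
          using eventually_happens by (force simp: trivial_limit_at_left_real)
        have "p \<notin> N" using positions_not_initial p(2) assms by blast
        have "N \<inter> {z'<..p} = {}"
        proof (rule ccontr)
          assume "N \<inter> {z'<..p} \<noteq> {}"
          then obtain v where "v \<in> N" "z' < v" "v \<le> p" by auto
          moreover have "v \<noteq> p" using \<open>v \<in> N\<close> \<open>p \<notin> N\<close> by blast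
          ultimately have "v \<in> N \<inter> {p - 1..p} \<inter> {z'..<p}" using w by auto
          then show False using w by blast
        qed
        then have "signed_count N z' = signed_count N p"
          using signed_count_diff[OF finite_N, of z' p] w by simp
        then show ?thesis using that w True by auto
      next
        case False then show ?thesis using that[of z] z(1) by auto
      qed
      have fresh: "(p, s) \<notin> C" using before by fastforce
      have "chain_in P z' x s (insert (p, s) C)"
        unfolding chain_in_def
      proof (intro conjI)
        show "finite (insert (p, s) C)" using z(2) by (simp add: chain_in_def)
        show "increasing_chain (insert (p, s) C)"
          using z(2) before by (intro increasing_chain_insert) (auto simp: chain_in_def)
        have "q \<in> P \<inter> ({z'<..x} \<times> {0<..s})" if "q \<in> C" for q
          using chain_inD[OF z(2) that] before[OF that] z' p(1) by (intro mem_box) linarith+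
        then show "insert (p, s) C \<subseteq> P \<inter> ({z'<..x} \<times> {0<..s})" using p z' assms by auto
      qed
      then show ?thesis
        using z' p z(2,3) fresh by (intro reachI[of z' _ _ _ "insert (p, s) C"]) (auto simp: chain_in_def)
    qed
  qed
  have const': "reach N P k x r \<longleftrightarrow> reach N P k x r'"
    if "K \<le> k" "x \<le> X" "r0 < r" "r < s" "r0 < r'" "r' < s" for k x r r'
    using const[OF that] const[OF that(1,2,5,6,3,4)] by (rule iffI)
  show ?thesis
  proof (rule exI[of _ r0], intro conjI allI impI)
    fix k x r assume "K \<le> k" "x \<le> X" "r0 < r" "r < s"
    then show "reach N P k x s \<longleftrightarrow> reach N P k x r \<or> (\<exists>p\<le>x. (p, s) \<in> P \<and> reach N P (k - 1) p r)"
      by (rule upd)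
  next
    fix k x r r' assume "K \<le> k" "x \<le> X" "r0 < r" "r < s" "r0 < r'" "r' < s"
    then show "reach N P k x r \<longleftrightarrow> reach N P k x r'" by (rule const')
  qed (fact r0)+
qed

end

section \<open>The trajectory of the tagged particle\<close>

text \<open>
  Continuous induction in time: two trajectories that agree before \<open>s\<close> have the same left limit at \<open>s\<close>, this
  limit and the configuration determine the value at \<open>s\<close>, and right-continuity carries the agreement
  beyond \<open>s\<close>.
\<close>

lemma particle_path_unique:assumes f: "particle_path N P z f" and g: "particle_path N P z g" and "0 \<le> t"
  shows "f t = g t"
proof (rule ccontr)
  assume "f t \<noteq> g t"
  define B where "B = {s. 0 \<le> s \<and> f s \<noteq> g s}"
  have t: "t \<in> B" using assms(3) \<open>f t \<noteq> g t\<close> by (simp add: B_def)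
  have bdd: "bdd_below B" by (auto simp: B_def)
  define s where "s = Inf B"
  have "0 \<le> s" unfolding s_def using t by (intro cInf_greatest) (auto simp: B_def)
  have before: "f r = g r" if "0 \<le> r" "r < s" for r
    using cInf_lower[OF _ bdd, of r] that by (auto simp: s_def B_def)
  have at: "f s = g s"
  proof (cases "s = 0")
    case True then show ?thesis using f g by (simp add: particle_path_def)
  next
    case False
    then have "0 < s" using \<open>0 \<le> s\<close> by simp
    obtain y where y: "\<forall>\<^sub>F r in at_left s. f r = y"
        "\<And>x. jumps_to N P s y x \<Longrightarrow> f s = x" "(\<nexists>x. jumps_to N P s y x) \<Longrightarrow> f s = y"
      using f \<open>0 < s\<close> unfolding particle_path_def by metis
    obtain y' where y': "\<forall>\<^sub>F r in at_left s. g r = y'"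
        "\<And>x. jumps_to N P s y' x \<Longrightarrow> g s = x" "(\<nexists>x. jumps_to N P s y' x) \<Longrightarrow> g s = y'"
      using g \<open>0 < s\<close> unfolding particle_path_def by metis
    have "\<forall>\<^sub>F r in at_left s. y = y'"
      using y(1) y'(1) eventually_just_left[OF \<open>0 < s\<close>, of s]
      by eventually_elim (use before in auto)
    then have "y = y'" by (simp add: trivial_limit_at_left_real)
    then show ?thesis using y y' by metis
  qed
  have "\<forall>\<^sub>F r in at_right s. f r = f s" "\<forall>\<^sub>F r in at_right s. g r = g s"
    using f g \<open>0 \<le> s\<close> by (auto simp: particle_path_def)
  then have "\<forall>\<^sub>F r in at_right s. f r = g r" by eventually_elim (simp add: at)
  then obtain b where b: "s < b" "\<And>r. s < r \<Longrightarrow> r < b \<Longrightarrow> f r = g r"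
    by (auto simp: eventually_at_right_field)
  obtain r where r: "r \<in> B" "r < b" using cInf_lessD[of B b] t b(1) unfolding s_def by blast
  then have "s \<le> r" using cInf_lower[OF _ bdd] by (simp add: s_def)
  then have "f r = g r" using b(2)[of r] r(2) at by (cases "r = s") auto
  then show False using r(1) by (simp add: B_def)
qed

lemma particle_position_eqI:
  assumes "particle_path N P z f" "0 \<le> t"
  shows "particle_position N P z t = f t"
  unfolding particle_position_def
  using assms particle_path_unique by (intro the_equality) blast+

context hammersley_data begin

lemma level_below_zero: obtains p where "level p t < 0" "p \<le> 0"
proof -
  obtain Z where Z: "\<And>k x r z C. 0 \<le> k \<Longrightarrow> x \<le> 0 \<Longrightarrow> r \<le> t \<Longrightarrow> chain_in P z x r C \<Longrightarrow>
      real_of_int k \<le> signed_count N z + real (card C) \<Longrightarrow> Z < z"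
    using reach_window[of 0 0 t] by metis
  have "\<not> reach N P 0 (min Z 0) t"
    using Z[of 0 "min Z 0" t] unfolding reach_def by fastforce
  then show ?thesis using that[of "min Z 0"] by (simp add: reach_iff_level)
qed

lemma level_zero_nonneg: "0 \<le> level 0 t"
  unfolding reach_iff_level[symmetric]
  by (rule reachI[of 0 _ _ _ "{}"]) (auto simp: signed_count_def)

definition tagged :: "real \<Rightarrow> real" where
  "tagged t = (SOME c. \<forall>v. 0 \<le> level v t \<longleftrightarrow> c \<le> v)"

lemma tagged_le_iff: "tagged t \<le> v \<longleftrightarrow> 0 \<le> level v t"
proof -
  obtain p where p: "level p t < 0" by (rule level_below_zero)
  obtain c where "\<forall>v. 0 \<le> level v t \<longleftrightarrow> c \<le> v"
    by (rule level_threshold[OF p level_zero_nonneg]) blast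
  then have "\<forall>v. 0 \<le> level v t \<longleftrightarrow> tagged t \<le> v" unfolding tagged_def by (rule someI)
  then show ?thesis by simp
qed

lemma tagged_nonpos: "tagged t \<le> 0"
  by (simp add: tagged_le_iff level_zero_nonneg)

lemma tagged_eqI:
  assumes "\<And>x. x \<le> 0 \<Longrightarrow> reach N P 0 x s \<longleftrightarrow> c \<le> x" "c \<le> 0"
  shows "tagged s = c"
proof -
  have "tagged s \<le> x \<longleftrightarrow> c \<le> x" if "x \<le> 0" for x
    using assms(1)[OF that] by (simp add: reach_iff_level tagged_le_iff)
  from this[of c] this[of "tagged s"] show ?thesis using assms(2) tagged_nonpos[of s] by auto
qed

lemma tagged_initial: assumes "0 \<in> N" shows "tagged 0 = 0"
proof (rule tagged_eqI)
  fix x :: real assume "x \<le> 0"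
  show "reach N P 0 x 0 \<longleftrightarrow> 0 \<le> x"
  proof
    assume "reach N P 0 x 0"
    then obtain z C where z: "z \<le> x" "chain_in P z x 0 C" "0 \<le> signed_count N z + real (card C)"
      unfolding reach_def by auto
    then have "C = {}" by (auto simp: chain_in_def)
    show "0 \<le> x"
    proof (rule ccontr)
      assume "\<not> 0 \<le> x"
      then have "z < 0" using z by simp
      then have "card (N \<inter> {z<..0}) > 0" using assms by (auto simp: card_gt_0_iff finite_N)
      then have "signed_count N z < 0" using \<open>z < 0\<close> by (simp add: signed_count_def)
      then show False using z \<open>C = {}\<close> by simp
    qed
  next
    assume "0 \<le> x"
    then have "x = 0" using \<open>x \<le> 0\<close> by simp
    then show "reach N P 0 x 0" using level_zero_nonneg by (simp add: reach_iff_level)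
  qed
qed simp

text \<open>
  If a point \<open>(x, s)\<close> falls into the gap to the left of the tagged atom \<open>y\<close>, the level on \<open>[x, y)\<close> is
  \<open>-1\<close> just before \<open>s\<close>, and \<open>reach_update\<close> lifts it to \<open>0\<close>: the threshold moves to \<open>x\<close>. Conversely,
  the threshold can only move if some point has level \<open>-1\<close> to its left, and then it lies in that gap.
\<close>

lemma tagged_path: assumes "0 \<in> N" shows "particle_path N P 0 tagged"
  unfolding particle_path_def
proof (intro conjI allI impI)
  show "tagged 0 = 0" by (rule tagged_initial[OF assms])
next
  fix t
  show "tagged t \<in> particles (hammersley N P t)"
    using tagged_le_iff[of t] by (auto simp: particles_iff not_le[symmetric] dest: order_trans)
next
  fix t :: real
  show "\<forall>\<^sub>F r in at_right t. tagged r = tagged t"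
    using eventually_reach_at_right[of 0 0 t]
    by eventually_elim (rule tagged_eqI, auto simp: reach_iff_level tagged_le_iff level_zero_nonneg)
next
  fix s :: real assume "0 < s"
  obtain r0 where r0: "r0 < s" "0 < r0"
    and update: "\<forall>k\<ge>-1. \<forall>x\<le>0. \<forall>r. r0 < r \<longrightarrow> r < s \<longrightarrow>
       (reach N P k x s \<longleftrightarrow> reach N P k x r \<or> (\<exists>p\<le>x. (p, s) \<in> P \<and> reach N P (k - 1) p r))"
    and const: "\<forall>k\<ge>-1. \<forall>x\<le>0. \<forall>r r'. r0 < r \<longrightarrow> r < s \<longrightarrow> r0 < r' \<longrightarrow> r' < s \<longrightarrow>
       (reach N P k x r \<longleftrightarrow> reach N P k x r')"
    using reach_update[OF \<open>0 < s\<close>, of "-1" 0] by (elim exE conjE) (rule that)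
  have upd: "reach N P 0 x s \<longleftrightarrow> reach N P 0 x r \<or> (\<exists>p\<le>x. (p, s) \<in> P \<and> reach N P (-1) p r)"
    if "x \<le> 0" "r0 < r" "r < s" for x r
    using update[rule_format, of 0 x r] that by simp
  define y where "y = tagged ((r0 + s) / 2)"
  have y: "tagged r = y" if "r0 < r" "r < s" for r
    unfolding y_def using that r0
    by (intro tagged_eqI tagged_nonpos)
       (subst const[rule_format, of _ _ _ "(r0 + s) / 2"], auto simp: reach_iff_level tagged_le_iff)
  have lev: "0 \<le> level x r \<longleftrightarrow> y \<le> x" if "r0 < r" "r < s" for r x
    using tagged_le_iff[of r x] y[OF that] by simp
  have "y \<le> 0" unfolding y_def by (rule tagged_nonpos)
  have near: "\<forall>\<^sub>F r in at_left s. r0 < r \<and> r < s"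
    using eventually_just_left[of "s - r0" s] r0 by simp
  have jump: "tagged s = x" if "jumps_to N P s y x" for x
  proof -
    have J: "(x, s) \<in> P" "x < y" "\<forall>\<^sub>F r in at_left s. particles (hammersley N P r) \<inter> {x<..<y} = {}"
      using that by (auto simp: jumps_to_def elim: eventually_mono)
    obtain r where r: "r0 < r" "r < s" "particles (hammersley N P r) \<inter> {x<..<y} = {}"
      using eventually_happens[OF eventually_conj[OF near J(3)]] by (auto simp: trivial_limit_at_left_real)
    obtain w where w: "x < w" "w < y" "level y r - 1 \<le> level w r"
      using eventually_happens[OF eventually_conj[OF eventually_level_at_left eventually_just_left[of "y - x" y]]] J(2)
      by (auto simp: trivial_limit_at_left_real)
    have "level w r = level x r" by (rule level_constant_without_particles[OF r(3)]) (use w in auto)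
    moreover have "0 \<le> level y r" using lev r by simp
    ultimately have "reach N P (-1) x r" using w(3) by (simp add: reach_iff_level)
    show ?thesis
    proof (rule tagged_eqI)
      fix v :: real assume "v \<le> 0"
      have "reach N P 0 v s \<longleftrightarrow> y \<le> v \<or> (\<exists>p\<le>v. (p, s) \<in> P \<and> reach N P (-1) p r)"
        using upd[OF \<open>v \<le> 0\<close> r(1,2)] lev[OF r(1,2)] by (simp add: reach_iff_level)
      also have "\<dots> \<longleftrightarrow> x \<le> v"
      proof
        assume "y \<le> v \<or> (\<exists>p\<le>v. (p, s) \<in> P \<and> reach N P (-1) p r)"
        then show "x \<le> v" using distinct_times[OF J(1) _ \<open>0 < s\<close>] J(2) by auto
      next
        assume "x \<le> v"
        then show "y \<le> v \<or> (\<exists>p\<le>v. (p, s) \<in> P \<and> reach N P (-1) p r)"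
          using J(1) \<open>reach N P (-1) x r\<close> by blast
      qed
      finally show "reach N P 0 v s \<longleftrightarrow> x \<le> v" .
    qed (use J(2) \<open>y \<le> 0\<close> in simp)
  qed
  have stay: "tagged s = y" if none: "\<nexists>x. jumps_to N P s y x"
  proof (rule tagged_eqI)
    fix v :: real assume v: "v \<le> 0"
    define r where "r = (r0 + s) / 2"
    have r: "r0 < r" "r < s" using r0 by (auto simp: r_def)
    have "y \<le> v" if p: "p \<le> v" "(p, s) \<in> P" "reach N P (-1) p r" for p
    proof (rule ccontr)
      assume "\<not> y \<le> v"
      then have "p < y" using p(1) by simp
      have empty: "particles (hammersley N P q) \<inter> {p<..<y} = {}" if q: "r0 < q" "q < s" for q
      proof -
        have "reach N P (-1) p q" using const[rule_format, of "-1" p r q] p r q v by simp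
        then have "-1 \<le> level p q" by (simp add: reach_iff_level)
        have "c \<notin> particles (hammersley N P q)" if "p < c" "c < y" for c
        proof -
          have "level c q < 0" using lev[OF q, of c] that by simp
          then have "\<not> level p q < level c q" using \<open>-1 \<le> level p q\<close> by simp
          then show ?thesis using that by (auto simp: particles_iff)
        qed
        then show ?thesis by auto
      qed
      have "jumps_to N P s y p"
        unfolding jumps_to_def
      proof (intro conjI)
        show "\<forall>\<^sub>F q in at_left s. y \<in> particles (hammersley N P q) \<and> particles (hammersley N P q) \<inter> {p<..<y} = {}"
          using near
        proof eventually_elim
          case (elim q)
          have "y \<in> particles (hammersley N P q)"
            using lev[of q] elim by (auto simp: particles_iff not_le[symmetric] dest: order_trans)
          then show ?case using empty elim by simp
        qed
      qed (use p \<open>p < y\<close> in auto)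
      then show False using none by blast
    qed
    then show "reach N P 0 v s \<longleftrightarrow> y \<le> v"
      using upd[OF v r] lev[OF r, of v] by (auto simp: reach_iff_level)
  qed (fact \<open>y \<le> 0\<close>)
  show "\<exists>y. (\<forall>\<^sub>F r in at_left s. tagged r = y) \<and>
        (\<forall>x. jumps_to N P s y x \<longrightarrow> tagged s = x) \<and>
        ((\<nexists>x. jumps_to N P s y x) \<longrightarrow> tagged s = y)"
    using near jump stay y by (intro exI[of _ y]) (auto elim: eventually_mono)
qed

end

section \<open>The lattice model and its Burke property\<close>

text \<open>
  One column of cells, processed upwards. A cell receives a step \<open>i\<close> from below, a step \<open>j\<close> from the left
  and possibly a point \<open>w\<close>. If \<open>h\<close> is the height at its lower left corner, then \<open>h + i\<close> and \<open>h + j\<close> are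
  the heights at the lower right and upper left corners, the upper right corner has height
  \<open>h + max i j w\<close>, and the outgoing steps are the resulting differences.
\<close>

fun percolate_column :: "bool \<Rightarrow> bool list \<Rightarrow> bool list \<Rightarrow> bool list" where
  "percolate_column i (j # js) (w # ws) =
     ((i \<or> j \<or> w) \<and> \<not> i) # percolate_column ((i \<or> j \<or> w) \<and> \<not> j) js ws"
| "percolate_column i _ _ = []"

fun percolate :: "bool list \<Rightarrow> (bool \<times> bool list) list \<Rightarrow> bool list" where
  "percolate js [] = js"
| "percolate js ((i, ws) # cols) = percolate (percolate_column i js ws) cols"

abbreviation bernoulli_list :: "nat \<Rightarrow> real \<Rightarrow> bool list pmf" where
  "bernoulli_list n p \<equiv> replicate_pmf n (bernoulli_pmf p)"

definition column_pmf :: "nat \<Rightarrow> real \<Rightarrow> real \<Rightarrow> (bool \<times> bool list) pmf" where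
  "column_pmf n a p = pair_pmf (bernoulli_pmf a) (bernoulli_list n p)"

text \<open>
  The balance equation equates the probability \<open>(1 - a) (1 - b) p\<close> that the cell emits two steps with the
  probability \<open>a b\<close> that it receives two; a single step always passes through on its own side.
\<close>

lemma bernoulli_cell_invariant:
  assumes "0 \<le> a" "a \<le> 1" "0 \<le> b" "b \<le> 1" "0 \<le> p" "p \<le> 1"
    and "a * b = p * (1 - a) * (1 - b)"
  shows "do {i \<leftarrow> bernoulli_pmf a; j \<leftarrow> bernoulli_pmf b; w \<leftarrow> bernoulli_pmf p;
             return_pmf ((i \<or> j \<or> w) \<and> \<not> i, (i \<or> j \<or> w) \<and> \<not> j)}
       = do {j \<leftarrow> bernoulli_pmf b; i \<leftarrow> bernoulli_pmf a; return_pmf (j, i)}"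
proof (rule pmf_eqI)
  fix x :: "bool \<times> bool"
  obtain u v where x: "x = (u, v)" by (cases x)
  show "pmf (do {i \<leftarrow> bernoulli_pmf a; j \<leftarrow> bernoulli_pmf b; w \<leftarrow> bernoulli_pmf p;
             return_pmf ((i \<or> j \<or> w) \<and> \<not> i, (i \<or> j \<or> w) \<and> \<not> j)}) x
       = pmf (do {j \<leftarrow> bernoulli_pmf b; i \<leftarrow> bernoulli_pmf a; return_pmf (j, i)}) x"
    unfolding x using assms
    by (cases u; cases v)
       (simp_all add: pmf_bind integral_bernoulli_pmf pmf_return indicator_def algebra_simps)
qed

lemma percolate_column_invariant:
  assumes "0 \<le> a" "a \<le> 1" "0 \<le> b" "b \<le> 1" "0 \<le> p" "p \<le> 1"
    and "a * b = p * (1 - a) * (1 - b)"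
  shows "do {i \<leftarrow> bernoulli_pmf a; js \<leftarrow> bernoulli_list n b; ws \<leftarrow> bernoulli_list n p;
             return_pmf (percolate_column i js ws)} = bernoulli_list n b"
proof (induction n)
  case 0
  show ?case by (simp add: bind_return_pmf)
next
  case (Suc n)
  have "do {i \<leftarrow> bernoulli_pmf a; js \<leftarrow> bernoulli_list (Suc n) b; ws \<leftarrow> bernoulli_list (Suc n) p;
             return_pmf (percolate_column i js ws)}
      = do {i \<leftarrow> bernoulli_pmf a; j \<leftarrow> bernoulli_pmf b; js \<leftarrow> bernoulli_list n b;
            w \<leftarrow> bernoulli_pmf p; ws \<leftarrow> bernoulli_list n p;
            return_pmf (((i \<or> j \<or> w) \<and> \<not> i) # percolate_column ((i \<or> j \<or> w) \<and> \<not> j) js ws)}"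
    by (simp add: bind_assoc_pmf bind_return_pmf)
  also have "\<dots> = do {i \<leftarrow> bernoulli_pmf a; j \<leftarrow> bernoulli_pmf b; w \<leftarrow> bernoulli_pmf p;
            js \<leftarrow> bernoulli_list n b; ws \<leftarrow> bernoulli_list n p;
            return_pmf (((i \<or> j \<or> w) \<and> \<not> i) # percolate_column ((i \<or> j \<or> w) \<and> \<not> j) js ws)}"
    by (subst bind_commute_pmf[of "bernoulli_list n b" "bernoulli_pmf p"]) simp
  also have "\<dots> = do {(j, i) \<leftarrow> do {i \<leftarrow> bernoulli_pmf a; j \<leftarrow> bernoulli_pmf b; w \<leftarrow> bernoulli_pmf p;
             return_pmf ((i \<or> j \<or> w) \<and> \<not> i, (i \<or> j \<or> w) \<and> \<not> j)};
            js \<leftarrow> bernoulli_list n b; ws \<leftarrow> bernoulli_list n p;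
            return_pmf (j # percolate_column i js ws)}"
    by (simp add: bind_assoc_pmf bind_return_pmf)
  also have "\<dots> = do {j \<leftarrow> bernoulli_pmf b; i \<leftarrow> bernoulli_pmf a;
            js \<leftarrow> bernoulli_list n b; ws \<leftarrow> bernoulli_list n p;
            return_pmf (j # percolate_column i js ws)}"
    unfolding bernoulli_cell_invariant[OF assms] by (simp add: bind_assoc_pmf bind_return_pmf)
  also have "\<dots> = do {j \<leftarrow> bernoulli_pmf b;
            js \<leftarrow> do {i \<leftarrow> bernoulli_pmf a; js \<leftarrow> bernoulli_list n b; ws \<leftarrow> bernoulli_list n p;
                    return_pmf (percolate_column i js ws)};
            return_pmf (j # js)}"
    by (simp add: bind_assoc_pmf bind_return_pmf)
  also have "\<dots> = bernoulli_list (Suc n) b"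
    unfolding Suc.IH by simp
  finally show ?case .
qed

text \<open>
  The Burke property of the lattice: the vertical steps keep their product law from column to column.
\<close>

theorem burke_percolate:
  assumes "0 \<le> a" "a \<le> 1" "0 \<le> b" "b \<le> 1" "0 \<le> p" "p \<le> 1"
    and "a * b = p * (1 - a) * (1 - b)"
  shows "do {js \<leftarrow> bernoulli_list n b; cols \<leftarrow> replicate_pmf m (column_pmf n a p);
             return_pmf (percolate js cols)} = bernoulli_list n b"
proof (induction m)
  case 0
  show ?case by (simp add: bind_return_pmf bind_return_pmf')
next
  case (Suc m)
  have "do {js \<leftarrow> bernoulli_list n b; cols \<leftarrow> replicate_pmf (Suc m) (column_pmf n a p);
             return_pmf (percolate js cols)}
      = do {js \<leftarrow> bernoulli_list n b; i \<leftarrow> bernoulli_pmf a; ws \<leftarrow> bernoulli_list n p;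
            cols \<leftarrow> replicate_pmf m (column_pmf n a p);
            return_pmf (percolate (percolate_column i js ws) cols)}"
    by (simp add: column_pmf_def pair_pmf_def bind_assoc_pmf bind_return_pmf)
  also have "\<dots> = do {i \<leftarrow> bernoulli_pmf a; js \<leftarrow> bernoulli_list n b; ws \<leftarrow> bernoulli_list n p;
            cols \<leftarrow> replicate_pmf m (column_pmf n a p);
            return_pmf (percolate (percolate_column i js ws) cols)}"
    by (rule bind_commute_pmf)
  also have "\<dots> = do {js \<leftarrow> do {i \<leftarrow> bernoulli_pmf a; js \<leftarrow> bernoulli_list n b; ws \<leftarrow> bernoulli_list n p;
                    return_pmf (percolate_column i js ws)};
            cols \<leftarrow> replicate_pmf m (column_pmf n a p); return_pmf (percolate js cols)}"
    by (simp add: bind_assoc_pmf bind_return_pmf)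
  also have "\<dots> = bernoulli_list n b"
    unfolding percolate_column_invariant[OF assms] Suc.IH ..
  finally show ?case .
qed

text \<open>
  The last passage recursion with prescribed values \<open>f\<close> on the lower and \<open>g\<close> on the left boundary and weight
  \<open>w i j\<close> on diagonal steps. The corner value is \<open>f 0\<close>.
\<close>

fun height :: "(nat \<Rightarrow> nat) \<Rightarrow> (nat \<Rightarrow> nat) \<Rightarrow> (nat \<Rightarrow> nat \<Rightarrow> bool) \<Rightarrow> nat \<Rightarrow> nat \<Rightarrow> nat" where
  "height f g w i 0 = f i"
| "height f g w 0 (Suc j) = g (Suc j)"
| "height f g w (Suc i) (Suc j) =
     max (height f g w i (Suc j))
       (max (height f g w (Suc i) j) (height f g w i j + of_bool (w i j)))"

abbreviation trues :: "bool list \<Rightarrow> nat" where "trues bs \<equiv> length (filter id bs)"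

definition bits_height :: "bool list \<Rightarrow> nat \<Rightarrow> nat" where "bits_height bs k = trues (take k bs)"

definition sources :: "(bool \<times> bool list) list \<Rightarrow> bool list" where "sources cols = map fst cols"

definition cell_of :: "(bool \<times> bool list) list \<Rightarrow> nat \<Rightarrow> nat \<Rightarrow> bool" where
  "cell_of cols i j = snd (cols ! i) ! j"

lemma length_percolate_column: "length js = length ws \<Longrightarrow> length (percolate_column i js ws) = length js"
  by (induction i js ws rule: percolate_column.induct) auto

lemma percolate_column_heights:
  assumes "length js = n" "length ws = n"
    and "\<And>j. j \<le> n \<Longrightarrow> u j = c + bits_height js j"
    and "v 0 = c + of_bool i"
    and "\<And>j. j < n \<Longrightarrow> v (Suc j) = max (u (Suc j)) (max (v j) (u j + of_bool (ws ! j)))"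
    and "j \<le> n"
  shows "v j = c + of_bool i + bits_height (percolate_column i js ws) j"
  using assms
proof (induction i js ws arbitrary: n u v c j rule: percolate_column.induct)
  case (1 i b js w ws)
  show ?case
  proof (cases j)
    case 0 then show ?thesis using 1 by (simp add: bits_height_def)
  next
    case (Suc k)
    obtain m where n: "n = Suc m" using 1 by (cases n) auto
    have u: "u j = c + (of_bool b + bits_height js (j - 1))" if "0 < j" "j \<le> n" for j
      using 1(4)[of j] that by (cases j) (auto simp: bits_height_def)
    have v1: "v (Suc 0) = (c + of_bool b) + of_bool ((i \<or> b \<or> w) \<and> \<not> b)"
      using 1(6)[of 0] 1(4)[of 0] 1(5) u[of 1] n by (auto simp: bits_height_def)
    have "v (Suc k) = (c + of_bool b) + of_bool ((i \<or> b \<or> w) \<and> \<not> b)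
        + bits_height (percolate_column ((i \<or> b \<or> w) \<and> \<not> b) js ws) k"
    proof (rule "1.IH"[of m "\<lambda>j. u (Suc j)" "c + of_bool b" "\<lambda>j. v (Suc j)" k])
      show "length js = m" "length ws = m" "k \<le> m" using 1 n Suc by auto
      show "u (Suc j) = c + of_bool b + bits_height js j" if "j \<le> m" for j
        using u[of "Suc j"] that n by simp
      show "v (Suc 0) = c + of_bool b + of_bool ((i \<or> b \<or> w) \<and> \<not> b)" by (fact v1)
      show "v (Suc (Suc j)) = max (u (Suc (Suc j))) (max (v (Suc j)) (u (Suc j) + of_bool (ws ! j)))"
        if "j < m" for j using 1(6)[of "Suc j"] that n by simp
    qed
    then show ?thesis unfolding Suc by (auto simp: bits_height_def)
  qed
qed (auto simp: bits_height_def)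

lemma grid_induct [case_names bottom left cell]:
  assumes "\<And>i. Q i 0" "\<And>j. Q 0 (Suc j)"
    "\<And>i j. Q i (Suc j) \<Longrightarrow> Q (Suc i) j \<Longrightarrow> Q i j \<Longrightarrow> Q (Suc i) (Suc j)"
  shows "Q i (j :: nat)"
  using height.induct[of "\<lambda>_ _ _. Q" undefined undefined undefined i j] assms by blast

lemma height_cong:
  assumes "\<And>i. i \<le> m \<Longrightarrow> f i = f' i" "\<And>j. j \<le> n \<Longrightarrow> g j = g' j"
    "\<And>i j. i < m \<Longrightarrow> j < n \<Longrightarrow> w i j = w' i j"
  shows "i \<le> m \<Longrightarrow> j \<le> n \<Longrightarrow> height f g w i j = height f' g' w' i j"
  by (induction i j rule: grid_induct) (use assms in auto)

lemma height_shift: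
  "height f g w (Suc i) j = height (\<lambda>i. f (Suc i)) (\<lambda>j. height f g w (Suc 0) j) (\<lambda>i. w (Suc i)) i j"
proof (induction i j rule: grid_induct)
  case (cell i j)
  show ?case
    unfolding height.simps(3)[of f g w "Suc i" j]
      height.simps(3)[of "\<lambda>i. f (Suc i)" "\<lambda>j. height f g w (Suc 0) j" "\<lambda>i. w (Suc i)" i j]
    by (simp only: cell)
qed simp_all

text \<open>
  Column by column, the vertical increments of the height function are the output of \<open>percolate\<close>.
\<close>

lemma height_percolate:
  assumes "length js = n" "\<And>c. c \<in> set cols \<Longrightarrow> length (snd c) = n" "j \<le> n"
  shows "height (\<lambda>i. c + bits_height (sources cols) i) (\<lambda>j. c + bits_height js j) (cell_of cols) (length cols) j
       = c + trues (sources cols) + bits_height (percolate js cols) j"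
  using assms
proof (induction cols arbitrary: js c j)
  case Nil
  then show ?case by (cases j) (simp_all add: bits_height_def sources_def)
next
  case (Cons col cols)
  obtain i ws where col: "col = (i, ws)" by (cases col)
  define f where "f = (\<lambda>i. c + bits_height (sources (col # cols)) i)"
  define g where "g = (\<lambda>j. c + bits_height js j)"
  have len: "length js = n" "length ws = n" using Cons.prems(1) Cons.prems(2)[of col] col by auto
  have h0: "height f g w 0 j = g j" for w j
    by (cases j) (simp_all add: f_def g_def bits_height_def)
  have first: "height f g (cell_of (col # cols)) (Suc 0) j
      = c + of_bool i + bits_height (percolate_column i js ws) j" if "j \<le> n" for j
  proof (rule percolate_column_heights[OF len _ _ _ that])
    show "height f g (cell_of (col # cols)) (Suc 0) 0 = c + of_bool i"
      by (simp add: f_def bits_height_def sources_def col)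
  next
    fix j assume "j < n"
    show "height f g (cell_of (col # cols)) (Suc 0) (Suc j)
        = max (height f g (cell_of (col # cols)) 0 (Suc j)) (max (height f g (cell_of (col # cols)) (Suc 0) j)
            (height f g (cell_of (col # cols)) 0 j + of_bool (ws ! j)))"
      by (simp add: cell_of_def col)
  next
    fix j show "height f g (cell_of (col # cols)) 0 j = c + bits_height js j"
      unfolding h0 by (simp add: g_def)
  qed
  have "height f g (cell_of (col # cols)) (length (col # cols)) j
     = height (\<lambda>i. f (Suc i)) (\<lambda>j. height f g (cell_of (col # cols)) (Suc 0) j)
         (\<lambda>i. cell_of (col # cols) (Suc i)) (length cols) j"
    by (simp only: length_Cons height_shift[of _ _ _ "length cols"])
  also have "\<dots> = height (\<lambda>k. (c + of_bool i) + bits_height (sources cols) k)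
      (\<lambda>j. (c + of_bool i) + bits_height (percolate_column i js ws) j) (cell_of cols) (length cols) j"
    by (rule height_cong[of "length cols" _ _ n])
       (use Cons.prems first in \<open>auto simp: f_def cell_of_def bits_height_def sources_def col\<close>)
  also have "\<dots> = (c + of_bool i) + trues (sources cols)
      + bits_height (percolate (percolate_column i js ws) cols) j"
    using Cons.prems len by (intro Cons.IH) (auto simp: length_percolate_column)
  finally show ?case by (simp add: f_def g_def col sources_def comp_def)
qed

lemma height_mono_boundary:
  assumes "\<And>i. f i \<le> f' i" "\<And>j. g j \<le> g' j"
  shows "height f g w i j \<le> height f' g' w i j"
  by (induction i j rule: grid_induct) (use assms in \<open>auto simp: le_max_iff_disj\<close>)

text \<open>
  An optimal path either avoids the left boundary or runs up along it first. In the second case its gain is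
  at most the value collected there plus a passage with zero boundary values.
\<close>

lemma height_le_split:
  assumes "mono g"
  shows "height f g w i j \<le> max (height f (\<lambda>_. 0) w i j) (g j + height (\<lambda>_. 0) (\<lambda>_. 0) w i j)"
proof (induction i j rule: grid_induct)
  case (cell i j)
  let ?H = "height f g w" and ?A = "height f (\<lambda>_. 0) w" and ?X = "height (\<lambda>_. 0) (\<lambda>_. 0) w"
  define R where "R = max (?A (Suc i) (Suc j)) (g (Suc j) + ?X (Suc i) (Suc j))"
  have "g j \<le> g (Suc j)" using assms by (simp add: mono_def)
  have "?A i (Suc j) \<le> R" "?A (Suc i) j \<le> R" "?A i j + of_bool (w i j) \<le> R"
    "g (Suc j) + ?X i (Suc j) \<le> R" "g (Suc j) + ?X (Suc i) j \<le> R"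
    "g (Suc j) + (?X i j + of_bool (w i j)) \<le> R"
    unfolding R_def height.simps(3) by (auto simp: le_max_iff_disj)
  then have "?H i (Suc j) \<le> R" "?H (Suc i) j \<le> R" "?H i j + of_bool (w i j) \<le> R"
    using cell \<open>g j \<le> g (Suc j)\<close> by linarith+
  then show ?case unfolding R_def[symmetric] by simp
qed simp_all

section \<open>Last passage in an uncrowded grid\<close>

lemma card_le_1_eqI: "finite A \<Longrightarrow> card A \<le> 1 \<Longrightarrow> a \<in> A \<Longrightarrow> b \<in> A \<Longrightarrow> a = b"
  by (simp add: card_le_Suc0_iff_eq)

text \<open>
  The recursion encodes that an optimal chain in the box \<open>(i + 1, j + 1)\<close> either has no point in the last
  column, or none in the last row, or has exactly one point in the corner cell and all others strictly to the
  left of and below that cell. The hypothesis on the columns also prevents a path from starting between an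
  atom of \<open>V\<close> and a point of \<open>P\<close> in the same column, a choice that the lattice cannot see.
\<close>

theorem height_eq_last_passage:
  fixes xs ts :: "nat \<Rightarrow> real"
  assumes xs: "strict_mono xs" and ts: "strict_mono ts" "ts 0 = 0"
    and finV: "\<And>A. bounded A \<Longrightarrow> finite (V \<inter> A)" and finP: "\<And>B. bounded B \<Longrightarrow> finite (P \<inter> B)"
    and column: "\<And>i. i < m \<Longrightarrow> card (V \<inter> {xs i<..xs (Suc i)})
        + card (P \<inter> ({xs i<..xs (Suc i)} \<times> {0<..ts n})) \<le> 1"
    and row: "\<And>j. j < n \<Longrightarrow> card (P \<inter> ({xs 0<..xs m} \<times> {ts j<..ts (Suc j)})) \<le> 1"
  defines "w \<equiv> \<lambda>i j. P \<inter> ({xs i<..xs (Suc i)} \<times> {ts j<..ts (Suc j)}) \<noteq> {}"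
    and "f \<equiv> \<lambda>i. card (V \<inter> {xs 0<..xs i})"
  shows "i \<le> m \<Longrightarrow> j \<le> n \<Longrightarrow> k \<le> height f (\<lambda>_. 0) w i j \<longleftrightarrow>
     (\<exists>z C. xs 0 \<le> z \<and> z \<le> xs i \<and> chain_in P z (xs i) (ts j) C \<and>
        k \<le> card (V \<inter> {xs 0<..z}) + card C)"
proof (induction i j arbitrary: k rule: grid_induct)
  case (bottom i)
  have "f i \<ge> k" if "xs 0 \<le> z" "z \<le> xs i" "chain_in P z (xs i) (ts 0) C" "k \<le> card (V \<inter> {xs 0<..z}) + card C" for z C
  proof -
    have "C = {}" using that(3) by (auto simp: chain_in_def ts)
    moreover have "card (V \<inter> {xs 0<..z}) \<le> card (V \<inter> {xs 0<..xs i})" using that(2) by (intro card_mono finV) auto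
    ultimately show ?thesis using that(4) by (simp add: f_def)
  qed
  moreover have "xs 0 \<le> xs i" using xs by (simp add: strict_mono_less_eq)
  ultimately show ?case by (auto simp: f_def intro!: exI[of _ "xs i"] exI[of _ "{}"])
next
  case (left j)
  have "k = 0" if "xs 0 \<le> z" "z \<le> xs 0" "chain_in P z (xs 0) (ts (Suc j)) C" "k \<le> card (V \<inter> {xs 0<..z}) + card C" for z C
  proof -
    have "z = xs 0" using that by simp
    moreover have "C = {}" using that(3) calculation by (auto simp: chain_in_def)
    ultimately show ?thesis using that(4) by simp
  qed
  then show ?case by (auto intro!: exI[of _ "xs 0"] exI[of _ "{}"])
next
  case (cell i j)
  let ?H = "height f (\<lambda>_. 0) w"
  let ?G = "\<lambda>i j k. \<exists>z C. xs 0 \<le> z \<and> z \<le> xs i \<and> chain_in P z (xs i) (ts j) C \<and>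
        k \<le> card (V \<inter> {xs 0<..z}) + card C"
  have ij: "i < m" "j < n" using cell.prems by auto
  have IH: "k \<le> ?H i (Suc j) \<longleftrightarrow> ?G i (Suc j) k" "k \<le> ?H (Suc i) j \<longleftrightarrow> ?G (Suc i) j k"
    "k \<le> ?H i j \<longleftrightarrow> ?G i j k" for k
    using cell.IH cell.prems by auto
  have lt: "xs i < xs (Suc i)" "ts j < ts (Suc j)" "xs 0 \<le> xs i" "xs (Suc i) \<le> xs m" "ts (Suc j) \<le> ts n" "0 \<le> ts j"
    using xs ts ij strict_mono_less_eq[OF ts(1), of 0 j] by (auto simp: strict_mono_less strict_mono_less_eq Suc_le_eq)
  have mono: "?G (Suc i) (Suc j) k" if G: "?G i' j' k" "xs i' \<le> xs (Suc i)" "ts j' \<le> ts (Suc j)" for i' j' k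
  proof -
    obtain z C where "xs 0 \<le> z" "z \<le> xs i'" "chain_in P z (xs i') (ts j') C"
      "k \<le> card (V \<inter> {xs 0<..z}) + card C" using G by blast
    then show ?thesis using that(2,3)
      by (intro exI[of _ z] exI[of _ C]) (auto intro: chain_in_mono)
  qed
  show ?case
  proof
    assume "k \<le> ?H (Suc i) (Suc j)"
    then consider "k \<le> ?H i (Suc j)" | "k \<le> ?H (Suc i) j" | "k \<le> ?H i j" |
       "w i j" "k \<le> Suc (?H i j)" by (cases "w i j") (auto simp: le_max_iff_disj)
    then show "?G (Suc i) (Suc j) k"
    proof cases
      case 1 then show ?thesis using mono[of i "Suc j" k] IH lt by auto
    next
      case 2 then show ?thesis using mono[of "Suc i" j k] IH lt by auto
    next
      case 3 then show ?thesis using mono[of i j k] IH lt by auto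
    next
      case 4
      then have "k - 1 \<le> ?H i j" by simp
      then obtain z C where z: "xs 0 \<le> z" "z \<le> xs i" "chain_in P z (xs i) (ts j) C"
        "k - 1 \<le> card (V \<inter> {xs 0<..z}) + card C" using IH(3) by blast
      obtain q where q: "q \<in> P" "xs i < fst q" "fst q \<le> xs (Suc i)" "ts j < snd q" "snd q \<le> ts (Suc j)"
        using \<open>w i j\<close> unfolding w_def by auto
      have C: "fst p < fst q \<and> snd p < snd q" if "p \<in> C" for p
        using chain_inD[OF z(3) that] q by simp
      have "chain_in P z (xs (Suc i)) (ts (Suc j)) (insert q C)"
        unfolding chain_in_def
      proof (intro conjI)
        show "finite (insert q C)" using z(3) by (simp add: chain_in_def)
        show "increasing_chain (insert q C)"
          using z(3) C by (intro increasing_chain_insert) (auto simp: chain_in_def)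
        have "p \<in> P \<inter> ({z<..xs (Suc i)} \<times> {0<..ts (Suc j)})" if "p \<in> C" for p
          using chain_inD[OF z(3) that] lt by (intro mem_box) linarith+
        moreover have "q \<in> P \<inter> ({z<..xs (Suc i)} \<times> {0<..ts (Suc j)})"
          using q lt z by (intro mem_box) linarith+
        ultimately show "insert q C \<subseteq> P \<inter> ({z<..xs (Suc i)} \<times> {0<..ts (Suc j)})" by blast
      qed
      moreover have "card (insert q C) = Suc (card C)" using z(3) C[of q] by (subst card_insert_disjoint) (auto simp: chain_in_def)
      ultimately show ?thesis using z lt by (intro exI[of _ z] exI[of _ "insert q C"]) auto
    qed
  next
    assume "?G (Suc i) (Suc j) k"
    then obtain z0 C where z0: "xs 0 \<le> z0" "z0 \<le> xs (Suc i)" "chain_in P z0 (xs (Suc i)) (ts (Suc j)) C"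
        "k \<le> card (V \<inter> {xs 0<..z0}) + card C" by blast
    have colP: "finite (P \<inter> ({xs i<..xs (Suc i)} \<times> {0<..ts n}))" 
      by (intro finP bounded_Times) auto
    have colV: "finite (V \<inter> {xs i<..xs (Suc i)})" by (intro finV) auto
    have rowP: "finite (P \<inter> ({xs 0<..xs m} \<times> {ts j<..ts (Suc j)}))" by (intro finP bounded_Times) auto
    have colI: "q \<in> P \<inter> ({xs i<..xs (Suc i)} \<times> {0<..ts n})" if "q \<in> C" "xs i < fst q" for q
      using chain_inD[OF z0(3) that(1)] that(2) lt by (intro mem_box) linarith+
    have rowI: "q \<in> P \<inter> ({xs 0<..xs m} \<times> {ts j<..ts (Suc j)})" if "q \<in> C" "ts j < snd q" for q
      using chain_inD[OF z0(3) that(1)] that(2) lt z0 by (intro mem_box) linarith+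
    have chain: "increasing_chain C" "finite C" using z0(3) by (auto simp: chain_in_def)
    show "k \<le> ?H (Suc i) (Suc j)"
    proof (cases "C = {}")
      case True
      then have "?G (Suc i) j k" using z0 by (intro exI[of _ z0] exI[of _ "{}"]) auto
      then show ?thesis using IH(2) by (simp add: le_max_iff_disj)
    next
      case False
      \<comment> \<open>A chain that starts inside the column occupies it, so that no atom of \<open>V\<close> is lost by starting at its left end.\<close>
      obtain z where z: "xs 0 \<le> z" "z \<le> xs i" "chain_in P z (xs (Suc i)) (ts (Suc j)) C"
        "k \<le> card (V \<inter> {xs 0<..z}) + card C"
      proof (cases "z0 \<le> xs i")
        case True then show ?thesis using that z0 by blast
      next
        case F: False
        obtain q where "q \<in> C" using False by blast
        then have "xs i < fst q" using chain_inD(2)[OF z0(3)] F by fastforce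
        then have "card (P \<inter> ({xs i<..xs (Suc i)} \<times> {0<..ts n})) > 0"
          using colI[OF \<open>q \<in> C\<close>] colP by (auto simp: card_gt_0_iff)
        then have "card (V \<inter> {xs i<..xs (Suc i)}) = 0" using column[OF ij(1)] by linarith
        then have "V \<inter> {xs i<..xs (Suc i)} = {}" using colV by simp
        then have "V \<inter> {xs 0<..z0} = V \<inter> {xs 0<..xs i}" using F z0(2) by force
        moreover have "chain_in P (xs i) (xs (Suc i)) (ts (Suc j)) C"
          using z0(3) F by (intro chain_in_mono[OF z0(3)]) auto
        ultimately show ?thesis using that[of "xs i"] z0 lt by auto
      qed
      consider "\<forall>q\<in>C. fst q \<le> xs i" | "\<forall>q\<in>C. snd q \<le> ts j"
        | q p where "q \<in> C" "xs i < fst q" "p \<in> C" "ts j < snd p" by (meson not_le)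
      then show ?thesis
      proof cases
        case 1
        then have "chain_in P z (xs i) (ts (Suc j)) C" using z(3) by (fastforce simp: chain_in_def)
        then have "?G i (Suc j) k" using z by blast
        then show ?thesis using IH(1) by (simp add: le_max_iff_disj)
      next
        case 2
        then have "chain_in P z (xs (Suc i)) (ts j) C" using z(3) by (fastforce simp: chain_in_def)
        then have "?G (Suc i) j k" using z lt by (intro exI[of _ z] exI[of _ C]) auto
        then show ?thesis using IH(2) by (simp add: le_max_iff_disj)
      next
        case 3
        have column_unique: "a = q" if "a \<in> C" "xs i < fst a" for a
          using card_le_1_eqI[OF colP _ colI[OF that] colI[OF 3(1,2)]] column[OF ij(1)] by simp
        have row_unique: "a = p" if "a \<in> C" "ts j < snd a" for a
          using card_le_1_eqI[OF rowP _ rowI[OF that] rowI[OF 3(3,4)]] row[OF ij(2)] by simp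
        have "p = q"
          using increasing_chainD[OF chain(1) 3(1,3)] column_unique[OF 3(3)] row_unique[OF 3(1)] 3(2,4)
          by (metis order_less_trans)
        then have w: "w i j" 
          using chain_inD[OF z0(3) 3(1)] 3 mem_box[of q P "xs i" "xs (Suc i)" "ts j" "ts (Suc j)"]
          unfolding w_def by auto
        have "a \<in> P \<inter> ({z<..xs i} \<times> {0<..ts j})" if "a \<in> C - {q}" for a
        proof -
          have a: "a \<in> C" "a \<noteq> q" using that by auto
          then have "\<not> xs i < fst a" "\<not> ts j < snd a"
            using column_unique row_unique \<open>p = q\<close> by metis+
          then show ?thesis using chain_inD[OF z(3) a(1)] by (intro mem_box) linarith+
        qed
        then have "chain_in P z (xs i) (ts j) (C - {q})"
          using chain increasing_chain_subset[of C "C - {q}"] unfolding chain_in_def by blast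
        moreover have "card C = Suc (card (C - {q}))" using chain 3 by (intro card.remove) auto
        ultimately have "?G i j (k - 1)" using z by (intro exI[of _ z] exI[of _ "C - {q}"]) auto
        then have "k - 1 \<le> ?H i j" using IH(3) by blast
        then show ?thesis using w by (simp add: le_max_iff_disj) linarith
      qed
    qed
  qed
qed

section \<open>The flux of the lattice model\<close>

abbreviation exceedance :: "nat pmf \<Rightarrow> nat pmf \<Rightarrow> real" where
  "exceedance V K \<equiv> measure (pair_pmf V K) {(v, k). v + 1 \<le> k}"

lemma pmf_replicate_pmf:
  "pmf (replicate_pmf n p) xs = (if length xs = n then \<Prod>i<n. pmf p (xs ! i) else 0)"
proof (induction n arbitrary: xs)
  case 0
  then show ?case by (auto simp: pmf_return indicator_def)
next
  case (Suc n)
  have *: "replicate_pmf (Suc n) p = map_pmf (\<lambda>(x, xs). x # xs) (pair_pmf p (replicate_pmf n p))"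
    by (simp add: pair_pmf_def map_bind_pmf bind_assoc_pmf bind_return_pmf map_return_pmf)
  show ?case
  proof (cases xs)
    case Nil
    then have "xs \<notin> set_pmf (replicate_pmf (Suc n) p)" by (simp only: set_replicate_pmf) auto
    then show ?thesis using Nil by (simp add: set_pmf_iff del: replicate_pmf.simps)
  next
    case (Cons y ys)
    have "pmf (replicate_pmf (Suc n) p) ((\<lambda>(x, xs). x # xs) (y, ys)) = pmf (pair_pmf p (replicate_pmf n p)) (y, ys)"
      unfolding * by (rule pmf_map_inj') (auto simp: inj_on_def)
    then show ?thesis
      using Suc.IH[of ys] by (simp add: Cons pmf_pair prod.lessThan_Suc_shift del: replicate_pmf.simps prod.lessThan_Suc)
  qed
qed

lemma map_replicate_pmf: "map_pmf (map f) (replicate_pmf n p) = replicate_pmf n (map_pmf f p)"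
proof (induction n)
  case (Suc n)
  then show ?case by (simp add: Suc[symmetric] bind_map_pmf map_bind_pmf map_return_pmf)
qed (simp add: map_return_pmf)

text \<open>
  Markov's inequality for \<open>C * \<theta> ^ k\<close>, whose mean the binomial theorem gives. \<open>\<theta> = 2\<close> yields upper and
  \<open>\<theta> = 1/2\<close> lower tails.
\<close>

lemma binomial_exponential_markov:
  assumes p: "0 \<le> p" "p \<le> 1" and "0 \<le> C" "0 < \<theta>" and P: "\<And>k. Q k \<Longrightarrow> 1 \<le> C * \<theta> ^ k"
  shows "measure (binomial_pmf n p) {k. Q k} \<le> C * (1 - p + p * \<theta>) ^ n"
proof -
  have "measure (binomial_pmf n p) {k. Q k} = measure (binomial_pmf n p) ({k. Q k} \<inter> {..n})"
    using set_pmf_binomial_eq[of p n] p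
    by (intro measure_pmf.finite_measure_eq_AE) (auto simp: AE_measure_pmf_iff set_pmf_binomial_eq split: if_splits)
  also have "\<dots> = (\<Sum>k\<in>{k. Q k} \<inter> {..n}. pmf (binomial_pmf n p) k)"
    by (intro measure_measure_pmf_finite) simp
  also have "\<dots> \<le> (\<Sum>k\<in>{k. Q k} \<inter> {..n}. C * \<theta> ^ k * pmf (binomial_pmf n p) k)"
    using P by (intro sum_mono) (auto intro!: mult_le_cancel_right1[THEN iffD2] simp: mult_le_cancel_right1)
  also have "\<dots> \<le> (\<Sum>k\<le>n. C * \<theta> ^ k * pmf (binomial_pmf n p) k)"
    using assms by (intro sum_mono2) auto
  also have "\<dots> = C * (\<Sum>k\<le>n. of_nat (n choose k) * (p * \<theta>) ^ k * (1 - p) ^ (n - k))"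
    using p by (simp add: sum_distrib_left pmf_binomial power_mult_distrib mult_ac)
  also have "\<dots> = C * (1 - p + p * \<theta>) ^ n"
    by (subst add.commute, subst binomial_ring) simp
  finally show ?thesis .
qed

lemma measure_trues_bernoulli_list:
  assumes "0 \<le> p" "p \<le> 1"
  shows "measure (bernoulli_list n p) {bs. Q (trues bs)} = measure (binomial_pmf n p) {k. Q k}"
  using assms by (subst binomial_pmf_altdef) (auto simp: measure_map_pmf vimage_def)

lemma one_plus_power_le_exp: "0 \<le> 1 + x \<Longrightarrow> (1 + x) ^ n \<le> exp (real n * x)" for x :: real
  by (metis exp_ge_add_one_self exp_of_nat_mult power_mono)

lemma bernoulli_list_upper_tail:
  assumes "0 \<le> p" "p \<le> 1"
  shows "measure (bernoulli_list n p) {bs. k \<le> trues bs} \<le> exp (real n * p) / 2 ^ k"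
proof -
  have "measure (bernoulli_list n p) {bs. k \<le> trues bs} \<le> (1 / 2 ^ k) * (1 - p + p * 2) ^ n"
    using assms unfolding measure_trues_bernoulli_list[OF assms]
    by (intro binomial_exponential_markov) (auto simp: field_simps power_increasing)
  also have "\<dots> \<le> (1 / 2 ^ k) * exp (real n * p)"
    using one_plus_power_le_exp[of p n] assms by (intro mult_left_mono) (auto simp: add.commute)
  finally show ?thesis by simp
qed

lemma bernoulli_list_lower_tail:
  assumes "0 \<le> p" "p \<le> 1"
  shows "measure (bernoulli_list n p) {bs. trues bs \<le> k} \<le> 2 ^ k * exp (- (real n * p / 2))"
proof -
  have "measure (bernoulli_list n p) {bs. trues bs \<le> k} \<le> 2 ^ k * (1 - p + p * (1/2)) ^ n"
    unfolding measure_trues_bernoulli_list[OF assms, where Q = "\<lambda>j. j \<le> k"]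
    using assms by (intro binomial_exponential_markov) (auto simp: field_simps power_increasing)
  also have "\<dots> \<le> 2 ^ k * exp (real n * (- p / 2))"
    using one_plus_power_le_exp[of "- p / 2" n] assms by (intro mult_left_mono) (auto simp: algebra_simps)
  finally show ?thesis by simp
qed

lemma map_pmf_sources:
  "map_pmf sources (replicate_pmf m (column_pmf n a p)) = bernoulli_list m a"
proof -
  have "sources = map fst" by (auto simp: sources_def)
  show ?thesis unfolding \<open>sources = map fst\<close> map_replicate_pmf column_pmf_def map_fst_pair_pmf ..
qed

text \<open>
  The three boundary conditions: sources below and sinks on the left, sources only, and neither.
\<close>

definition sink_height :: "nat \<Rightarrow> bool list \<Rightarrow> (bool \<times> bool list) list \<Rightarrow> nat" where
  "sink_height n js cols = height (bits_height (sources cols)) (bits_height js) (cell_of cols) (length cols) n"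

definition source_height :: "nat \<Rightarrow> (bool \<times> bool list) list \<Rightarrow> nat" where
  "source_height n cols = height (bits_height (sources cols)) (\<lambda>_. 0) (cell_of cols) (length cols) n"

definition bulk_height :: "nat \<Rightarrow> (bool \<times> bool list) list \<Rightarrow> nat" where
  "bulk_height n cols = height (\<lambda>_. 0) (\<lambda>_. 0) (cell_of cols) (length cols) n"

lemma mono_bits_height: "mono (bits_height js)"
proof (rule monoI)
  fix i j :: nat assume "i \<le> j"
  then have "take j js = take i js @ take (j - i) (drop i js)"
    by (metis le_add_diff_inverse take_add)
  then show "bits_height js i \<le> bits_height js j" by (simp add: bits_height_def)
qed

lemma bits_height_length: "length js = n \<Longrightarrow> bits_height js n = trues js"
  by (simp add: bits_height_def)

lemma
  shows source_le_sink: "source_height n cols \<le> sink_height n js cols"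
    and bulk_le_sink: "bulk_height n cols \<le> sink_height n js cols"
  unfolding source_height_def sink_height_def bulk_height_def by (rule height_mono_boundary; simp)+

lemma sink_le_source_or_bulk:
  assumes "length js = n"
  shows "sink_height n js cols \<le> max (source_height n cols) (trues js + bulk_height n cols)"
  using height_le_split[OF mono_bits_height[of js], where f = "bits_height (sources cols)"
      and w = "cell_of cols" and i = "length cols" and j = n]
  unfolding source_height_def sink_height_def bulk_height_def bits_height_length[OF assms] .

lemma length_percolate:
  "length js = n \<Longrightarrow> (\<And>c. c \<in> set cols \<Longrightarrow> length (snd c) = n) \<Longrightarrow> length (percolate js cols) = n"
proof (induction cols arbitrary: js)
  case (Cons c cols)
  show ?case
    using Cons.IH[of "percolate_column (fst c) js (snd c)"] Cons.prems(1) Cons.prems(2)[of c] Cons.prems(2)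
    by (cases c) (simp add: length_percolate_column)
qed simp

lemma sink_height_eq:
  assumes "length js = n" "\<And>c. c \<in> set cols \<Longrightarrow> length (snd c) = n"
  shows "sink_height n js cols = trues (sources cols) + trues (percolate js cols)"
  using height_percolate[OF assms, where j = n and c = 0] bits_height_length[OF length_percolate[OF assms]]
  unfolding sink_height_def by simp

definition sink_pmf :: "nat \<Rightarrow> nat \<Rightarrow> real \<Rightarrow> real \<Rightarrow> real \<Rightarrow> (bool list \<times> (bool \<times> bool list) list) pmf" where
  "sink_pmf m n a b p = pair_pmf (bernoulli_list n b) (replicate_pmf m (column_pmf n a p))"

lemma set_sink_pmf:
  "(js, cols) \<in> set_pmf (sink_pmf m n a b p) \<Longrightarrow> length js = n \<and> (\<forall>c\<in>set cols. length (snd c) = n)"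
proof
  assume D: "(js, cols) \<in> set_pmf (sink_pmf m n a b p)"
  show "length js = n" using D unfolding sink_pmf_def set_pair_pmf set_replicate_pmf by blast
  have "set cols \<subseteq> set_pmf (column_pmf n a p)"
    using D unfolding sink_pmf_def set_pair_pmf set_replicate_pmf by blast
  moreover have "length (snd c) = n" if "c \<in> set_pmf (column_pmf n a p)" for c
    using that unfolding column_pmf_def set_pair_pmf set_replicate_pmf by force
  ultimately show "\<forall>c\<in>set cols. length (snd c) = n" by blast
qed

lemma map_percolate_sink_pmf:
  assumes "0 \<le> a" "a \<le> 1" "0 \<le> b" "b \<le> 1" "0 \<le> p" "p \<le> 1" "a * b = p * (1 - a) * (1 - b)"
  shows "map_pmf (\<lambda>(js, cols). percolate js cols) (sink_pmf m n a b p) = bernoulli_list n b"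
  using burke_percolate[OF assms, of n m]
  by (simp add: sink_pmf_def pair_pmf_def map_bind_pmf map_return_pmf)

text \<open>
  The bulk height does not involve the sources, so their density may be changed to any \<open>a\<close> that balances some
  \<open>b\<close>. The height with these boundary steps is larger, and by the Burke property it is a sum of a binomial
  number of steps along the bottom and another along the right side.
\<close>

lemma bulk_height_tail:
  assumes "0 \<le> a" "a \<le> 1" "0 \<le> b" "b \<le> 1" "0 \<le> p" "p \<le> 1" "a * b = p * (1 - a) * (1 - b)"
  shows "measure (replicate_pmf m (column_pmf n c p)) {cols. 2 * k \<le> bulk_height n cols}
     \<le> (exp (real m * a) + exp (real n * b)) / 2 ^ k"
proof -
  let ?D = "sink_pmf m n a b p"
  define B where "B = (\<lambda>cells :: bool list list. height (\<lambda>_. 0) (\<lambda>_. 0) (\<lambda>i j. cells ! i ! j) (length cells) n)"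
  have B: "bulk_height n cols = B (map snd cols)" for cols
    unfolding bulk_height_def B_def length_map
    by (rule height_cong[of "length cols" _ _ n]) (auto simp: cell_of_def)
  have cells: "map_pmf (map snd) (replicate_pmf m (column_pmf n c p)) = replicate_pmf m (bernoulli_list n p)" for c
    by (simp add: map_replicate_pmf column_pmf_def map_snd_pair_pmf)
  have "measure (replicate_pmf m (column_pmf n c p)) {cols. 2 * k \<le> bulk_height n cols}
      = measure (map_pmf (map snd) (replicate_pmf m (column_pmf n c p))) {x. 2 * k \<le> B x}" for c
    by (simp add: measure_map_pmf vimage_def B)
  then have "measure (replicate_pmf m (column_pmf n c p)) {cols. 2 * k \<le> bulk_height n cols}
      = measure (replicate_pmf m (column_pmf n a p)) {cols. 2 * k \<le> bulk_height n cols}"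
    by (simp add: cells)
  also have "\<dots> = measure ?D {(js, cols). 2 * k \<le> bulk_height n cols}"
  proof -
    have "replicate_pmf m (column_pmf n a p) = map_pmf snd ?D" by (simp add: sink_pmf_def map_snd_pair_pmf)
    then show ?thesis by (simp add: measure_map_pmf vimage_def case_prod_unfold)
  qed
  also have "\<dots> \<le> measure ?D ({(js, cols). k \<le> trues (sources cols)} \<union> {(js, cols). k \<le> trues (percolate js cols)})"
  proof (rule measure_pmf.finite_measure_mono_AE)
    show "AE x in ?D. x \<in> {(js, cols). 2 * k \<le> bulk_height n cols} \<longrightarrow>
        x \<in> {(js, cols). k \<le> trues (sources cols)} \<union> {(js, cols). k \<le> trues (percolate js cols)}"
    proof (unfold AE_measure_pmf_iff, safe)
      fix js cols assume D: "(js, cols) \<in> set_pmf ?D" and "2 * k \<le> bulk_height n cols"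
        and "\<not> k \<le> trues (percolate js cols)"
      then show "k \<le> trues (sources cols)"
        using bulk_le_sink[of n cols js] sink_height_eq[of js n cols] set_sink_pmf[OF D] by auto
    qed
  qed simp
  also have "\<dots> \<le> measure ?D {(js, cols). k \<le> trues (sources cols)} + measure ?D {(js, cols). k \<le> trues (percolate js cols)}"
    by (intro measure_Un_le) auto
  also have "measure ?D {(js, cols). k \<le> trues (sources cols)} = measure (map_pmf sources (map_pmf snd ?D)) {bs. k \<le> trues bs}"
    by (simp add: measure_map_pmf vimage_def case_prod_unfold del: map_pmf_comp)
  also have "\<dots> = measure (bernoulli_list m a) {bs. k \<le> trues bs}"
    by (simp only: sink_pmf_def map_snd_pair_pmf map_pmf_sources)
  also have "measure ?D {(js, cols). k \<le> trues (percolate js cols)}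
      = measure (map_pmf (\<lambda>(js, cols). percolate js cols) ?D) {bs. k \<le> trues bs}"
    by (simp add: measure_map_pmf vimage_def case_prod_unfold)
  also have "\<dots> = measure (bernoulli_list n b) {bs. k \<le> trues bs}"
    by (simp only: map_percolate_sink_pmf[OF assms])
  finally show ?thesis
    using bernoulli_list_upper_tail[OF assms(1,2), of m k] bernoulli_list_upper_tail[OF assms(3,4), of n k]
    unfolding add_divide_distrib by linarith
qed

text \<open>
  With sinks the flux is binomial. Removing them lowers it only if the path along the left side wins, that is,
  if the sinks together with a bulk passage outnumber all the sources. Then there are at least \<open>c\<close> sinks, or
  at most \<open>3 * c\<close> sources, or the bulk height is at least \<open>2 * c\<close>. The variable \<open>v\<close> is the number of
  atoms between the observation point and the origin; \<open>a'\<close> and \<open>b'\<close> are the auxiliary densities of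
  \<open>bulk_height_tail\<close>.
\<close>

theorem source_flux_law:
  assumes "0 \<le> a" "a \<le> 1" "0 \<le> b" "b \<le> 1" "0 \<le> p" "p \<le> 1" "a * b = p * (1 - a) * (1 - b)"
    and "0 \<le> a'" "a' \<le> 1" "0 \<le> b'" "b' \<le> 1" "a' * b' = p * (1 - a') * (1 - b')"
  shows "\<bar>measure (pair_pmf V (replicate_pmf m (column_pmf n a p)))
            {(v, cols). v + 1 + trues (sources cols) \<le> source_height n cols}
          - exceedance V (binomial_pmf n b)\<bar>
     \<le> exp (real n * b) / 2 ^ c + 2 ^ (3 * c) * exp (- (real m * a / 2))
        + (exp (real m * a') + exp (real n * b')) / 2 ^ c"
proof -
  let ?S = "sink_pmf m n a b p"
  let ?D = "pair_pmf V ?S"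
  let ?cols = "replicate_pmf m (column_pmf n a p)"
  let ?A = "{(v, js, cols). v + 1 + trues (sources cols) \<le> source_height n cols}"
  let ?B = "{(v, js, cols). v + 1 \<le> trues (percolate js cols)}"
  let ?E1 = "{(v :: nat, js, cols :: (bool \<times> bool list) list). c \<le> trues js}"
  let ?E2 = "{(v :: nat, js :: bool list, cols). trues (sources cols) \<le> 3 * c}"
  let ?E3 = "{(v :: nat, js :: bool list, cols). 2 * c \<le> bulk_height n cols}"
  have len: "length js = n" "\<And>c. c \<in> set cols \<Longrightarrow> length (snd c) = n"
    if "(v, js, cols) \<in> set_pmf ?D" for v js cols
    using that set_sink_pmf[of js cols m n a b p] by auto
  have AB: "AE x in ?D. x \<in> ?A \<longrightarrow> x \<in> ?B"
  proof (unfold AE_measure_pmf_iff, safe)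
    fix v js cols assume D: "(v, js, cols) \<in> set_pmf ?D"
      and "v + 1 + trues (sources cols) \<le> source_height n cols"
    then show "v + 1 \<le> trues (percolate js cols)"
      using source_le_sink[of n cols js] sink_height_eq[OF len[OF D]] by simp
  qed
  have BA: "AE x in ?D. x \<in> ?B \<longrightarrow> x \<in> ?A \<union> (?E1 \<union> (?E2 \<union> ?E3))"
  proof (unfold AE_measure_pmf_iff, intro ballI impI)
    fix x assume x: "x \<in> set_pmf ?D" "x \<in> ?B"
    obtain v js cols where [simp]: "x = (v, js, cols)" by (cases x)
    have D: "(v, js, cols) \<in> set_pmf ?D" using x by simp
    have "v + 1 + trues (sources cols) \<le> max (source_height n cols) (trues js + bulk_height n cols)"
      using sink_le_source_or_bulk[OF len(1)[OF D], of cols] sink_height_eq[OF len[OF D]] x(2) by simp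
    then have "v + 1 + trues (sources cols) \<le> source_height n cols \<or> c \<le> trues js \<or>
        trues (sources cols) \<le> 3 * c \<or> 2 * c \<le> bulk_height n cols" by linarith
    then show "x \<in> ?A \<union> (?E1 \<union> (?E2 \<union> ?E3))" by simp
  qed
  have "measure ?D ?A \<le> measure ?D ?B" by (rule measure_pmf.finite_measure_mono_AE[OF AB]) simp
  moreover have "measure ?D ?B \<le> measure ?D (?A \<union> (?E1 \<union> (?E2 \<union> ?E3)))"
    by (rule measure_pmf.finite_measure_mono_AE[OF BA]) simp
  moreover have "measure ?D (?A \<union> (?E1 \<union> (?E2 \<union> ?E3)))
      \<le> measure ?D ?A + (measure ?D ?E1 + (measure ?D ?E2 + measure ?D ?E3))"
    by (intro order_trans[OF measure_Un_le] add_left_mono order_refl) auto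
  moreover have "measure ?D ?E1 \<le> exp (real n * b) / 2 ^ c"
  proof -
    have "measure ?D ?E1 = measure (map_pmf (\<lambda>(v, js, cols). js) ?D) {js. c \<le> trues js}"
      by (simp add: measure_map_pmf vimage_def case_prod_unfold)
    also have "map_pmf (\<lambda>(v, js, cols). js) ?D = map_pmf fst (map_pmf snd ?D)"
      by (simp add: pmf.map_comp comp_def case_prod_unfold del: map_pmf_comp)
    finally show ?thesis using bernoulli_list_upper_tail[OF assms(3,4), of n c]
      by (simp only: map_snd_pair_pmf sink_pmf_def map_fst_pair_pmf)
  qed
  moreover have "measure ?D ?E2 \<le> 2 ^ (3 * c) * exp (- (real m * a / 2))"
  proof -
    have "measure ?D ?E2 = measure (map_pmf (\<lambda>(v, js, cols). sources cols) ?D) {bs. trues bs \<le> 3 * c}"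
      by (simp add: measure_map_pmf vimage_def case_prod_unfold)
    also have "map_pmf (\<lambda>(v, js, cols). sources cols) ?D = map_pmf sources (map_pmf snd (map_pmf snd ?D))"
      by (simp add: pmf.map_comp comp_def case_prod_unfold del: map_pmf_comp)
    finally show ?thesis using bernoulli_list_lower_tail[OF assms(1,2), of m "3 * c"]
      by (simp only: map_snd_pair_pmf sink_pmf_def map_pmf_sources)
  qed
  moreover have "measure ?D ?E3 \<le> (exp (real m * a') + exp (real n * b')) / 2 ^ c"
  proof -
    have "measure ?D ?E3 = measure (map_pmf (\<lambda>(v, js, cols). cols) ?D) {cols. 2 * c \<le> bulk_height n cols}"
      by (simp add: measure_map_pmf vimage_def case_prod_unfold)
    also have "map_pmf (\<lambda>(v, js, cols). cols) ?D = map_pmf snd (map_pmf snd ?D)"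
      by (simp add: pmf.map_comp comp_def case_prod_unfold del: map_pmf_comp)
    finally show ?thesis using bulk_height_tail[OF assms(8-11) assms(5,6) assms(12), of m n a c]
      by (simp only: map_snd_pair_pmf sink_pmf_def)
  qed
  moreover have "measure ?D ?A = measure (pair_pmf V ?cols)
            {(v, cols). v + 1 + trues (sources cols) \<le> source_height n cols}"
  proof -
    have "map_pmf (\<lambda>(v, js, cols). (v, cols)) ?D = pair_pmf (map_pmf id V) (map_pmf snd ?S)"
      by (simp only: map_pair[symmetric]) (simp add: case_prod_unfold)
    then have "pair_pmf V ?cols = map_pmf (\<lambda>(v, js, cols). (v, cols)) ?D"
      by (simp add: sink_pmf_def map_snd_pair_pmf pmf.map_id0)
    then show ?thesis by (simp add: measure_map_pmf vimage_def case_prod_unfold)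
  qed
  moreover have "measure ?D ?B = exceedance V (binomial_pmf n b)"
  proof -
    have "map_pmf (\<lambda>(v, js, cols). (v, percolate js cols)) ?D
        = pair_pmf (map_pmf id V) (map_pmf (\<lambda>(js, cols). percolate js cols) ?S)"
      by (simp only: map_pair[symmetric]) (simp add: case_prod_unfold)
    then have *: "pair_pmf V (bernoulli_list n b) = map_pmf (\<lambda>(v, js, cols). (v, percolate js cols)) ?D"
      by (simp add: map_percolate_sink_pmf[OF assms(1-7)] pmf.map_id0)
    have "pair_pmf V (binomial_pmf n b) = map_pmf (\<lambda>(v, bs). (v, trues bs)) (pair_pmf V (bernoulli_list n b))"
      using assms(3,4) by (simp add: binomial_pmf_altdef map_pair[symmetric, of id, simplified] pmf.map_id0 comp_def case_prod_unfold pair_map_pmf2)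
    then show ?thesis unfolding * by (simp add: measure_map_pmf vimage_def case_prod_unfold)
  qed
  ultimately show ?thesis by linarith
qed

section \<open>Poisson point processes and completions\<close>

lemma poisson_process_finite:
  assumes "poisson_process M m N" "\<omega> \<in> space M" "bounded A"
  shows "finite (N \<omega> \<inter> A)"
proof -
  have "N \<omega> \<in> space config_space"
    using assms by (auto simp: poisson_process_def dest: measurable_space)
  then show ?thesis using assms(3) by (simp add: config_space_def configurations_def space_measure_of_conv)
qed

lemma count_sets_config_space:
  assumes "A \<in> sets borel" "bounded A"
  shows "{T \<in> configurations. card (T \<inter> A) \<in> S} \<in> sets config_space"
proof -
  have "{T \<in> configurations. card (T \<inter> A) = k} \<in> sets config_space" for k
    unfolding config_space_def using assms by (subst sets_measure_of) (auto intro!: sigma_sets.Basic)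
  then have "(\<Union>k\<in>S. {T \<in> configurations. card (T \<inter> A) = k}) \<in> sets config_space"
    by (intro sets.countable_UN'') auto
  then show ?thesis by (rule back_subst[of "\<lambda>B. B \<in> _"]) auto
qed

lemma poisson_process_vimage_sets:
  assumes "poisson_process M m N" "A \<in> sets borel" "bounded A"
  shows "{\<omega> \<in> space M. card (N \<omega> \<inter> A) \<in> S} \<in> sets (vimage_algebra (space M) N config_space)"
proof -
  have "N -` {T \<in> configurations. card (T \<inter> A) \<in> S} \<inter> space M \<in> sets (vimage_algebra (space M) N config_space)"
    by (intro in_vimage_algebra count_sets_config_space assms)
  moreover have "N \<omega> \<in> configurations" if "\<omega> \<in> space M" for \<omega>
    using poisson_process_finite[OF assms(1) that] by (simp add: configurations_def)
  ultimately show ?thesis by (auto elim!: back_subst[of "\<lambda>B. B \<in> _"])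
qed

lemma poisson_process_events:
  assumes "poisson_process M m N" "A \<in> sets borel" "bounded A"
  shows "{\<omega> \<in> space M. card (N \<omega> \<inter> A) \<in> S} \<in> sets M"
proof -
  have "N \<in> measurable M config_space" using assms(1) by (simp add: poisson_process_def)
  then have "N -` {T \<in> configurations. card (T \<inter> A) \<in> S} \<inter> space M \<in> sets M"
    by (rule measurable_sets) (intro count_sets_config_space assms)
  moreover have "N \<omega> \<in> configurations" if "\<omega> \<in> space M" for \<omega>
    using poisson_process_finite[OF assms(1) that] by (simp add: configurations_def)
  ultimately show ?thesis by (auto elim!: back_subst[of "\<lambda>B. B \<in> _"])
qed

lemma poisson_process_prob:
  "poisson_process M m N \<Longrightarrow> A \<in> sets borel \<Longrightarrow> bounded A \<Longrightarrow>
    measure M {\<omega> \<in> space M. card (N \<omega> \<inter> A) = k} = measure m A ^ k / fact k * exp (- measure m A)"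
  by (simp add: poisson_process_def)

context prob_space begin

lemma poisson_process_nonempty_prob:
  assumes "poisson_process M m N" "A \<in> sets borel" "bounded A"
  shows "prob {\<omega> \<in> space M. 0 < card (N \<omega> \<inter> A)} = 1 - exp (- measure m A)"
proof -
  have E: "{\<omega> \<in> space M. card (N \<omega> \<inter> A) = 0} \<in> events"
    using poisson_process_events[OF assms, of "{0}"] by simp
  have "{\<omega> \<in> space M. 0 < card (N \<omega> \<inter> A)} = space M - {\<omega> \<in> space M. card (N \<omega> \<inter> A) = 0}" by auto
  then show ?thesis using prob_compl[OF E] poisson_process_prob[OF assms, of 0] by simp
qed

lemma poisson_process_ge_1:
  assumes "poisson_process M m N" "A \<in> sets borel" "bounded A"
  shows "prob {\<omega> \<in> space M. 0 < card (N \<omega> \<inter> A)} \<le> measure m A"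
  using exp_ge_add_one_self[of "- measure m A"] poisson_process_nonempty_prob[OF assms] by simp

lemma poisson_process_ge_2:
  assumes "poisson_process M m N" "A \<in> sets borel" "bounded A"
  shows "prob {\<omega> \<in> space M. 2 \<le> card (N \<omega> \<inter> A)} \<le> (measure m A)\<^sup>2"
proof -
  define \<mu> where "\<mu> = measure m A"
  define E where "E = {\<omega> \<in> space M. card (N \<omega> \<inter> A) \<in> {0}}"
  define E1 where "E1 = {\<omega> \<in> space M. card (N \<omega> \<inter> A) \<in> {1}}"
  have ev: "E \<in> events" "E1 \<in> events" unfolding E_def E1_def by (rule poisson_process_events[OF assms])+
  have "{\<omega> \<in> space M. 2 \<le> card (N \<omega> \<inter> A)} = space M - (E \<union> E1)" by (auto simp: E_def E1_def)
  then have "prob {\<omega> \<in> space M. 2 \<le> card (N \<omega> \<inter> A)} = 1 - prob (E \<union> E1)" using ev prob_compl by simp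
  also have "prob (E \<union> E1) = prob E + prob E1" by (intro finite_measure_Union ev) (auto simp: E_def E1_def)
  also have "prob E = exp (- \<mu>)" using poisson_process_prob[OF assms, of 0] by (simp add: E_def \<mu>_def)
  also have "prob E1 = \<mu> * exp (- \<mu>)" using poisson_process_prob[OF assms, of 1] by (simp add: E1_def \<mu>_def)
  also have "1 - (exp (- \<mu>) + \<mu> * exp (- \<mu>)) = 1 - (1 + \<mu>) * exp (- \<mu>)" by (simp add: algebra_simps)
  also have "\<dots> \<le> 1 - (1 + \<mu>) * (1 + - \<mu>)"
    by (intro diff_mono mult_left_mono exp_ge_add_one_self order_refl) (simp add: \<mu>_def)
  also have "\<dots> = \<mu>\<^sup>2" by (simp add: power2_eq_square algebra_simps)
  finally show ?thesis by (simp add: \<mu>_def)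
qed

text \<open>
  Bound \<open>\<mu> ^ j\<close> by \<open>2 ^ k * (\<mu> / 2) ^ j\<close> for \<open>j \<le> k\<close> and complete the exponential series.
\<close>

lemma poisson_process_lower_tail:
  assumes "poisson_process M m N" "A \<in> sets borel" "bounded A"
  shows "prob {\<omega> \<in> space M. card (N \<omega> \<inter> A) \<le> k} \<le> 2 ^ k * exp (- (measure m A / 2))"
proof -
  define \<mu> where "\<mu> = measure m A"
  have "\<mu> \<ge> 0" by (simp add: \<mu>_def)
  define E where "E j = {\<omega> \<in> space M. card (N \<omega> \<inter> A) = j}" for j
  have ev: "E j \<in> events" for j using poisson_process_events[OF assms, of "{j}"] by (simp add: E_def)
  have "{\<omega> \<in> space M. card (N \<omega> \<inter> A) \<le> k} = (\<Union>j\<in>{..k}. E j)" by (auto simp: E_def)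
  then have "prob {\<omega> \<in> space M. card (N \<omega> \<inter> A) \<le> k} = (\<Sum>j\<le>k. prob (E j))"
    using ev by (simp add: finite_measure_finite_Union disjoint_family_on_def E_def image_subset_iff)
       (subst finite_measure_finite_Union, auto simp: disjoint_family_on_def)
  also have "\<dots> = (\<Sum>j\<le>k. \<mu> ^ j / fact j * exp (- \<mu>))"
    using poisson_process_prob[OF assms] by (simp add: E_def \<mu>_def)
  also have "\<dots> \<le> (\<Sum>j\<le>k. 2 ^ k * ((\<mu> / 2) ^ j / fact j) * exp (- \<mu>))"
  proof (intro sum_mono mult_right_mono)
    fix j assume "j \<in> {..k}"
    have "\<mu> ^ j / fact j = 2 ^ j * ((\<mu> / 2) ^ j / fact j)" by (simp add: power_divide)
    also have "\<dots> \<le> 2 ^ k * ((\<mu> / 2) ^ j / fact j)"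
      using \<open>j \<in> {..k}\<close> \<open>\<mu> \<ge> 0\<close> by (intro mult_right_mono power_increasing) auto
    finally show "\<mu> ^ j / fact j \<le> 2 ^ k * ((\<mu> / 2) ^ j / fact j)" .
  qed simp
  also have "\<dots> = 2 ^ k * exp (- \<mu>) * (\<Sum>j\<le>k. (\<mu> / 2) ^ j / fact j)"
    by (simp add: sum_distrib_left mult_ac)
  also have "(\<Sum>j\<le>k. (\<mu> / 2) ^ j / fact j) \<le> exp (\<mu> / 2)"
    using \<open>\<mu> \<ge> 0\<close> sum_le_suminf[OF summable_exp[of "\<mu> / 2"], of "{..k}"]
    by (simp add: exp_def inverse_eq_divide field_simps)
  also have "2 ^ k * exp (- \<mu>) * exp (\<mu> / 2) = 2 ^ k * exp (- (\<mu> / 2))"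
    by (simp add: exp_add[symmetric] mult.assoc)
  finally show ?thesis by (simp add: \<mu>_def)
qed

lemma poisson_process_indep:
  assumes pp: "poisson_process M m N" and K: "finite K" "disjoint_family_on A K"
    and A: "\<And>q. q \<in> K \<Longrightarrow> A q \<in> sets borel \<and> bounded (A q)"
  shows "prob {\<omega> \<in> space M. \<forall>q\<in>K. card (N \<omega> \<inter> A q) \<in> S q}
       = (\<Prod>q\<in>K. prob {\<omega> \<in> space M. card (N \<omega> \<inter> A q) \<in> S q})"
proof (cases "K = {}")
  case True
  then show ?thesis by (simp add: prob_space)
next
  case False
  obtain h where h: "bij_betw h {..<card K} K"
    using ex_bij_betw_nat_finite[OF K(1)] by (auto simp: atLeast0LessThan)
  define B where "B i = (if i < card K then A (h i) else {})" for i
  have hK: "h i \<in> K" if "i < card K" for i using h that by (auto simp: bij_betw_def)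
  have "A (h i) \<inter> A (h j) = {}" if "i < card K" "j < card K" "i \<noteq> j" for i j
  proof (rule disjoint_family_onD[OF K(2) hK hK])
    show "h i \<noteq> h j" using that inj_onD[OF bij_betw_imp_inj_on[OF h], of i j] by auto
  qed (use that in auto)
  then have "disjoint_family B" by (simp add: disjoint_family_on_def B_def)
  moreover have "B i \<in> sets borel \<and> bounded (B i)" for i using A hK by (auto simp: B_def)
  ultimately have iv: "indep_vars (\<lambda>_. count_space UNIV) (\<lambda>i \<omega>. card (N \<omega> \<inter> B i)) UNIV"
    using pp by (simp add: poisson_process_def)
  have ne: "{..<card K} \<noteq> {}" using False K(1) by (auto simp: card_gt_0_iff lessThan_empty_iff)
  have "prob (\<Inter>i\<in>{..<card K}. (\<lambda>\<omega>. card (N \<omega> \<inter> B i)) -` S (h i) \<inter> space M)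
      = (\<Prod>i\<in>{..<card K}. prob ((\<lambda>\<omega>. card (N \<omega> \<inter> B i)) -` S (h i) \<inter> space M))"
    by (rule indep_varsD[OF iv ne]) auto
  also have "\<dots> = (\<Prod>i<card K. prob {\<omega> \<in> space M. card (N \<omega> \<inter> A (h i)) \<in> S (h i)})"
    by (intro prod.cong refl arg_cong[where f=prob]) (auto simp: B_def)
  also have "\<dots> = (\<Prod>q\<in>K. prob {\<omega> \<in> space M. card (N \<omega> \<inter> A q) \<in> S q})"
    by (rule prod.reindex_bij_betw[OF h])
  also have "(\<Inter>i\<in>{..<card K}. (\<lambda>\<omega>. card (N \<omega> \<inter> B i)) -` S (h i) \<inter> space M)
      = {\<omega> \<in> space M. \<forall>q\<in>K. card (N \<omega> \<inter> A q) \<in> S q}"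
  proof -
    have "(\<forall>q\<in>K. \<phi> q) \<longleftrightarrow> (\<forall>i\<in>{..<card K}. \<phi> (h i))" for \<phi>
    proof -
      have "(\<forall>q\<in>h ` {..<card K}. \<phi> q) \<longleftrightarrow> (\<forall>i\<in>{..<card K}. \<phi> (h i))" by blast
      then show ?thesis by (simp only: bij_betw_imp_surj_on[OF h])
    qed
    then show ?thesis using ne by (auto simp: B_def)
  qed
  finally show ?thesis .
qed

lemma poisson_processes_joint_indep:
  assumes pp: "poisson_process M m N" and K: "finite K" "disjoint_family_on A K"
    and A: "\<And>q. q \<in> K \<Longrightarrow> A q \<in> sets borel \<and> bounded (A q)"
    and pp': "poisson_process M m' N'" and K': "finite K'" "disjoint_family_on A' K'"
    and A': "\<And>q. q \<in> K' \<Longrightarrow> A' q \<in> sets borel \<and> bounded (A' q)"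
    and indep: "indep_configs M N N'"
  shows "prob {\<omega> \<in> space M. (\<forall>q\<in>K. card (N \<omega> \<inter> A q) \<in> S q) \<and> (\<forall>q\<in>K'. card (N' \<omega> \<inter> A' q) \<in> S' q)}
       = (\<Prod>q\<in>K. prob {\<omega> \<in> space M. card (N \<omega> \<inter> A q) \<in> S q}) *
         (\<Prod>q\<in>K'. prob {\<omega> \<in> space M. card (N' \<omega> \<inter> A' q) \<in> S' q})"
proof -
  let ?E = "{\<omega> \<in> space M. \<forall>q\<in>K. card (N \<omega> \<inter> A q) \<in> S q}"
  let ?E' = "{\<omega> \<in> space M. \<forall>q\<in>K'. card (N' \<omega> \<inter> A' q) \<in> S' q}"
  have "?E \<in> sets (vimage_algebra (space M) N config_space)"
    using sets.sets_Collect_finite_All[OF _ K(1), of "vimage_algebra (space M) N config_space"]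
      poisson_process_vimage_sets[OF pp] A by simp
  moreover have "?E' \<in> sets (vimage_algebra (space M) N' config_space)"
    using sets.sets_Collect_finite_All[OF _ K'(1), of "vimage_algebra (space M) N' config_space"]
      poisson_process_vimage_sets[OF pp'] A' by simp
  ultimately have "prob (?E \<inter> ?E') = prob ?E * prob ?E'"
    using indep unfolding indep_configs_def by (rule indep_setD[rotated])
  moreover have "?E \<inter> ?E' = {\<omega> \<in> space M. (\<forall>q\<in>K. card (N \<omega> \<inter> A q) \<in> S q) \<and> (\<forall>q\<in>K'. card (N' \<omega> \<inter> A' q) \<in> S' q)}"
    by auto
  ultimately show ?thesis
    using poisson_process_indep[OF pp K A] poisson_process_indep[OF pp' K' A'] by simp
qed

lemma prob_eq_measure_pmf:
  fixes X :: "'a \<Rightarrow> 'b :: countable"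
  assumes ev: "\<And>c. {\<omega> \<in> space M. X \<omega> = c} \<in> events"
    and pmf: "\<And>c. prob {\<omega> \<in> space M. X \<omega> = c} = pmf D c"
  shows "{\<omega> \<in> space M. X \<omega> \<in> S} \<in> events" "prob {\<omega> \<in> space M. X \<omega> \<in> S} = measure D S"
proof -
  have X: "X \<in> measurable M (count_space UNIV)"
    using ev by (intro measurable_count_space_eq2_countable[THEN iffD2])
       (auto simp: vimage_def Int_def conj_commute)
  show "{\<omega> \<in> space M. X \<omega> \<in> S} \<in> events"
    using measurable_sets[OF X, of S] by (simp add: vimage_def Int_def conj_commute)
  have "distr M (count_space UNIV) X = measure_pmf D"
  proof (rule measure_eqI_countable)
    fix c
    have "emeasure (distr M (count_space UNIV) X) {c} = emeasure M {\<omega> \<in> space M. X \<omega> = c}"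
      using X by (subst emeasure_distr) (auto simp: vimage_def Int_def conj_commute)
    then show "emeasure (distr M (count_space UNIV) X) {c} = emeasure D {c}"
      by (simp add: emeasure_eq_measure pmf emeasure_pmf_single)
  qed (auto intro: countableI_type)
  then have "measure D S = measure (distr M (count_space UNIV) X) S" by simp
  also have "\<dots> = prob {\<omega> \<in> space M. X \<omega> \<in> S}"
    using X by (subst measure_distr) (auto simp: vimage_def Int_def conj_commute)
  finally show "prob {\<omega> \<in> space M. X \<omega> \<in> S} = measure D S" ..
qed

text \<open>
  A set that agrees with a measurable \<open>B n\<close> off a measurable \<open>G n\<close> lies between the union of all
  \<open>B n - G n\<close> and the intersection of all \<open>B n \<union> G n\<close>, and these differ by a null set once the
  probabilities of \<open>G n\<close> tend to zero.
\<close>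

lemma completion_approximation:
  assumes B: "\<And>n. B n \<in> events" and G: "\<And>n. G n \<in> events"
    and S: "S \<subseteq> space M" "\<And>n \<omega>. \<omega> \<in> space M - G n \<Longrightarrow> \<omega> \<in> S \<longleftrightarrow> \<omega> \<in> B n"
    and lim: "(\<lambda>n. prob (G n)) \<longlonglongrightarrow> 0"
  shows "S \<in> sets (completion M)" "(\<lambda>n. prob (B n)) \<longlonglongrightarrow> measure (completion M) S"
proof -
  interpret C: prob_space "completion M" by (rule prob_space_completion)
  define L where "L = (\<Union>n. B n - G n)"
  define U where "U = (\<Inter>n. B n \<union> G n)"
  have ev: "L \<in> events" "U \<in> events" using B G by (auto simp: L_def U_def)
  have "L \<subseteq> S" using S(2) B sets.sets_into_space unfolding L_def by blast
  have "S \<subseteq> U" using S unfolding U_def by blast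
  have null: "U - L \<in> null_sets M"
  proof -
    have "prob (U - L) \<le> prob (G n)" for n
      by (intro finite_measure_mono G) (auto simp: U_def L_def)
    then have "prob (U - L) \<le> 0" by (intro LIMSEQ_le_const[OF lim]) auto
    then have "prob (U - L) = 0" using measure_nonneg[of M "U - L"] by linarith
    then show ?thesis using ev by (simp add: null_sets_def emeasure_eq_measure sets.Diff)
  qed
  have "S = L \<union> (S - L)" using \<open>L \<subseteq> S\<close> by auto
  moreover have "S - L \<subseteq> U - L" using \<open>S \<subseteq> U\<close> by auto
  ultimately show S': "S \<in> sets (completion M)"
    using ev(1) null by (intro sets_completionI[of S L "S - L" "U - L"]) auto
  have "\<bar>measure (completion M) S - prob (B n)\<bar> \<le> prob (G n)" for n
  proof -
    have "measure (completion M) S \<le> measure (completion M) (B n \<union> G n)"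
      using S(1) S(2)[of _ n] B[of n] G[of n] by (intro C.finite_measure_mono) blast+
    also have "\<dots> \<le> prob (B n) + prob (G n)" using B G by (simp add: measure_Un_le)
    finally have 1: "measure (completion M) S \<le> prob (B n) + prob (G n)" .
    have "measure (completion M) (B n) \<le> measure (completion M) (S \<union> G n)"
    proof (rule C.finite_measure_mono)
      show "B n \<subseteq> S \<union> G n" using S(2)[of _ n] sets.sets_into_space[OF B[of n]] by blast
      show "S \<union> G n \<in> C.events" by (rule sets.Un[OF S' sets_completionI_sets[OF G]])
    qed
    also have "\<dots> \<le> measure (completion M) S + prob (G n)"
      using S' G measure_Un_le[of S "completion M" "G n"] by simp
    finally show ?thesis using 1 B by simp
  qed
  then have "(\<lambda>n. prob (B n) - measure (completion M) S) \<longlonglongrightarrow> 0"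
    by (intro Lim_null_comparison[OF _ lim] always_eventually) (auto simp: abs_minus_commute)
  then show "(\<lambda>n. prob (B n)) \<longlonglongrightarrow> measure (completion M) S" by (rule LIM_zero_cancel)
qed

end

section \<open>Differences of Poisson variables\<close>

lemma tendsto_pmf_binomial_poisson:
  fixes b :: "nat \<Rightarrow> real"
  assumes b: "\<And>n. 0 \<le> b n \<and> b n \<le> 1" and lim: "(\<lambda>n. real n * b n) \<longlonglongrightarrow> r" and "r > 0"
  shows "(\<lambda>n. pmf (binomial_pmf n (b n)) k) \<longlonglongrightarrow> pmf (poisson_pmf r) k"
proof -
  have b0: "b \<longlonglongrightarrow> 0"
  proof -
    have "(\<lambda>n. (real n * b n) * (1 / real n)) \<longlonglongrightarrow> r * 0"
      by (intro tendsto_mult lim) real_asymp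
    moreover have "\<forall>\<^sub>F n in sequentially. (real n * b n) * (1 / real n) = b n"
      using eventually_gt_at_top[of 0] by eventually_elim simp
    ultimately show ?thesis using Lim_transform_eventually by fastforce
  qed
  have choose: "(\<lambda>n. real (n choose k) / real n ^ k) \<longlonglongrightarrow> 1 / fact k" for k
  proof (induction k)
    case (Suc k)
    have "(\<lambda>n. (real (n choose k) / real n ^ k) * ((real n - real k) / real n * (1 / real (Suc k)))) \<longlonglongrightarrow> 1 / fact k * (1 * (1 / real (Suc k)))"
      by (intro tendsto_mult Suc.IH tendsto_const) real_asymp
    moreover have "\<forall>\<^sub>F n in sequentially. (real (n choose k) / real n ^ k) * ((real n - real k) / real n * (1 / real (Suc k)))
        = real (n choose Suc k) / real n ^ Suc k"
      using eventually_ge_at_top[of k]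
    proof eventually_elim
      case (elim n)
      have "Suc k * (n choose Suc k) = (n - k) * (n choose k)"
        using binomial_absorb_comp[of n k] binomial_absorption[of k n] by simp
      then have "real (Suc k) * real (n choose Suc k) = (real n - real k) * real (n choose k)"
        using elim by (metis of_nat_diff of_nat_mult)
      then have "real (n choose Suc k) = (real n - real k) * real (n choose k) / real (Suc k)"
        by (simp add: field_simps del: of_nat_Suc)
      then show ?case by (simp add: mult_ac)
    qed
    ultimately have "(\<lambda>n. real (n choose Suc k) / real n ^ Suc k) \<longlonglongrightarrow> 1 / fact k * (1 * (1 / real (Suc k)))"
      by (rule Lim_transform_eventually)
    then show ?case by (simp add: field_simps)
  qed simp
  have exp: "(\<lambda>n. (1 - b n) ^ n) \<longlonglongrightarrow> exp (- r)"
  proof -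
    have small: "\<forall>\<^sub>F n in sequentially. b n < 1 / 2" using order_tendstoD(2)[OF b0, of "1/2"] by simp
    have "(\<lambda>n. real n * ln (1 - b n)) \<longlonglongrightarrow> - r"
    proof (rule tendsto_sandwich)
      show "\<forall>\<^sub>F n in sequentially. - (real n * b n) - 2 * (real n * b n) * b n \<le> real n * ln (1 - b n)"
        using small
      proof eventually_elim
        case (elim n)
        have "real n * (- b n - 2 * (b n)\<^sup>2) \<le> real n * ln (1 - b n)"
          using b[of n] elim by (intro mult_left_mono ln_one_minus_pos_lower_bound) auto
        then show ?case by (simp add: algebra_simps power2_eq_square)
      qed
      show "\<forall>\<^sub>F n in sequentially. real n * ln (1 - b n) \<le> - (real n * b n)"
        using small
      proof eventually_elim
        case (elim n)
        have "real n * ln (1 - b n) \<le> real n * (- b n)"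
          using b[of n] elim ln_le_minus_one[of "1 - b n"] by (intro mult_left_mono) auto
        then show ?case by simp
      qed
      have "(\<lambda>n. - (real n * b n) - 2 * (real n * b n) * b n) \<longlonglongrightarrow> - r - 2 * r * 0"
        by (intro tendsto_intros lim b0)
      then show "(\<lambda>n. - (real n * b n) - 2 * (real n * b n) * b n) \<longlonglongrightarrow> - r" by simp
      show "(\<lambda>n. - (real n * b n)) \<longlonglongrightarrow> - r" by (intro tendsto_minus lim)
    qed
    then have "(\<lambda>n. exp (real n * ln (1 - b n))) \<longlonglongrightarrow> exp (- r)" by (rule tendsto_exp)
    moreover have "\<forall>\<^sub>F n in sequentially. exp (real n * ln (1 - b n)) = (1 - b n) ^ n"
      using small by eventually_elim (simp add: exp_of_nat_mult)
    ultimately show ?thesis by (rule Lim_transform_eventually)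
  qed
  have "(\<lambda>n. (real (n choose k) / real n ^ k) * (real n * b n) ^ k * ((1 - b n) ^ n / (1 - b n) ^ k))
      \<longlonglongrightarrow> (1 / fact k) * r ^ k * (exp (- r) / (1 - 0) ^ k)"
    by (intro tendsto_mult tendsto_divide tendsto_power tendsto_diff tendsto_const choose lim exp b0) auto
  moreover have "\<forall>\<^sub>F n in sequentially.
      (real (n choose k) / real n ^ k) * (real n * b n) ^ k * ((1 - b n) ^ n / (1 - b n) ^ k)
      = pmf (binomial_pmf n (b n)) k"
    using eventually_ge_at_top[of k] eventually_gt_at_top[of 0] order_tendstoD(2)[OF b0, of 1, simplified]
  proof eventually_elim
    case (elim n)
    then show ?case using b[of n] by (simp add: power_mult_distrib power_diff)
  qed
  ultimately have "(\<lambda>n. pmf (binomial_pmf n (b n)) k) \<longlonglongrightarrow> (1 / fact k) * r ^ k * (exp (- r) / (1 - 0) ^ k)"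
    by (rule Lim_transform_eventually)
  then show ?thesis using \<open>r > 0\<close> by simp
qed

lemma measure_pair_pmf_eq_expectation:
  "exceedance V K = measure_pmf.expectation V (\<lambda>v. 1 - (\<Sum>k\<le>v. pmf K k))"
proof -
  have *: "measure K {k. v + 1 \<le> k} = 1 - (\<Sum>k\<le>v. pmf K k)" for v
  proof -
    have "measure K (UNIV - {..v}) = 1 - measure K {..v}"
      using measure_pmf.prob_compl[of "{..v}" K] by simp
    moreover have "UNIV - {..v} = {k. v + 1 \<le> k}" by auto
    ultimately show ?thesis by (simp add: measure_measure_pmf_finite)
  qed
  have "ennreal (exceedance V K) = emeasure (pair_pmf V K) {(v, k). v + 1 \<le> k}"
    by (simp add: measure_pmf.emeasure_eq_measure)
  also have "\<dots> = (\<integral>\<^sup>+ x. indicator {(v, k). v + 1 \<le> k} x \<partial>pair_pmf V K)" by simp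
  also have "\<dots> = (\<integral>\<^sup>+ v. \<integral>\<^sup>+ k. indicator {k. v + 1 \<le> k} k \<partial>K \<partial>V)"
    unfolding nn_integral_pair_pmf' by (intro nn_integral_cong) (auto simp: indicator_def)
  also have "\<dots> = (\<integral>\<^sup>+ v. ennreal (1 - (\<Sum>k\<le>v. pmf K k)) \<partial>V)"
    by (simp add: measure_pmf.emeasure_eq_measure *[simplified])
  also have "\<dots> = ennreal (measure_pmf.expectation V (\<lambda>v. 1 - (\<Sum>k\<le>v. pmf K k)))"
  proof (rule nn_integral_eq_integral)
    have b: "0 \<le> 1 - (\<Sum>k\<le>v. pmf K k)" "1 - (\<Sum>k\<le>v. pmf K k) \<le> 1" for v
      unfolding *[symmetric] by auto
    show "integrable V (\<lambda>v. 1 - (\<Sum>k\<le>v. pmf K k))"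
      using b by (intro measure_pmf.integrable_const_bound[of _ 1]) (auto simp: abs_le_iff intro: order_trans[OF _ b(1)])
    show "AE v in V. 0 \<le> 1 - (\<Sum>k\<le>v. pmf K k)" using b by simp
  qed
  finally show ?thesis
    by (subst (asm) ennreal_inj) (auto intro!: integral_nonneg_AE simp: *[symmetric])
qed

lemma tendsto_binomial_poisson_comparison:
  fixes b :: "nat \<Rightarrow> real"
  assumes "\<And>n. 0 \<le> b n \<and> b n \<le> 1" "(\<lambda>n. real n * b n) \<longlonglongrightarrow> r" "r > 0"
  shows "(\<lambda>n. exceedance V (binomial_pmf n (b n)))
     \<longlonglongrightarrow> exceedance V (poisson_pmf r)"
  unfolding measure_pair_pmf_eq_expectation
proof (rule integral_dominated_convergence[where w = "\<lambda>_. 1"])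
  show "AE v in V. (\<lambda>n. 1 - (\<Sum>k\<le>v. pmf (binomial_pmf n (b n)) k)) \<longlonglongrightarrow> 1 - (\<Sum>k\<le>v. pmf (poisson_pmf r) k)"
    by (intro AE_I2 tendsto_diff tendsto_const tendsto_sum tendsto_pmf_binomial_poisson assms)
  show "AE v in V. norm (1 - (\<Sum>k\<le>v. pmf (binomial_pmf n (b n)) k)) \<le> 1" for n
  proof (rule AE_I2)
    fix v
    have "(\<Sum>k\<le>v. pmf (binomial_pmf n (b n)) k) = measure (binomial_pmf n (b n)) {..v}"
      by (simp add: measure_measure_pmf_finite)
    then show "norm (1 - (\<Sum>k\<le>v. pmf (binomial_pmf n (b n)) k)) \<le> 1" by simp
  qed
qed auto

lemma expectation_iexp_poisson:
  assumes "r > 0"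
  shows "measure_pmf.expectation (poisson_pmf r) (\<lambda>k. iexp (h * real k)) = exp (of_real r * (iexp h - 1))"
proof -
  have int: "integrable (measure_pmf (poisson_pmf r)) (\<lambda>k. iexp (h * real k))"
    by (intro measure_pmf.integrable_const_bound[of _ 1]) auto
  have "measure_pmf.expectation (poisson_pmf r) (\<lambda>k. iexp (h * real k))
      = (LINT k|count_space UNIV. pmf (poisson_pmf r) k *\<^sub>R iexp (h * real k))"
    unfolding measure_pmf_eq_density by (rule integral_density) auto
  moreover have "integrable (count_space UNIV) (\<lambda>k. pmf (poisson_pmf r) k *\<^sub>R iexp (h * real k))"
    using int unfolding measure_pmf_eq_density by (subst (asm) integrable_density) auto
  ultimately have "(\<lambda>k. pmf (poisson_pmf r) k *\<^sub>R iexp (h * real k)) sums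
      measure_pmf.expectation (poisson_pmf r) (\<lambda>k. iexp (h * real k))"
    using sums_integral_count_space_nat by metis
  moreover have "(\<lambda>k. pmf (poisson_pmf r) k *\<^sub>R iexp (h * real k)) sums (exp (of_real r * iexp h) * exp (- of_real r))"
  proof -
    have "(\<lambda>k. ((of_real r * iexp h) ^ k /\<^sub>R fact k) * exp (- of_real r)) sums (exp (of_real r * iexp h) * exp (- of_real r))"
      by (intro sums_mult2 exp_converges)
    moreover have "((of_real r * iexp h) ^ k /\<^sub>R fact k) * exp (- of_real r) = pmf (poisson_pmf r) k *\<^sub>R iexp (h * real k)" for k
    proof -
      have "iexp h ^ k = iexp (h * real k)" by (simp add: exp_of_nat_mult[symmetric] mult_ac)
      moreover have "exp (- complex_of_real r) = of_real (exp (- r))" by (simp flip: exp_of_real)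
      ultimately show ?thesis using assms by (simp add: power_mult_distrib scaleR_conv_of_real divide_inverse mult_ac)
    qed
    ultimately show ?thesis by simp
  qed
  ultimately show ?thesis
    by (simp add: sums_unique2 exp_add[symmetric] algebra_simps)
qed

lemma sigma_sets_vimageE:
  assumes "S \<in> sigma_sets UNIV {S. \<exists>Y. S = X -` Y}"
  shows "\<exists>Y. S = X -` Y"
  using assms
proof induction
  case (Basic a) then show ?case by auto
next
  case Empty show ?case by (intro exI[of _ "{}"]) auto
next
  case (Compl a)
  then obtain Y where "a = X -` Y" by blast
  then show ?case by (intro exI[of _ "- Y"]) auto
next
  case (Union a)
  then obtain Y where "a i = X -` Y i" for i by metis
  then show ?case by (intro exI[of _ "\<Union>i. Y i"]) auto
qed

lemma indep_var_fst_snd: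
  fixes A B :: "'a :: countable pmf"
  shows "prob_space.indep_var (measure_pmf (pair_pmf A B)) (count_space UNIV) fst (count_space UNIV) snd"
proof -
  let ?prob = "measure_pmf.prob (pair_pmf A B)"
  have prod: "?prob (fst -` Y \<inter> snd -` Z) = ?prob (fst -` Y) * ?prob (snd -` Z)" for Y Z
  proof -
    have "?prob (fst -` Y) = measure_pmf.prob A Y" by (metis map_fst_pair_pmf measure_map_pmf)
    moreover have "?prob (snd -` Z) = measure_pmf.prob B Z" by (metis map_snd_pair_pmf measure_map_pmf)
    moreover have "fst -` Y \<inter> snd -` Z = Y \<times> Z" by auto
    ultimately show ?thesis
      using measure_pmf_prob_product[of Y Z A B] by (simp add: countableI_type)
  qed
  show ?thesis
    unfolding prob_space.indep_var_eq[OF prob_space_measure_pmf] prob_space.indep_sets2_eq[OF prob_space_measure_pmf]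
    by (auto dest!: sigma_sets_vimageE simp: prod)
qed

lemma char_poisson_difference:
  assumes "\<beta> > 0" "\<alpha> > 0"
  shows "char (distr (pair_pmf (poisson_pmf \<beta>) (poisson_pmf \<alpha>)) borel
            (\<lambda>(v, k). (real v - real k + c) / s)) \<theta>
     = iexp (\<theta> * c / s) * exp (of_real \<beta> * (iexp (\<theta> / s) - 1)) * exp (of_real \<alpha> * (iexp (- \<theta> / s) - 1))"
proof -
  let ?D = "pair_pmf (poisson_pmf \<beta>) (poisson_pmf \<alpha>)"
  let ?X = "\<lambda>z. (real (fst z) + c) / s" and ?Y = "\<lambda>z. - real (snd z) / s"
  have "prob_space.indep_var ?D borel ((\<lambda>v. (real v + c) / s) \<circ> fst) borel ((\<lambda>k. - real k / s) \<circ> snd)"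
    by (rule prob_space.indep_var_compose[OF prob_space_measure_pmf indep_var_fst_snd]) auto
  then have iv: "prob_space.indep_var ?D borel ?X borel ?Y" by (simp add: comp_def)
  have "(\<lambda>(v, k). (real v - real k + c) / s) = (\<lambda>z. ?X z + ?Y z)"
    by (auto simp: fun_eq_iff add_divide_distrib diff_divide_distrib)
  then have "char (distr ?D borel (\<lambda>(v, k). (real v - real k + c) / s)) \<theta>
      = char (distr ?D borel ?X) \<theta> * char (distr ?D borel ?Y) \<theta>"
    using prob_space.char_distr_add[OF prob_space_measure_pmf iv] by simp
  also have "char (distr ?D borel ?X) \<theta> = measure_pmf.expectation ?D (\<lambda>z. iexp (\<theta> * ((real (fst z) + c) / s)))"
    unfolding char_def by (subst integral_distr) auto
  also have "\<dots> = measure_pmf.expectation (poisson_pmf \<beta>) (\<lambda>v. iexp (\<theta> * ((real v + c) / s)))"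
    by (rule expectation_pair_pmf_fst)
  also have "\<dots> = measure_pmf.expectation (poisson_pmf \<beta>) (\<lambda>v. iexp (\<theta> * c / s) * iexp (\<theta> / s * real v))"
    by (intro Bochner_Integration.integral_cong refl) (simp add: exp_add[symmetric] add_divide_distrib algebra_simps)
  also have "\<dots> = iexp (\<theta> * c / s) * exp (of_real \<beta> * (iexp (\<theta> / s) - 1))"
    using expectation_iexp_poisson[OF assms(1), of "\<theta> / s"] by (subst integral_mult_right_zero) simp
  also have "char (distr ?D borel ?Y) \<theta> = measure_pmf.expectation ?D (\<lambda>z. iexp (\<theta> * (- real (snd z) / s)))"
    unfolding char_def by (subst integral_distr) auto
  also have "\<dots> = measure_pmf.expectation (poisson_pmf \<alpha>) (\<lambda>k. iexp (\<theta> * (- real k / s)))"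
    by (rule expectation_pair_pmf_snd)
  also have "\<dots> = measure_pmf.expectation (poisson_pmf \<alpha>) (\<lambda>k. iexp (- \<theta> / s * real k))"
    by (intro Bochner_Integration.integral_cong refl) simp
  also have "\<dots> = exp (of_real \<alpha> * (iexp (- \<theta> / s) - 1))"
    by (rule expectation_iexp_poisson[OF assms(2)])
  finally show ?thesis .
qed

lemma isCont_cdf_std_normal: "isCont (cdf std_normal_distribution) x"
proof -
  interpret real_distribution std_normal_distribution by (rule real_dist_normal_dist)
  have "AE y in lborel. y \<notin> {x}" by (rule AE_lborel_singleton[THEN AE_mp]) auto
  then have "emeasure std_normal_distribution {x} = 0"
    by (subst emeasure_density) (auto intro!: nn_integral_0_iff_AE[THEN iffD2] elim!: eventually_mono)
  then show ?thesis by (simp add: isCont_cdf measure_def)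
qed

text \<open>
  With \<open>V\<close> and \<open>K\<close> for the two variables, the event \<open>V + 1 \<le> K\<close> reads
  \<open>(V - K + 1 + s * u) / s \<le> u\<close>, in which the left side is asymptotically centred with variance tending to one.
  The summand \<open>1\<close>, which is negligible, turns the strict inequality into a value of the distribution function.
\<close>

theorem poisson_difference_clt:
  "((\<lambda>s. exceedance (poisson_pmf (s\<^sup>2 / 2 - s * u)) (poisson_pmf (s\<^sup>2 / 2)))
     \<longlongrightarrow> cdf std_normal_distribution u) at_top"
proof (rule tendsto_at_topI_sequentially)
  fix s :: "nat \<Rightarrow> real" assume s: "filterlim s at_top sequentially"
  define D where "D n = pair_pmf (poisson_pmf ((s n)\<^sup>2 / 2 - s n * u)) (poisson_pmf ((s n)\<^sup>2 / 2))" for n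
  define Q where "Q n = distr (D n) borel (\<lambda>(v, k). (real v - real k + (1 + s n * u)) / s n)" for n
  have ev: "\<forall>\<^sub>F n in sequentially. s n > 0 \<and> (s n)\<^sup>2 / 2 - s n * u > 0"
  proof -
    have "\<forall>\<^sub>F t in at_top. t > 0 \<and> t\<^sup>2 / 2 - t * u > 0" by (intro eventually_conj; real_asymp)
    then show ?thesis by (rule eventually_compose_filterlim[OF _ s])
  qed
  have "weak_conv_m Q std_normal_distribution"
  proof (rule levy_continuity)
    show "real_distribution (Q n)" for n
      unfolding Q_def by (intro prob_space.real_distribution_distr prob_space_measure_pmf) simp
    show "real_distribution std_normal_distribution" by (rule real_dist_normal_dist)
  next
    fix \<theta>
    define re where "re t = (t\<^sup>2 - t * u) * (cos (\<theta> / t) - 1)" for t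
    define im where "im t = \<theta> / t + \<theta> * u - t * u * sin (\<theta> / t)" for t
    have "(re \<longlongrightarrow> - (\<theta> * \<theta> / 2)) at_top" unfolding re_def by real_asymp
    then have "(\<lambda>n. re (s n)) \<longlonglongrightarrow> - (\<theta> * \<theta> / 2)" using s by (rule filterlim_compose)
    moreover have "(im \<longlongrightarrow> 0) at_top" unfolding im_def by real_asymp
    then have "(\<lambda>n. im (s n)) \<longlonglongrightarrow> 0" using s by (rule filterlim_compose)
    ultimately have "(\<lambda>n. exp (Complex (re (s n)) (im (s n)))) \<longlonglongrightarrow> exp (Complex (- (\<theta> * \<theta> / 2)) 0)"
      by (intro tendsto_exp tendsto_Complex)
    moreover have "exp (Complex (- (\<theta> * \<theta> / 2)) 0) = char std_normal_distribution \<theta>"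
    proof -
      have "Complex (- (\<theta> * \<theta> / 2)) 0 = of_real (- (\<theta> * \<theta> / 2))" by (rule complex_of_real_def[symmetric])
      then show ?thesis by (simp only: char_std_normal_distribution exp_of_real power2_eq_square minus_divide_left)
    qed
    moreover have "\<forall>\<^sub>F n in sequentially. exp (Complex (re (s n)) (im (s n))) = char (Q n) \<theta>"
      using ev
    proof eventually_elim
      case (elim n)
      have "char (Q n) \<theta> = iexp (\<theta> * (1 + s n * u) / s n)
          * exp (of_real ((s n)\<^sup>2 / 2 - s n * u) * (iexp (\<theta> / s n) - 1))
          * exp (of_real ((s n)\<^sup>2 / 2) * (iexp (- \<theta> / s n) - 1))"
        unfolding Q_def D_def using elim by (intro char_poisson_difference) auto
      also have "\<dots> = exp (\<i> * of_real (\<theta> * (1 + s n * u) / s n)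
          + of_real ((s n)\<^sup>2 / 2 - s n * u) * (iexp (\<theta> / s n) - 1)
          + of_real ((s n)\<^sup>2 / 2) * (iexp (- \<theta> / s n) - 1))"
        by (simp only: exp_add)
      also have "\<i> * of_real (\<theta> * (1 + s n * u) / s n)
          + of_real ((s n)\<^sup>2 / 2 - s n * u) * (iexp (\<theta> / s n) - 1)
          + of_real ((s n)\<^sup>2 / 2) * (iexp (- \<theta> / s n) - 1) = Complex (re (s n)) (im (s n))"
        using elim
        by (intro complex_eqI)
           (simp_all add: re_def im_def Re_exp Im_exp field_simps del: of_real_mult of_real_divide of_real_diff of_real_minus of_real_add)
      finally show ?case ..
    qed
    ultimately show "(\<lambda>n. char (Q n) \<theta>) \<longlonglongrightarrow> char std_normal_distribution \<theta>"
      using Lim_transform_eventually by fastforce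
  qed
  then have "(\<lambda>n. cdf (Q n) u) \<longlonglongrightarrow> cdf std_normal_distribution u"
    using isCont_cdf_std_normal by (simp add: weak_conv_m_def weak_conv_def)
  moreover have "\<forall>\<^sub>F n in sequentially. cdf (Q n) u = measure (D n) {(v, k). v + 1 \<le> k}"
    using ev
  proof eventually_elim
    case (elim n)
    have "cdf (Q n) u = measure (D n) {(v, k). (real v - real k + (1 + s n * u)) / s n \<le> u}"
      unfolding cdf_def Q_def by (subst measure_distr) (auto simp: vimage_def case_prod_unfold)
    also have "{(v, k). (real v - real k + (1 + s n * u)) / s n \<le> u} = {(v, k). v + 1 \<le> k}"
      using elim by (auto simp: field_simps)
    finally show ?case .
  qed
  ultimately show "(\<lambda>n. exceedance (poisson_pmf ((s n)\<^sup>2 / 2 - s n * u)) (poisson_pmf ((s n)\<^sup>2 / 2))) \<longlonglongrightarrow> cdf std_normal_distribution u"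
    unfolding D_def by (rule Lim_transform_eventually)
qed

section \<open>Discretising the Poisson system\<close>

abbreviation line_intensity :: "real \<Rightarrow> real measure" where
  "line_intensity lam \<equiv> scale_measure (ennreal lam) lborel"

abbreviation half_plane_intensity :: "(real \<times> real) measure" where
  "half_plane_intensity \<equiv> density lborel (indicator (UNIV \<times> {0<..}))"

lemma measure_line_intensity:
  assumes "0 < lam" "a \<le> b"
  shows "measure (line_intensity lam) {a<..b} = lam * (b - a)"
proof -
  have "measure (line_intensity lam) {a<..b} = lam * measure lborel {a<..b}"
    using assms by (simp add: measure_scale_measure)
  then show ?thesis using assms by simp
qed

lemma measure_plane_intensity:
  assumes "a \<le> b" "0 \<le> c" "c \<le> d"
  shows "measure half_plane_intensity ({a<..b} \<times> {c<..d}) = (b - a) * (d - c :: real)"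
proof -
  let ?A = "{a<..b} \<times> {c<..d}"
  have A: "?A \<in> sets borel" by (intro borel_Times) auto
  have "open (UNIV \<times> {0<..} :: (real \<times> real) set)" by (intro open_Times) auto
  then have I: "indicator (UNIV \<times> {0 :: real<..}) \<in> borel_measurable (lborel :: (real \<times> real) measure)"
    by (intro borel_measurable_indicator) (simp add: borel_open)
  have "emeasure half_plane_intensity ?A
      = (\<integral>\<^sup>+ z. indicator (UNIV \<times> {0<..}) z * indicator ?A z \<partial>(lborel :: (real \<times> real) measure))"
    using A I by (subst emeasure_density) auto
  also have "\<dots> = (\<integral>\<^sup>+ z. indicator ?A z \<partial>(lborel :: (real \<times> real) measure))"
    using assms(2) by (intro nn_integral_cong) (auto simp: indicator_def)
  also have "\<dots> = emeasure (lborel :: (real \<times> real) measure) ?A" using A by simp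
  also have "\<dots> = emeasure lborel {a<..b} * emeasure lborel {c<..d}"
    unfolding lborel_prod[symmetric] by (intro lborel.emeasure_pair_measure_Times) auto
  also have "\<dots> = ennreal ((b - a) * (d - c))" using assms by (simp add: ennreal_mult)
  finally show ?thesis using assms by (simp add: measure_def)
qed

definition grid :: "real \<Rightarrow> real \<Rightarrow> nat \<Rightarrow> nat \<Rightarrow> real" where
  "grid x R n i = x - R + R * real i / real n"

lemma grid_0 [simp]: "grid x R n 0 = x - R"
  by (simp add: grid_def)

lemma grid_n [simp]: "n > 0 \<Longrightarrow> grid x R n n = x"
  by (simp add: grid_def)

lemma grid_step: "grid x R n (Suc i) - grid x R n i = R / real n"
  by (simp add: grid_def add_divide_distrib algebra_simps)

lemma strict_mono_grid:
  assumes "R > 0" "n > 0"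
  shows "strict_mono (grid x R n)"
proof (rule strict_monoI_Suc)
  fix i
  have "R / real n > 0" using assms by simp
  then show "grid x R n i < grid x R n (Suc i)" using grid_step[of x R n i] by linarith
qed

lemma grid_cell_exists:
  assumes "R > 0" "n > 0" "x - R < y" "y \<le> x"
  shows "\<exists>i<n. grid x R n i < y \<and> y \<le> grid x R n (Suc i)"
proof -
  define i where "i = (LEAST i. y \<le> grid x R n (Suc i))"
  have "y \<le> grid x R n (Suc (n - 1))" using assms by simp
  then have i: "y \<le> grid x R n (Suc i)" and "i \<le> n - 1"
    unfolding i_def by (rule LeastI) (rule Least_le, fact)
  have "grid x R n i < y"
  proof (cases i)
    case 0 then show ?thesis using assms by simp
  next
    case (Suc k)
    then have "\<not> y \<le> grid x R n (Suc k)" using not_less_Least[of k "\<lambda>i. y \<le> grid x R n (Suc i)"] by (simp add: i_def)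
    then show ?thesis using Suc by simp
  qed
  then show ?thesis using i \<open>i \<le> n - 1\<close> assms(2) by (intro exI[of _ i]) auto
qed

abbreviation grid_cell :: "real \<Rightarrow> real \<Rightarrow> nat \<Rightarrow> nat \<Rightarrow> real set" where
  "grid_cell x R n i \<equiv> {grid x R n i<..grid x R n (Suc i)}"

lemma disjoint_grid_cells:
  assumes "R > 0" "n > 0" shows "disjoint_family (grid_cell x R n)"
proof -
  have "grid_cell x R n i \<inter> grid_cell x R n j = {}" if "i < j" for i j
    using strict_mono_less_eq[OF strict_mono_grid[OF assms], of x "Suc i" j] that by auto
  then show ?thesis unfolding disjoint_family_on_def by (metis Int_commute nat_neq_iff)
qed

definition grid_columns :: "real set \<Rightarrow> (real \<times> real) set \<Rightarrow> real \<Rightarrow> real \<Rightarrow> real \<Rightarrow> nat \<Rightarrow> (bool \<times> bool list) list" where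
  "grid_columns V P x R t n = map (\<lambda>i. (V \<inter> grid_cell x R n i \<noteq> {},
      map (\<lambda>j. P \<inter> (grid_cell x R n i \<times> grid_cell t t n j) \<noteq> {}) [0..<n])) [0..<n]"

locale poisson_system = prob_space M for M :: "'w measure" +
  fixes \<nu> :: "'w \<Rightarrow> real set" and P :: "'w \<Rightarrow> (real \<times> real) set" and lam :: real
  assumes lam_pos: "0 < lam"
    and line_poisson: "poisson_process M (line_intensity lam) \<nu>"
    and plane_poisson: "poisson_process M half_plane_intensity P"
    and independent: "indep_configs M \<nu> P"
begin

definition columns where "columns x R t n \<omega> = grid_columns (\<nu> \<omega>) (P \<omega>) x R t n"

text \<open>
  Off this event all strips of the grid satisfy the hypotheses of \<open>height_eq_last_passage\<close>. It is written as a
  union over counts so that it is measurable and easy to estimate.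
\<close>

definition crowded :: "real \<Rightarrow> real \<Rightarrow> real \<Rightarrow> nat \<Rightarrow> 'w set" where
  "crowded x R t n =
    (\<Union>i<n. {\<omega> \<in> space M. 2 \<le> card (\<nu> \<omega> \<inter> grid_cell x R n i)} \<union>
            ({\<omega> \<in> space M. 2 \<le> card (P \<omega> \<inter> (grid_cell x R n i \<times> {0<..t}))} \<union>
            ({\<omega> \<in> space M. 0 < card (\<nu> \<omega> \<inter> grid_cell x R n i) \<and> 0 < card (P \<omega> \<inter> (grid_cell x R n i \<times> {0<..t}))} \<union>
             {\<omega> \<in> space M. 2 \<le> card (P \<omega> \<inter> ({x - R<..x} \<times> grid_cell t t n i))})))"

lemma box_borel [simp]: "{a<..b} \<times> {c<..d} \<in> sets (borel :: (real \<times> real) measure)"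
  by (intro borel_Times) auto

lemma box_bounded [simp]: "bounded ({a<..b} \<times> {c<..d} :: (real \<times> real) set)"
  by (intro bounded_Times) auto

lemma finite_\<nu>: "\<omega> \<in> space M \<Longrightarrow> bounded A \<Longrightarrow> finite (\<nu> \<omega> \<inter> A)"
  by (rule poisson_process_finite[OF line_poisson])

lemma finite_P: "\<omega> \<in> space M \<Longrightarrow> bounded A \<Longrightarrow> finite (P \<omega> \<inter> A)"
  by (rule poisson_process_finite[OF plane_poisson])

text \<open>
  Each of the \<open>n\<close> strips has intensity of order \<open>1 / n\<close>, so two points in it have probability of order
  \<open>1 / n\<^sup>2\<close>.
\<close>

lemma crowded_bound:
  assumes "0 < R" "0 < t" "0 < n"
  shows "crowded x R t n \<in> events"
    "prob (crowded x R t n) \<le> ((lam * R)\<^sup>2 + 2 * (R * t)\<^sup>2 + lam * R * (R * t)) / real n"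
proof -
  let ?c = "grid_cell x R n" and ?r = "grid_cell t t n"
  define A where "A i = {\<omega> \<in> space M. card (\<nu> \<omega> \<inter> ?c i) \<in> {2..}}" for i
  define B where "B i = {\<omega> \<in> space M. card (P \<omega> \<inter> (?c i \<times> {0<..t})) \<in> {2..}}" for i
  define C where "C i = {\<omega> \<in> space M. card (\<nu> \<omega> \<inter> ?c i) \<in> {0<..}} \<inter> {\<omega> \<in> space M. card (P \<omega> \<inter> (?c i \<times> {0<..t})) \<in> {0<..}}" for i
  define D where "D i = {\<omega> \<in> space M. card (P \<omega> \<inter> ({x - R<..x} \<times> ?r i)) \<in> {2..}}" for i
  have ev: "A i \<in> events" "B i \<in> events" "C i \<in> events" "D i \<in> events" for i
    unfolding A_def B_def C_def D_def
    by (intro sets.Int poisson_process_events[OF line_poisson] poisson_process_events[OF plane_poisson]; simp)+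
  have eq: "crowded x R t n = (\<Union>i<n. A i \<union> (B i \<union> (C i \<union> D i)))"
    unfolding crowded_def A_def B_def C_def D_def by (intro SUP_cong) auto
  show "crowded x R t n \<in> events" unfolding eq using ev by (intro sets.finite_UN sets.Un) auto
  have mono: "?c i = {grid x R n i<..grid x R n i + R / real n}" "?r i = {grid t t n i<..grid t t n i + t / real n}" "0 \<le> grid t t n i" for i
    using grid_step[of x R n i] grid_step[of t t n i] assms by (auto simp: algebra_simps) (simp add: grid_def)
  have line: "measure (line_intensity lam) (?c i) = lam * R / real n" for i
    unfolding mono(1) using lam_pos assms by (subst measure_line_intensity) auto
  have strip: "measure half_plane_intensity (?c i \<times> {0<..t}) = R * t / real n" for i
    unfolding mono(1) using assms by (subst measure_plane_intensity) auto
  have row: "measure half_plane_intensity ({x - R<..x} \<times> ?r i) = R * t / real n" for i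
    unfolding mono(2) using assms mono(3) by (subst measure_plane_intensity) auto
  have "prob (A i) \<le> (lam * R / real n)\<^sup>2" for i
    using poisson_process_ge_2[OF line_poisson, of "?c i"] by (simp add: A_def line)
  moreover have "prob (B i) \<le> (R * t / real n)\<^sup>2" for i
    using poisson_process_ge_2[OF plane_poisson, of "?c i \<times> {0<..t}"] by (simp add: B_def strip)
  moreover have "prob (D i) \<le> (R * t / real n)\<^sup>2" for i
    using poisson_process_ge_2[OF plane_poisson, of "{x - R<..x} \<times> ?r i"] by (simp add: D_def row)
  moreover have "prob (C i) \<le> (lam * R / real n) * (R * t / real n)" for i
  proof -
    have "prob (C i) = prob {\<omega> \<in> space M. card (\<nu> \<omega> \<inter> ?c i) \<in> {0<..}} * prob {\<omega> \<in> space M. card (P \<omega> \<inter> (?c i \<times> {0<..t})) \<in> {0<..}}"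
      unfolding C_def using independent unfolding indep_configs_def
      by (rule indep_setD) (intro poisson_process_vimage_sets[OF line_poisson] poisson_process_vimage_sets[OF plane_poisson]; simp)+
    also have "\<dots> \<le> (lam * R / real n) * (R * t / real n)"
      using poisson_process_ge_1[OF line_poisson, of "?c i"] poisson_process_ge_1[OF plane_poisson, of "?c i \<times> {0<..t}"]
        assms lam_pos by (intro mult_mono) (auto simp: line strip)
    finally show ?thesis .
  qed
  ultimately have each: "prob (A i \<union> (B i \<union> (C i \<union> D i))) \<le>
      (lam * R / real n)\<^sup>2 + ((R * t / real n)\<^sup>2 + ((lam * R / real n) * (R * t / real n) + (R * t / real n)\<^sup>2))" for i
    using ev by (intro order_trans[OF measure_Un_le] add_mono sets.Un) auto
  have "prob (crowded x R t n) \<le> (\<Sum>i<n. prob (A i \<union> (B i \<union> (C i \<union> D i))))"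
    unfolding eq using ev by (intro finite_measure_subadditive_finite) auto
  also have "\<dots> \<le> (\<Sum>i<n. (lam * R / real n)\<^sup>2 + ((R * t / real n)\<^sup>2 + ((lam * R / real n) * (R * t / real n) + (R * t / real n)\<^sup>2)))"
    by (intro sum_mono each)
  also have "\<dots> = ((lam * R)\<^sup>2 + 2 * (R * t)\<^sup>2 + lam * R * (R * t)) / real n"
    using assms(3) by (simp add: power2_eq_square field_simps)
  finally show "prob (crowded x R t n) \<le> ((lam * R)\<^sup>2 + 2 * (R * t)\<^sup>2 + lam * R * (R * t)) / real n" .
qed

lemma crowded_tendsto_0:
  assumes "0 < R" "0 < t"
  shows "(\<lambda>n. prob (crowded x R t (Suc n))) \<longlonglongrightarrow> 0"
proof (rule tendsto_sandwich[OF _ _ tendsto_const])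
  define K where "K = (lam * R)\<^sup>2 + 2 * (R * t)\<^sup>2 + lam * R * (R * t)"
  show "\<forall>\<^sub>F n in sequentially. prob (crowded x R t (Suc n)) \<le> K * inverse (real (Suc n))"
    using crowded_bound(2)[OF assms, of "Suc _" x] by (simp add: K_def divide_inverse)
  show "(\<lambda>n. K * inverse (real (Suc n))) \<longlonglongrightarrow> 0"
    using tendsto_mult[OF tendsto_const LIMSEQ_inverse_real_of_nat, of K] by simp
qed simp

lemma not_crowdedD:
  assumes "\<omega> \<in> space M - crowded x R t n" "i < n"
  shows "card (\<nu> \<omega> \<inter> grid_cell x R n i) + card (P \<omega> \<inter> (grid_cell x R n i \<times> {0<..t})) \<le> 1"
    "card (P \<omega> \<inter> ({x - R<..x} \<times> grid_cell t t n i)) \<le> 1"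
proof -
  have "\<not> 2 \<le> card (\<nu> \<omega> \<inter> grid_cell x R n i)" "\<not> 2 \<le> card (P \<omega> \<inter> (grid_cell x R n i \<times> {0<..t}))"
    "\<not> (0 < card (\<nu> \<omega> \<inter> grid_cell x R n i) \<and> 0 < card (P \<omega> \<inter> (grid_cell x R n i \<times> {0<..t})))"
    "\<not> 2 \<le> card (P \<omega> \<inter> ({x - R<..x} \<times> grid_cell t t n i))"
    using assms unfolding crowded_def by blast+
  then show "card (\<nu> \<omega> \<inter> grid_cell x R n i) + card (P \<omega> \<inter> (grid_cell x R n i \<times> {0<..t})) \<le> 1"
    "card (P \<omega> \<inter> ({x - R<..x} \<times> grid_cell t t n i)) \<le> 1" by linarith+
qed

lemma grid_height:
  assumes "0 < R" "0 < t" "0 < n" and \<omega>: "\<omega> \<in> space M - crowded x R t n"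
    and V: "V \<subseteq> \<nu> \<omega>"
  shows "k \<le> height (\<lambda>i. card (V \<inter> {x - R<..grid x R n i})) (\<lambda>_. 0)
            (\<lambda>i j. P \<omega> \<inter> (grid_cell x R n i \<times> grid_cell t t n j) \<noteq> {}) n n \<longleftrightarrow>
     (\<exists>z C. x - R \<le> z \<and> z \<le> x \<and> chain_in (P \<omega>) z x t C \<and>
        k \<le> card (V \<inter> {x - R<..z}) + card C)"
proof -
  have \<omega>M: "\<omega> \<in> space M" using \<omega> by simp
  have finV: "finite (V \<inter> A)" if "bounded A" for A
    by (rule finite_subset[OF _ finite_\<nu>[OF \<omega>M that]]) (use V in auto)
  have *: "card (V \<inter> grid_cell x R n i) + card (P \<omega> \<inter> (grid_cell x R n i \<times> {0<..grid t t n n})) \<le> 1" if "i < n" for i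
  proof -
    have "card (V \<inter> grid_cell x R n i) \<le> card (\<nu> \<omega> \<inter> grid_cell x R n i)"
      using V by (intro card_mono finite_\<nu>[OF \<omega>M]) auto
    then show ?thesis using not_crowdedD(1)[OF \<omega> that] assms by simp
  qed
  have **: "card (P \<omega> \<inter> ({grid x R n 0<..grid x R n n} \<times> grid_cell t t n j)) \<le> 1" if "j < n" for j
    using not_crowdedD(2)[OF \<omega> that] assms by simp
  show ?thesis
    using height_eq_last_passage[OF strict_mono_grid[OF assms(1,3), of x] strict_mono_grid[OF assms(2,3), of t] _ finV
        finite_P[OF \<omega>M] * **, of n n k] assms by simp
qed

lemma sources_count:
  assumes "0 < R" "0 < t" "0 < n" and \<omega>: "\<omega> \<in> space M - crowded x R t n" and "i \<le> n"
  shows "bits_height (sources (columns x R t n \<omega>)) i = card (\<nu> \<omega> \<inter> {x - R<..grid x R n i})"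
  using \<open>i \<le> n\<close>
proof (induction i)
  case 0 then show ?case by (simp add: bits_height_def)
next
  case (Suc i)
  let ?s = "sources (columns x R t n \<omega>)"
  have fin: "finite (\<nu> \<omega> \<inter> {a<..b})" for a b using \<omega> by (intro finite_\<nu>) auto
  have len: "length ?s = n" by (simp add: sources_def columns_def grid_columns_def)
  have "?s ! i = (\<nu> \<omega> \<inter> grid_cell x R n i \<noteq> {})"
    using Suc.prems by (simp add: sources_def columns_def grid_columns_def)
  moreover have "card (\<nu> \<omega> \<inter> grid_cell x R n i) \<le> 1" using not_crowdedD(1)[OF \<omega>, of i] Suc.prems by simp
  then have "of_bool (\<nu> \<omega> \<inter> grid_cell x R n i \<noteq> {}) = card (\<nu> \<omega> \<inter> grid_cell x R n i)"
    using fin[of "grid x R n i" "grid x R n (Suc i)"] by (cases "\<nu> \<omega> \<inter> grid_cell x R n i = {}") (auto simp: card_gt_0_iff le_Suc_eq)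
  ultimately have step: "bits_height ?s (Suc i) = bits_height ?s i + card (\<nu> \<omega> \<inter> grid_cell x R n i)"
    using Suc.prems len
    by (cases "\<nu> \<omega> \<inter> grid_cell x R n i = {}") (auto simp: bits_height_def take_Suc_conv_app_nth)
  have "x - R \<le> grid x R n i" "grid x R n i \<le> grid x R n (Suc i)"
    using strict_mono_less_eq[OF strict_mono_grid[OF assms(1,3)], of x 0 i]
      strict_mono_less_eq[OF strict_mono_grid[OF assms(1,3)], of x i "Suc i"] by simp_all
  from card_Int_Ioc_split[OF fin this] show ?case using step Suc by simp
qed

text \<open>
  The optimal height minus the number of all sources is the flux through \<open>x\<close>, restricted to paths that start in
  \<open>[x - R, x]\<close>.
\<close>

lemma source_height_columns:
  assumes "0 < R" "0 < t" "0 < n" and \<omega>: "\<omega> \<in> space M - crowded x R t n"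
  shows "v + trues (sources (columns x R t n \<omega>)) \<le> source_height n (columns x R t n \<omega>) \<longleftrightarrow>
     (\<exists>z C. x - R \<le> z \<and> z \<le> x \<and> chain_in (P \<omega>) z x t C \<and> card (\<nu> \<omega> \<inter> {z<..x}) + v \<le> card C)"
proof -
  have len: "length (columns x R t n \<omega>) = n" by (simp add: columns_def grid_columns_def)
  have height: "source_height n (columns x R t n \<omega>)
      = height (\<lambda>i. card (\<nu> \<omega> \<inter> {x - R<..grid x R n i})) (\<lambda>_. 0)
            (\<lambda>i j. P \<omega> \<inter> (grid_cell x R n i \<times> grid_cell t t n j) \<noteq> {}) n n"
    unfolding source_height_def len
  proof (rule height_cong[of n _ _ n])
    show "bits_height (sources (columns x R t n \<omega>)) i = card (\<nu> \<omega> \<inter> {x - R<..grid x R n i})" if "i \<le> n" for i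
      by (rule sources_count[OF assms that])
  qed (auto simp: cell_of_def columns_def grid_columns_def)
  have total: "trues (sources (columns x R t n \<omega>)) = card (\<nu> \<omega> \<inter> {x - R<..x})"
    using sources_count[OF assms order_refl] assms(3) len by (simp add: bits_height_def sources_def)
  have fin: "finite (\<nu> \<omega> \<inter> {a<..b})" for a b using \<omega> by (intro finite_\<nu>) auto
  have split: "card (\<nu> \<omega> \<inter> {x - R<..x}) = card (\<nu> \<omega> \<inter> {x - R<..z}) + card (\<nu> \<omega> \<inter> {z<..x})"
    if "x - R \<le> z" "z \<le> x" for z
    by (rule card_Int_Ioc_split[OF fin that])
  show ?thesis unfolding height total grid_height[OF assms order_refl] using split by fastforce
qed

lemma bulk_height_columns:
  assumes "0 < R" "0 < t" "0 < n" and \<omega>: "\<omega> \<in> space M - crowded x R t n"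
    and C: "chain_in (P \<omega>) (x - R) x t C"
  shows "card C \<le> bulk_height n (columns x R t n \<omega>)"
proof -
  have len: "length (columns x R t n \<omega>) = n" by (simp add: columns_def grid_columns_def)
  have "bulk_height n (columns x R t n \<omega>)
      = height (\<lambda>i. card ({} \<inter> {x - R<..grid x R n i})) (\<lambda>_. 0)
            (\<lambda>i j. P \<omega> \<inter> (grid_cell x R n i \<times> grid_cell t t n j) \<noteq> {}) n n"
    unfolding bulk_height_def len
    by (rule height_cong[of n _ _ n]) (auto simp: cell_of_def columns_def grid_columns_def)
  then show ?thesis
    using grid_height[OF assms(1-4), of "{}" "card C"] C assms(1) by force
qed

end

section \<open>The law of the flux\<close>

lemma map_columns_eq_iff:
  assumes "length c = n" "\<forall>i<n. length (snd (c ! i)) = n"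
  shows "map (\<lambda>i. (u i, map (w i) [0..<n])) [0..<n] = c \<longleftrightarrow>
     (\<forall>i<n. u i = fst (c ! i)) \<and> (\<forall>i<n. \<forall>j<n. w i j = snd (c ! i) ! j)"
  using assms by (auto simp: list_eq_iff_nth_eq prod_eq_iff)

context poisson_system begin

lemma occupied_prob:
  assumes "poisson_process M m N" "A \<in> sets borel" "bounded A"
  shows "prob {\<omega> \<in> space M. card (N \<omega> \<inter> A) \<in> {k. (0 < k) = b}} = pmf (bernoulli_pmf (1 - exp (- measure m A))) b"
  using poisson_process_nonempty_prob[OF assms] poisson_process_prob[OF assms, of 0]
  by (cases b) simp_all

text \<open>
  The occupation numbers of disjoint sets are independent, whence the occupied cells form independent Bernoulli
  variables, and the count on \<open>(x, y]\<close> is independent of them.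
\<close>

lemma columns_law:
  assumes "0 < R" "0 < t" "0 < n" "x \<le> y"
  defines "a \<equiv> 1 - exp (- (lam * R / real n))" and "p \<equiv> 1 - exp (- (R * t / (real n * real n)))"
  defines "E \<equiv> \<lambda>l c. {\<omega> \<in> space M. card (\<nu> \<omega> \<inter> {x<..y}) = l \<and> columns x R t n \<omega> = c}"
  shows "E l c \<in> events"
    and "prob (E l c) = prob {\<omega> \<in> space M. card (\<nu> \<omega> \<inter> {x<..y}) = l} * pmf (replicate_pmf n (column_pmf n a p)) c"
proof -
  have "E l c \<in> events \<and>
    prob (E l c) = prob {\<omega> \<in> space M. card (\<nu> \<omega> \<inter> {x<..y}) = l} * pmf (replicate_pmf n (column_pmf n a p)) c"
  proof (cases "length c = n \<and> (\<forall>i<n. length (snd (c ! i)) = n)")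
    case False
    have "pmf (replicate_pmf n (column_pmf n a p)) c = 0"
    proof (cases "length c = n")
      case True
      then obtain i where "i < n" "length (snd (c ! i)) \<noteq> n" using False by blast
      then have "pmf (column_pmf n a p) (c ! i) = 0"
        by (cases "c ! i") (simp add: column_pmf_def pmf_pair pmf_replicate_pmf)
      then show ?thesis using True \<open>i < n\<close> by (auto simp: pmf_replicate_pmf intro!: bexI[of _ i])
    qed (simp add: pmf_replicate_pmf)
    moreover have "length (columns x R t n \<omega>) = n \<and> (\<forall>i<n. length (snd (columns x R t n \<omega> ! i)) = n)" for \<omega>
      by (simp add: columns_def grid_columns_def)
    then have "E l c = {}" using False unfolding E_def by blast
    ultimately show ?thesis by simp
  next
    case True
    define A where "A q = (if q < n then grid_cell x R n q else {x<..y})" for q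
    define S where "S q = (if q < n then {k. (0 < k) = fst (c ! q)} else {l})" for q :: nat
    define B where "B q = grid_cell x R n (fst q) \<times> grid_cell t t n (snd q)" for q
    define T where "T q = {k :: nat. (0 < k) = snd (c ! fst q) ! snd q}" for q :: "nat \<times> nat"
    define K where "K = {..<n} \<times> {..<n}"
    have A: "A q \<in> sets borel \<and> bounded (A q)" for q by (auto simp: A_def)
    have B: "B q \<in> sets borel \<and> bounded (B q)" for q by (auto simp: B_def)
    have disjA: "disjoint_family_on A {..n}"
    proof -
      have "grid x R n (Suc i) \<le> x" if "i < n" for i
        using strict_mono_less_eq[OF strict_mono_grid[OF assms(1,3)], of x "Suc i" n] that assms(3) by simp
      then have last: "grid_cell x R n i \<inter> {x<..y} = {}" if "i < n" for i using that by fastforce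
      have "grid_cell x R n i \<inter> grid_cell x R n j = {}" if "i \<noteq> j" for i j
        using disjoint_grid_cells[OF assms(1,3), of x] that by (simp add: disjoint_family_on_def)
      then show ?thesis using last by (auto simp: disjoint_family_on_def A_def)
    qed
    have disjB: "disjoint_family_on B K"
    proof -
      have "B q \<inter> B r = {}" if "q \<noteq> r" for q r
      proof (cases "fst q = fst r")
        case True
        then have "grid_cell t t n (snd q) \<inter> grid_cell t t n (snd r) = {}"
          using disjoint_grid_cells[OF assms(2,3), of t] that by (simp add: disjoint_family_on_def prod_eq_iff)
        then show ?thesis by (auto simp: B_def)
      next
        case False
        then have "grid_cell x R n (fst q) \<inter> grid_cell x R n (fst r) = {}"
          using disjoint_grid_cells[OF assms(1,3), of x] by (simp add: disjoint_family_on_def)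
        then show ?thesis by (auto simp: B_def)
      qed
      then show ?thesis by (simp add: disjoint_family_on_def)
    qed
    have pos: "0 < card (N \<inter> A) \<longleftrightarrow> N \<inter> A \<noteq> {}" if "finite (N \<inter> A)" for N A :: "'z set"
      using that by (simp add: card_gt_0_iff)
    have E: "E l c = {\<omega> \<in> space M. (\<forall>q\<in>{..n}. card (\<nu> \<omega> \<inter> A q) \<in> S q) \<and> (\<forall>q\<in>K. card (P \<omega> \<inter> B q) \<in> T q)}"
    proof -
      have "columns x R t n \<omega> = c \<longleftrightarrow> (\<forall>i<n. card (\<nu> \<omega> \<inter> A i) \<in> S i) \<and> (\<forall>q\<in>K. card (P \<omega> \<inter> B q) \<in> T q)"
        if \<omega>: "\<omega> \<in> space M" for \<omega>
      proof -
        have "columns x R t n \<omega> = c \<longleftrightarrow> (\<forall>i<n. (\<nu> \<omega> \<inter> grid_cell x R n i \<noteq> {}) = fst (c ! i)) \<and>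
            (\<forall>i<n. \<forall>j<n. (P \<omega> \<inter> (grid_cell x R n i \<times> grid_cell t t n j) \<noteq> {}) = snd (c ! i) ! j)"
          unfolding columns_def grid_columns_def using True by (intro map_columns_eq_iff) auto
        also have "\<dots> \<longleftrightarrow> (\<forall>i<n. card (\<nu> \<omega> \<inter> A i) \<in> S i) \<and> (\<forall>q\<in>K. card (P \<omega> \<inter> B q) \<in> T q)"
        proof -
          have "card (\<nu> \<omega> \<inter> A i) \<in> S i \<longleftrightarrow> (\<nu> \<omega> \<inter> grid_cell x R n i \<noteq> {}) = fst (c ! i)" if "i < n" for i
            using pos[OF finite_\<nu>[OF \<omega>], of "grid_cell x R n i"] that by (simp add: A_def S_def)
          then have "(\<forall>i<n. card (\<nu> \<omega> \<inter> A i) \<in> S i) \<longleftrightarrow> (\<forall>i<n. (\<nu> \<omega> \<inter> grid_cell x R n i \<noteq> {}) = fst (c ! i))"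
            by metis
          moreover have "card (P \<omega> \<inter> B (i, j)) \<in> T (i, j) \<longleftrightarrow>
              (P \<omega> \<inter> (grid_cell x R n i \<times> grid_cell t t n j) \<noteq> {}) = snd (c ! i) ! j" for i j
            using pos[OF finite_P[OF \<omega>], of "B (i, j)"] B[of "(i, j)"] by (simp add: B_def T_def)
          moreover have "(\<forall>q\<in>K. \<phi> q) \<longleftrightarrow> (\<forall>i<n. \<forall>j<n. \<phi> (i, j))" for \<phi>
            by (auto simp: K_def)
          ultimately show ?thesis by (simp only:)
        qed
        finally show ?thesis .
      qed
      moreover have "(\<forall>q\<in>{..n}. card (\<nu> \<omega> \<inter> A q) \<in> S q) \<longleftrightarrow> (\<forall>q<n. card (\<nu> \<omega> \<inter> A q) \<in> S q) \<and> card (\<nu> \<omega> \<inter> {x<..y}) = l" for \<omega>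
        unfolding lessThan_Suc_atMost[symmetric] lessThan_Suc by (auto simp: A_def S_def)
      ultimately show ?thesis unfolding E_def by auto
    qed
    have "E l c \<in> events" unfolding E
      using poisson_process_events[OF line_poisson] poisson_process_events[OF plane_poisson] A B
      by (intro sets.sets_Collect_conj sets.sets_Collect_finite_All) (auto simp: K_def)
    have line: "measure (line_intensity lam) (grid_cell x R n i) = lam * R / real n" for i
      using grid_step[of x R n i] assms(1,3) lam_pos strict_mono_less_eq[OF strict_mono_grid[OF assms(1,3)], of x i "Suc i"]
      by (subst measure_line_intensity) auto
    have plane: "measure half_plane_intensity (B q) = R * t / (real n * real n)" for q
      unfolding B_def using grid_step[of x R n "fst q"] grid_step[of t t n "snd q"] assms(1-3)
        strict_mono_less_eq[OF strict_mono_grid[OF assms(1,3)], of x "fst q" "Suc (fst q)"]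
        strict_mono_less_eq[OF strict_mono_grid[OF assms(2,3)], of t "snd q" "Suc (snd q)"]
      by (subst measure_plane_intensity) (auto simp: grid_def)
    have "prob (E l c) = (\<Prod>q\<le>n. prob {\<omega> \<in> space M. card (\<nu> \<omega> \<inter> A q) \<in> S q}) *
         (\<Prod>q\<in>K. prob {\<omega> \<in> space M. card (P \<omega> \<inter> B q) \<in> T q})"
      unfolding E by (rule poisson_processes_joint_indep[OF line_poisson _ disjA A plane_poisson _ disjB B independent])
        (auto simp: K_def)
    also have "(\<Prod>q\<le>n. prob {\<omega> \<in> space M. card (\<nu> \<omega> \<inter> A q) \<in> S q})
        = (\<Prod>i<n. pmf (bernoulli_pmf a) (fst (c ! i))) * prob {\<omega> \<in> space M. card (\<nu> \<omega> \<inter> {x<..y}) = l}"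
    proof -
      have "prob {\<omega> \<in> space M. card (\<nu> \<omega> \<inter> A i) \<in> S i} = pmf (bernoulli_pmf a) (fst (c ! i))" if "i < n" for i
        using occupied_prob[OF line_poisson, of "grid_cell x R n i" "fst (c ! i)"] that
        by (simp add: A_def S_def line a_def)
      then show ?thesis unfolding lessThan_Suc_atMost[symmetric] by (simp add: A_def S_def)
    qed
    also have "(\<Prod>q\<in>K. prob {\<omega> \<in> space M. card (P \<omega> \<inter> B q) \<in> T q})
        = (\<Prod>q\<in>K. pmf (bernoulli_pmf p) (snd (c ! fst q) ! snd q))"
      using occupied_prob[OF plane_poisson] B by (intro prod.cong refl) (simp add: T_def plane p_def)
    also have "\<dots> = (\<Prod>i<n. \<Prod>j<n. pmf (bernoulli_pmf p) (snd (c ! i) ! j))"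
      unfolding K_def by (simp add: prod.cartesian_product case_prod_unfold)
    finally have "prob (E l c) = prob {\<omega> \<in> space M. card (\<nu> \<omega> \<inter> {x<..y}) = l} *
        (\<Prod>i<n. pmf (bernoulli_pmf a) (fst (c ! i)) * (\<Prod>j<n. pmf (bernoulli_pmf p) (snd (c ! i) ! j)))"
      by (simp add: prod.distrib mult_ac)
    also have "(\<Prod>i<n. pmf (bernoulli_pmf a) (fst (c ! i)) * (\<Prod>j<n. pmf (bernoulli_pmf p) (snd (c ! i) ! j)))
        = pmf (replicate_pmf n (column_pmf n a p)) c"
    proof -
      have "pmf (column_pmf n a p) (c ! i) = pmf (bernoulli_pmf a) (fst (c ! i)) * (\<Prod>j<n. pmf (bernoulli_pmf p) (snd (c ! i) ! j))"
        if "i < n" for i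
        using True that by (cases "c ! i") (auto simp: column_pmf_def pmf_pair pmf_replicate_pmf dest!: spec[of _ i])
      then show ?thesis using True by (simp add: pmf_replicate_pmf)
    qed
    finally show ?thesis using \<open>E l c \<in> events\<close> by simp
  qed
  then show "E l c \<in> events" and "prob (E l c) = prob {\<omega> \<in> space M. card (\<nu> \<omega> \<inter> {x<..y}) = l} *
      pmf (replicate_pmf n (column_pmf n a p)) c" by auto
qed

lemma columns_prob:
  assumes "0 < R" "0 < t" "0 < n"
  defines "D \<equiv> replicate_pmf n (column_pmf n (1 - exp (- (lam * R / real n))) (1 - exp (- (R * t / (real n * real n)))))"
  shows "{\<omega> \<in> space M. columns x R t n \<omega> \<in> S} \<in> events"
    and "prob {\<omega> \<in> space M. columns x R t n \<omega> \<in> S} = measure D S"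
proof -
  have "{\<omega> \<in> space M. columns x R t n \<omega> = c} \<in> events \<and> prob {\<omega> \<in> space M. columns x R t n \<omega> = c} = pmf D c" for c
    using columns_law[OF assms(1-3) order_refl, where l = 0 and x = x and c = c] prob_space by (simp add: D_def)
  then show "{\<omega> \<in> space M. columns x R t n \<omega> \<in> S} \<in> events"
    and "prob {\<omega> \<in> space M. columns x R t n \<omega> \<in> S} = measure D S"
    using prob_eq_measure_pmf[of "columns x R t n" D] by auto
qed

lemma count_columns_prob:
  assumes "0 < R" "0 < t" "0 < n" "x < y"
  defines "D \<equiv> replicate_pmf n (column_pmf n (1 - exp (- (lam * R / real n))) (1 - exp (- (R * t / (real n * real n)))))"
  shows "{\<omega> \<in> space M. (card (\<nu> \<omega> \<inter> {x<..y}), columns x R t n \<omega>) \<in> S} \<in> events"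
    and "prob {\<omega> \<in> space M. (card (\<nu> \<omega> \<inter> {x<..y}), columns x R t n \<omega>) \<in> S}
       = measure (pair_pmf (poisson_pmf (lam * (y - x))) D) S"
proof -
  let ?X = "\<lambda>\<omega>. (card (\<nu> \<omega> \<inter> {x<..y}), columns x R t n \<omega>)"
  have rate: "lam * (y - x) > 0" using assms(4) lam_pos by simp
  have V: "prob {\<omega> \<in> space M. card (\<nu> \<omega> \<inter> {x<..y}) = l} = pmf (poisson_pmf (lam * (y - x))) l" for l
    using poisson_process_prob[OF line_poisson, of "{x<..y}" l] rate assms(4) lam_pos
    by (simp add: measure_line_intensity)
  have "{\<omega> \<in> space M. ?X \<omega> = c} \<in> events \<and> prob {\<omega> \<in> space M. ?X \<omega> = c} = pmf (pair_pmf (poisson_pmf (lam * (y - x))) D) c" for c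
    using columns_law[OF assms(1-3) less_imp_le[OF assms(4)], where l = "fst c" and c = "snd c"]
    by (cases c) (simp add: D_def pmf_pair V)
  then show "{\<omega> \<in> space M. ?X \<omega> \<in> S} \<in> events"
    and "prob {\<omega> \<in> space M. ?X \<omega> \<in> S} = measure (pair_pmf (poisson_pmf (lam * (y - x))) D) S"
    using prob_eq_measure_pmf[of ?X "pair_pmf (poisson_pmf (lam * (y - x))) D"] by auto
qed

end

lemma exp_half_less_2: "exp (1 / 2 :: real) < 2"
proof -
  have "exp (1 / 2 :: real) \<le> 1 + 1 / 2 + (1 / 2)\<^sup>2" by (rule exp_bound) auto
  then show ?thesis by (simp add: power2_eq_square)
qed

lemma eight_exp_minus_4_less_1: "8 * exp (-4 :: real) < 1"
proof -
  have "3 * 3 \<le> exp 2 * exp (2 :: real)"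
    using exp_ge_add_one_self[of "2 :: real"] by (intro mult_mono) auto
  also have "\<dots> = exp 4" by (simp add: exp_add[symmetric])
  finally show ?thesis by (simp add: exp_minus field_simps)
qed

text \<open>
  A bound for the error in \<open>source_flux_law\<close> for the parameters chosen in \<open>overtaking_approximation\<close>.
\<close>

definition flux_error :: "real \<Rightarrow> real \<Rightarrow> nat \<Rightarrow> real" where
  "flux_error lam t N = exp (t / lam) / 2 ^ N + 2 ^ (3 * N) * exp (- (4 * real N)) + (exp (real N / 2) + exp (32 * t / lam)) / 2 ^ N"

lemma flux_error_tendsto_0: "flux_error lam t \<longlonglongrightarrow> 0"
proof -
  have eq: "flux_error lam t k
      = exp (t / lam) * (1 / 2) ^ k + (8 * exp (-4)) ^ k + ((exp (1 / 2) / 2) ^ k + exp (32 * t / lam) * (1 / 2) ^ k)" for k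
  proof -
    have "(2 :: real) ^ (3 * k) = 8 ^ k" by (simp add: power_mult)
    then show ?thesis unfolding flux_error_def
      by (simp add: power_mult_distrib power_divide exp_of_nat_mult[symmetric] add_divide_distrib mult.commute)
  qed
  have "(\<lambda>k. flux_error lam t k) \<longlonglongrightarrow> exp (t / lam) * 0 + 0 + (0 + exp (32 * t / lam) * 0)"
    unfolding eq using exp_half_less_2 eight_exp_minus_4_less_1
    by (intro tendsto_add tendsto_mult tendsto_const LIMSEQ_power_zero) auto
  then show ?thesis by simp
qed

text \<open>
  The density of sinks that balances sources of density \<open>a\<close> and points of density \<open>p\<close>.
\<close>

definition sink_rate :: "real \<Rightarrow> real \<Rightarrow> real" where
  "sink_rate p a = p * (1 - a) / (a + p * (1 - a))"

lemma
  assumes "0 \<le> a" "a \<le> 1" "0 \<le> p"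
  shows sink_rate_nonneg: "0 \<le> sink_rate p a" and sink_rate_le_1: "sink_rate p a \<le> 1"
proof -
  have "0 \<le> p * (1 - a)" using assms by simp
  then show "0 \<le> sink_rate p a" "sink_rate p a \<le> 1"
    unfolding sink_rate_def using assms(1) by (auto simp: divide_le_eq_1)
qed

lemma sink_rate_balance:
  assumes "0 < a" "a \<le> 1" "0 \<le> p"
  shows "a * sink_rate p a = p * (1 - a) * (1 - sink_rate p a)"
proof -
  have "a + p * (1 - a) > 0" using assms by (simp add: add_pos_nonneg)
  then show ?thesis unfolding sink_rate_def by (simp add: field_simps)
qed

lemma sink_rate_le:
  assumes "0 < a" "a \<le> 1" "0 \<le> p"
  shows "sink_rate p a \<le> p * (1 - a) / a"
  unfolding sink_rate_def using assms by (intro divide_left_mono) (auto simp: add_pos_nonneg)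

lemma low_source_rate:
  fixes n :: nat
  assumes "0 < R" "0 < t" "0 < \<kappa>" "\<kappa> * R < real n"
  defines "p \<equiv> 1 - exp (- (R * t / (real n * real n)))" and "a \<equiv> \<kappa> * R / real n"
  shows "0 < a" "a \<le> 1" "0 \<le> p" "p \<le> 1" "real n * a = \<kappa> * R" "real n * sink_rate p a \<le> t / \<kappa>"
proof -
  have n: "0 < real n" using assms(1,3,4) mult_pos_pos[of \<kappa> R] by linarith
  show a: "0 < a" "a \<le> 1" "real n * a = \<kappa> * R" using n assms by (auto simp: a_def)
  show p: "0 \<le> p" "p \<le> 1" using assms by (auto simp: p_def)
  have "sink_rate p a \<le> p * (1 - a) / a" by (rule sink_rate_le[OF a(1,2) p(1)])
  also have "\<dots> \<le> p / a" using a p by (intro divide_right_mono) (auto simp: mult_left_le)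
  also have "\<dots> \<le> (R * t / (real n * real n)) / a"
    using exp_ge_add_one_self[of "- (R * t / (real n * real n))"] a by (intro divide_right_mono) (auto simp: p_def)
  finally have "real n * sink_rate p a \<le> real n * ((R * t / (real n * real n)) / a)"
    using n by (intro mult_left_mono) auto
  also have "\<dots> = t / \<kappa>" using n assms(1,3) by (simp add: a_def field_simps)
  finally show "real n * sink_rate p a \<le> t / \<kappa>" .
qed

context poisson_system begin

text \<open>
  The auxiliary density \<open>\<kappa>\<close> is free: a small \<open>\<kappa>\<close> shows that the longest chain in a box of width \<open>R\<close> and
  fixed height is shorter than any given multiple of \<open>R\<close>, up to exponentially small probability.
\<close>

lemma chain_length_tail:
  assumes "0 < R" "0 < t" "0 < \<kappa>" "0 < \<epsilon>"
  shows "\<exists>E\<in>events. prob E \<le> (exp (\<kappa> * R) + exp (t / \<kappa>)) / 2 ^ k + \<epsilon> \<and>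
    (\<forall>\<omega>\<in>space M - E. \<forall>C. chain_in (P \<omega>) (x - R) x t C \<longrightarrow> card C < 2 * k)"
proof -
  have "\<forall>\<^sub>F n in sequentially. prob (crowded x R t (Suc n)) < \<epsilon>"
    by (rule order_tendstoD(2)[OF crowded_tendsto_0[OF assms(1,2)] assms(4)])
  moreover have "\<forall>\<^sub>F n in sequentially. \<kappa> * R < real (Suc n)" by real_asymp
  ultimately have "\<forall>\<^sub>F n in sequentially. prob (crowded x R t (Suc n)) < \<epsilon> \<and> \<kappa> * R < real (Suc n)"
    by (rule eventually_conj)
  then obtain m where m: "prob (crowded x R t (Suc m)) < \<epsilon>" "\<kappa> * R < real (Suc m)"
    by (auto simp: eventually_sequentially)
  define n where "n = Suc m"
  have n: "0 < n" "prob (crowded x R t n) < \<epsilon>" "\<kappa> * R < real n" using m by (auto simp: n_def)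
  define p where "p = 1 - exp (- (R * t / (real n * real n)))"
  define a where "a = \<kappa> * R / real n"
  note rate = low_source_rate[OF assms(1-3) n(3), folded p_def a_def]
  define T where "T = {\<omega> \<in> space M. columns x R t n \<omega> \<in> {c. 2 * k \<le> bulk_height n c}}"
  have T: "T \<in> events" unfolding T_def by (rule columns_prob[OF assms(1,2) n(1)])
  have "prob T \<le> (exp (real n * a) + exp (real n * sink_rate p a)) / 2 ^ k"
    unfolding T_def columns_prob(2)[OF assms(1,2) n(1)] p_def[symmetric]
    by (rule bulk_height_tail)
       (use rate sink_rate_nonneg[of a p] sink_rate_le_1[of a p] sink_rate_balance[of a p] in auto)
  also have "\<dots> \<le> (exp (\<kappa> * R) + exp (t / \<kappa>)) / 2 ^ k"
    using rate by (intro divide_right_mono add_mono) auto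
  finally have "prob (crowded x R t n \<union> T) \<le> (exp (\<kappa> * R) + exp (t / \<kappa>)) / 2 ^ k + \<epsilon>"
    using measure_Un_le[of "crowded x R t n" M T] T crowded_bound(1)[OF assms(1,2) n(1)] n(2) by simp
  moreover have "card C < 2 * k" if "\<omega> \<in> space M - (crowded x R t n \<union> T)" "chain_in (P \<omega>) (x - R) x t C" for \<omega> C
    using bulk_height_columns[OF assms(1,2) n(1) _ that(2)] that(1) by (fastforce simp: T_def)
  ultimately show ?thesis
    using T crowded_bound(1)[OF assms(1,2) n(1)] by (intro bexI[of _ "crowded x R t n \<union> T"]) auto
qed

text \<open>
  The event that the tagged particle has passed \<open>x\<close>, restricted to paths starting in \<open>[x - R, x]\<close>.
\<close>

definition overtaking :: "real \<Rightarrow> real \<Rightarrow> real \<Rightarrow> 'w set" where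
  "overtaking x R t = {\<omega> \<in> space M. \<exists>z C. x - R \<le> z \<and> z \<le> x \<and> chain_in (P \<omega>) z x t C \<and>
     card (\<nu> \<omega> \<inter> {z<..0}) + 1 \<le> card C}"

text \<open>
  The choices \<open>R = 16 N / \<lambda>\<close>, \<open>c = N\<close> in \<open>source_flux_law\<close> and auxiliary source density \<open>\<lambda> / 32\<close> make
  all errors decay geometrically in \<open>N\<close>: about \<open>16 N\<close> sources are expected, against an order of
  \<open>N\<close> for the other two contributions.
\<close>

lemma overtaking_approximation:
  assumes "x < 0" "0 < t" "0 < N"
  defines "R \<equiv> 16 * real N / lam"
  shows "overtaking x R t \<in> sets (completion M)"
    and "\<bar>measure (completion M) (overtaking x R t)
          - exceedance (poisson_pmf (lam * (0 - x))) (poisson_pmf (t / lam))\<bar>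
        \<le> flux_error lam t N"
proof -
  have R: "0 < R" "lam * R = 16 * real N" using assms lam_pos by (auto simp: R_def)
  define V where "V = poisson_pmf (lam * (0 - x))"
  define a where "a n = 1 - exp (- (lam * R / real n))" for n :: nat
  define p where "p n = 1 - exp (- (R * t / (real n * real n)))" for n :: nat
  define b where "b n = sink_rate (p n) (a n)" for n
  define S where "S n = {(v, cols). v + 1 + trues (sources cols) \<le> source_height n cols}" for n
  define B where "B n = {\<omega> \<in> space M. (card (\<nu> \<omega> \<inter> {x<..0}), columns x R t (Suc n) \<omega>) \<in> S (Suc n)}" for n
  have B: "B n \<in> events" "prob (B n) = measure (pair_pmf V (replicate_pmf (Suc n) (column_pmf (Suc n) (a (Suc n)) (p (Suc n))))) (S (Suc n))" for n
    unfolding B_def V_def a_def p_def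
    by (rule count_columns_prob[OF R(1) assms(2) _ assms(1)], simp)+
  have SB: "\<omega> \<in> overtaking x R t \<longleftrightarrow> \<omega> \<in> B n" if \<omega>: "\<omega> \<in> space M - crowded x R t (Suc n)" for \<omega> n
  proof -
    have \<omega>M: "\<omega> \<in> space M" using \<omega> by simp
    have fin: "finite (\<nu> \<omega> \<inter> {a<..b})" for a b by (rule finite_\<nu>[OF \<omega>M]) simp
    have split: "card (\<nu> \<omega> \<inter> {z<..0}) = card (\<nu> \<omega> \<inter> {z<..x}) + card (\<nu> \<omega> \<inter> {x<..0})" if "z \<le> x" for z
      by (rule card_Int_Ioc_split[OF fin that]) (use assms(1) in simp)
    have eq: "(x - R \<le> z \<and> z \<le> x \<and> chain_in (P \<omega>) z x t C \<and> card (\<nu> \<omega> \<inter> {z<..0}) + 1 \<le> card C) \<longleftrightarrow>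
        (x - R \<le> z \<and> z \<le> x \<and> chain_in (P \<omega>) z x t C \<and>
          card (\<nu> \<omega> \<inter> {z<..x}) + (card (\<nu> \<omega> \<inter> {x<..0}) + 1) \<le> card C)" for z C
    proof (cases "z \<le> x")
      case True
      show ?thesis by (simp only: split[OF True] add.assoc)
    qed simp
    have "\<omega> \<in> overtaking x R t \<longleftrightarrow> (\<exists>z C. x - R \<le> z \<and> z \<le> x \<and> chain_in (P \<omega>) z x t C \<and>
        card (\<nu> \<omega> \<inter> {z<..x}) + (card (\<nu> \<omega> \<inter> {x<..0}) + 1) \<le> card C)"
      unfolding overtaking_def mem_Collect_eq eq using \<omega>M by blast
    also have "\<dots> \<longleftrightarrow> \<omega> \<in> B n"
      using source_height_columns[OF R(1) assms(2) _ \<omega>, of "card (\<nu> \<omega> \<inter> {x<..0}) + 1"] \<omega>M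
      by (simp add: B_def S_def)
    finally show ?thesis .
  qed
  have "overtaking x R t \<subseteq> space M" by (auto simp: overtaking_def)
  note app = completion_approximation[of B "\<lambda>n. crowded x R t (Suc n)", OF B(1)
      crowded_bound(1)[OF R(1) assms(2) zero_less_Suc] this SB crowded_tendsto_0[OF R(1) assms(2)]]
  show "overtaking x R t \<in> sets (completion M)" by (rule app(1))
  have ap: "0 \<le> a n" "a n \<le> 1" "0 \<le> p n" "p n \<le> 1" for n
    using R assms(2) lam_pos by (auto simp: a_def p_def)
  have b: "0 \<le> b n \<and> b n \<le> 1" for n
    unfolding b_def using sink_rate_nonneg sink_rate_le_1 ap by blast
  have "(\<lambda>n. real n * b n) \<longlonglongrightarrow> R * t * (inverse lam * inverse R)"
    unfolding b_def a_def p_def sink_rate_def using R(1) assms(2) lam_pos by real_asymp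
  also have "R * t * (inverse lam * inverse R) = t / lam" using R(1) by (simp add: field_simps)
  finally have "(\<lambda>n. exceedance V (binomial_pmf n (b n)))
     \<longlonglongrightarrow> exceedance V (poisson_pmf (t / lam))"
    using assms(2) lam_pos by (intro tendsto_binomial_poisson_comparison b) auto
  then have Q: "(\<lambda>n. exceedance V (binomial_pmf (Suc n) (b (Suc n))))
     \<longlonglongrightarrow> exceedance V (poisson_pmf (t / lam))"
    by (rule LIMSEQ_Suc)
  define err where "err = flux_error lam t N"
  have bound: "\<bar>prob (B m) - exceedance V (binomial_pmf (Suc m) (b (Suc m)))\<bar> \<le> err"
    if m: "16 * real N < real (Suc m)" for m
  proof -
    define n where "n = Suc m"
    have n: "0 < real n" "lam * R < real n" using m R by (auto simp: n_def)
    have \<kappa>: "0 < lam / 32" "lam / 32 * R < real n" using lam_pos n R by auto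
    define a' where "a' = lam / 32 * R / real n"
    note rate = low_source_rate[OF R(1) assms(2) \<kappa>, folded a'_def p_def]
    have a: "0 < a n" using R lam_pos n assms(3) by (simp add: a_def)
    have nb: "real n * b n \<le> t / lam"
    proof -
      have "a n / (1 - a n) \<ge> lam * R / real n"
      proof -
        have "a n / (1 - a n) = exp (lam * R / real n) - 1" by (simp add: a_def exp_minus field_simps)
        then show ?thesis using exp_ge_add_one_self[of "lam * R / real n"] by linarith
      qed
      moreover have "b n \<le> p n * (1 - a n) / a n" unfolding b_def by (rule sink_rate_le[OF a ap(2,3)])
      moreover have "p n * (1 - a n) / a n = p n / (a n / (1 - a n))" by simp
      moreover have "p n / (a n / (1 - a n)) \<le> p n / (lam * R / real n)"
      proof -
        have "0 < lam * R / real n" using assms(3) R(2) n by simp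
        then have "0 < a n / (1 - a n)" using calculation(1) by linarith
        then show ?thesis using calculation(1) ap(3)[of n] \<open>0 < lam * R / real n\<close>
          by (intro divide_left_mono mult_pos_pos)
      qed
      moreover have "p n / (lam * R / real n) \<le> (R * t / (real n * real n)) / (lam * R / real n)"
        using exp_ge_add_one_self[of "- (R * t / (real n * real n))"] R lam_pos n
        by (intro divide_right_mono) (auto simp: p_def)
      moreover have "(R * t / (real n * real n)) / (lam * R / real n) = t / lam / real n"
        using R(1) lam_pos n by (simp add: field_simps)
      ultimately have "b n \<le> t / lam / real n" by linarith
      then have "real n * b n \<le> real n * (t / lam / real n)" using n by (intro mult_left_mono) auto
      then show ?thesis using n by simp
    qed
    have na: "4 * real N \<le> real n * a n / 2"
    proof -
      define h where "h = lam * R / real n"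
      have h: "0 \<le> h" "h \<le> 1" using R lam_pos n by (auto simp: h_def)
      \<comment> \<open>Valid since \<open>h \<le> 1\<close>; half the linear rate is enough to beat the factor \<open>2 ^ (3 * N)\<close>.\<close>
      have "exp (- h) \<le> 1 - h / 2"
      proof -
        have "exp (- h) \<le> 1 / (1 + h)" using exp_ge_add_one_self[of h] h by (simp add: exp_minus divide_simps)
        also have "\<dots> \<le> 1 - h / 2" using h by (simp add: field_simps mult_left_le)
        finally show ?thesis .
      qed
      then have "h / 2 \<le> a n" by (simp add: a_def h_def)
      then have "real n * (h / 2) \<le> real n * a n" using n by (intro mult_left_mono) auto
      then show ?thesis using n R by (simp add: h_def)
    qed
    have "\<bar>prob (B m) - exceedance V (binomial_pmf n (b n))\<bar>
      \<le> exp (real n * b n) / 2 ^ N + 2 ^ (3 * N) * exp (- (real n * a n / 2))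
        + (exp (real n * a') + exp (real n * sink_rate (p n) a')) / 2 ^ N"
      unfolding B(2) n_def[symmetric] S_def
      by (rule source_flux_law)
        (use ap[of n] b[of n] a rate sink_rate_nonneg[of a' "p n"] sink_rate_le_1[of a' "p n"] sink_rate_balance[of a' "p n"]
          sink_rate_balance[of "a n" "p n"] in \<open>auto simp: b_def\<close>)
    also have "\<dots> \<le> err"
    proof -
      have "real n * a' = real N / 2" using rate(5) R by simp
      moreover have "real n * sink_rate (p n) a' \<le> 32 * t / lam" using rate(6) by (simp add: mult.commute)
      ultimately show ?thesis unfolding err_def flux_error_def using nb na
        by (intro add_mono divide_right_mono mult_left_mono) auto
    qed
    finally show ?thesis by (simp only: n_def)
  qed
  have "\<forall>\<^sub>F m in sequentially. 16 * real N < real (Suc m)" by real_asymp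
  then have "\<forall>\<^sub>F m in sequentially. \<bar>prob (B m) - exceedance V (binomial_pmf (Suc m) (b (Suc m)))\<bar> \<le> err"
    by eventually_elim (rule bound)
  then show "\<bar>measure (completion M) (overtaking x R t)
          - exceedance (poisson_pmf (lam * (0 - x))) (poisson_pmf (t / lam))\<bar>
        \<le> flux_error lam t N"
    unfolding V_def[symmetric] err_def[symmetric]
    by (intro tendsto_upperbound[OF tendsto_rabs[OF tendsto_diff[OF app(2) Q]]]) auto
qed

text \<open>
  The events restricted to starting points in \<open>[x - R, x]\<close> increase to the full event as \<open>R \<rightarrow> \<infinity>\<close>.
\<close>

theorem overtaking_prob:
  assumes "x < 0" "0 < t"
  defines "S \<equiv> {\<omega> \<in> space M. \<exists>z C. z \<le> x \<and> chain_in (P \<omega>) z x t C \<and> card (\<nu> \<omega> \<inter> {z<..0}) + 1 \<le> card C}"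
  shows "S \<in> sets (completion M)"
    and "measure (completion M) S = exceedance (poisson_pmf (lam * (0 - x))) (poisson_pmf (t / lam))"
proof -
  interpret C: prob_space "completion M" by (rule prob_space_completion)
  define A where "A N = overtaking x (16 * real (Suc N) / lam) t" for N
  have A: "range A \<subseteq> C.events"
    using overtaking_approximation(1)[OF assms(1,2), of "Suc _"] by (auto simp: A_def simp del: of_nat_Suc)
  have inc: "incseq A"
  proof (rule monoI)
    fix i j :: nat assume "i \<le> j"
    then have "16 * real (Suc i) / lam \<le> 16 * real (Suc j) / lam" using lam_pos by (intro divide_right_mono) auto
    then have "x - 16 * real (Suc j) / lam \<le> z" if "x - 16 * real (Suc i) / lam \<le> z" for z
      using that by linarith
    then show "A i \<le> A j" unfolding A_def overtaking_def by blast
  qed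
  have S: "S = (\<Union>N. A N)"
  proof (intro equalityI subsetI)
    fix \<omega> assume "\<omega> \<in> S"
    then obtain z C where z: "\<omega> \<in> space M" "z \<le> x" "chain_in (P \<omega>) z x t C" "card (\<nu> \<omega> \<inter> {z<..0}) + 1 \<le> card C"
      unfolding S_def by blast
    obtain N :: nat where "(x - z) * lam / 16 \<le> real N" using real_arch_simple by blast
    then have "(x - z) * lam \<le> 16 * real (Suc N)" by (simp add: field_simps)
    then have "x - 16 * real (Suc N) / lam \<le> z" using lam_pos by (simp add: field_simps)
    then have "\<omega> \<in> A N" using z unfolding A_def overtaking_def by blast
    then show "\<omega> \<in> (\<Union>N. A N)" by blast
  next
    fix \<omega> assume "\<omega> \<in> (\<Union>N. A N)"
    then show "\<omega> \<in> S" unfolding A_def overtaking_def S_def by blast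
  qed
  show "S \<in> sets (completion M)" unfolding S using A by (intro sets.countable_UN)
  let ?Q = "exceedance (poisson_pmf (lam * (0 - x))) (poisson_pmf (t / lam))"
  have "(\<lambda>N. C.prob (A N)) \<longlonglongrightarrow> C.prob S" unfolding S by (rule C.finite_Lim_measure_incseq[OF A inc])
  moreover have "(\<lambda>N. C.prob (A N) - ?Q) \<longlonglongrightarrow> 0"
  proof (rule Lim_null_comparison)
    show "\<forall>\<^sub>F N in sequentially. norm (C.prob (A N) - ?Q) \<le> flux_error lam t (Suc N)"
      using overtaking_approximation(2)[OF assms(1,2), of "Suc _"] by (auto simp: A_def)
    show "(\<lambda>N. flux_error lam t (Suc N)) \<longlonglongrightarrow> 0"
      by (rule LIMSEQ_Suc[OF flux_error_tendsto_0])
  qed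
  then have "(\<lambda>N. C.prob (A N)) \<longlonglongrightarrow> ?Q" by (rule LIM_zero_cancel)
  ultimately show "C.prob S = ?Q" by (rule LIMSEQ_unique)
qed

end

section \<open>Typical configurations and the central limit theorem\<close>

context prob_space begin

lemma measure_completion_cong_AE:
  assumes S: "S \<in> sets (completion M)" and A: "A \<subseteq> space M" and AE: "AE \<omega> in M. \<omega> \<in> A \<longleftrightarrow> \<omega> \<in> S"
  shows "measure (completion M) A = measure (completion M) S"
proof -
  interpret C: prob_space "completion M" by (rule prob_space_completion)
  have "AE \<omega> in M. \<not> (\<omega> \<in> A \<and> \<omega> \<notin> S)" "AE \<omega> in M. \<not> (\<omega> \<notin> A \<and> \<omega> \<in> S)" using AE by (auto elim: eventually_mono)
  from this[THEN sets_completion_AE]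
  have "{\<omega> \<in> space M. \<omega> \<in> A \<and> \<omega> \<notin> S} \<in> C.events" "{\<omega> \<in> space M. \<omega> \<notin> A \<and> \<omega> \<in> S} \<in> C.events"
    by (simp_all add: pred_def)
  then have "(S - {\<omega> \<in> space M. \<omega> \<notin> A \<and> \<omega> \<in> S}) \<union> {\<omega> \<in> space M. \<omega> \<in> A \<and> \<omega> \<notin> S} \<in> C.events"
    using S by (intro sets.Un sets.Diff)
  moreover have "(S - {\<omega> \<in> space M. \<omega> \<notin> A \<and> \<omega> \<in> S}) \<union> {\<omega> \<in> space M. \<omega> \<in> A \<and> \<omega> \<notin> S} = A"
    using A sets.sets_into_space[OF S] by auto
  ultimately have "A \<in> C.events" by simp
  then show ?thesis using S AE_completion[OF AE] by (intro C.finite_measure_eq_AE) auto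
qed

end

context poisson_system begin

lemma AE_uncrowded:
  assumes "0 < R" "0 < t"
  shows "AE \<omega> in M. \<exists>n>0. \<omega> \<notin> crowded x R t n"
proof (rule AE_I')
  let ?I = "\<Inter>n. crowded x R t (Suc n)"
  have ev: "crowded x R t (Suc n) \<in> events" for n by (rule crowded_bound(1)[OF assms]) simp
  then have I: "?I \<in> events" by (intro sets.countable_INT) auto
  have "prob ?I \<le> prob (crowded x R t (Suc n))" for n by (intro finite_measure_mono ev) auto
  then have "prob ?I \<le> 0" by (intro LIMSEQ_le_const[OF crowded_tendsto_0[OF assms]]) auto
  then have "prob ?I = 0" using measure_nonneg[of M ?I] by linarith
  then show "?I \<in> null_sets M" using I by (simp add: null_sets_def emeasure_eq_measure)
  show "{\<omega> \<in> space M. \<not> (\<exists>n>0. \<omega> \<notin> crowded x R t n)} \<subseteq> ?I" by auto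
qed

lemma AE_avoids_null_set:
  assumes pp: "poisson_process M m N" and A: "A \<in> sets borel" "bounded A" "measure m A = 0"
  shows "AE \<omega> in M. N \<omega> \<inter> A = {}"
proof -
  have "prob {\<omega> \<in> space M. card (N \<omega> \<inter> A) \<in> {0}} = 1" using poisson_process_prob[OF pp A(1,2), of 0] A(3) by simp
  then have "AE \<omega> in M. \<omega> \<in> {\<omega> \<in> space M. card (N \<omega> \<inter> A) \<in> {0}}"
    by (subst AE_in_set_eq_1[OF poisson_process_events[OF pp A(1,2)]])
  then show ?thesis
    using AE_space by eventually_elim (use poisson_process_finite[OF pp _ A(2)] in auto)
qed

lemma AE_origin_vacant: "AE \<omega> in M. 0 \<notin> \<nu> \<omega>"
proof -
  have "measure (line_intensity lam) {0 :: real} = 0"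
    using lam_pos by (simp add: measure_scale_measure)
  from AE_avoids_null_set[OF line_poisson _ _ this] show ?thesis by auto
qed

lemma AE_axis_vacant: "AE \<omega> in M. \<forall>s>0. (0, s) \<notin> P \<omega>"
proof -
  have "AE \<omega> in M. P \<omega> \<inter> ({0} \<times> {0<..real n}) = {}" for n
  proof (rule AE_avoids_null_set[OF plane_poisson])
    let ?A = "{0} \<times> {0<..real n} :: (real \<times> real) set"
    show A: "?A \<in> sets borel" by (intro borel_Times) auto
    show "bounded ?A" by (intro bounded_Times) auto
    have "emeasure (lborel :: (real \<times> real) measure) ?A = emeasure lborel {0 :: real} * emeasure lborel {0<..real n}"
      unfolding lborel_prod[symmetric] by (intro lborel.emeasure_pair_measure_Times) auto
    then have null: "?A \<in> null_sets lborel" using A by (simp add: null_sets_def)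
    have "open (UNIV \<times> {0<..} :: (real \<times> real) set)" by (intro open_Times) auto
    then have I: "(indicator (UNIV \<times> {0 :: real<..}) :: real \<times> real \<Rightarrow> ennreal) \<in> borel_measurable lborel"
      by (intro borel_measurable_indicator) (simp add: borel_open)
    have "?A \<in> null_sets half_plane_intensity"
      unfolding null_sets_density_iff[OF I] using A AE_not_in[OF null] by (auto elim: eventually_mono)
    then show "measure half_plane_intensity ?A = 0"
      by (simp add: measure_def null_sets_def)
  qed
  then have "AE \<omega> in M. \<forall>n. P \<omega> \<inter> ({0} \<times> {0<..real n}) = {}" by (simp add: AE_all_countable)
  then show ?thesis
  proof eventually_elim
    case (elim \<omega>)
    show ?case
    proof (intro allI impI notI)
      fix s :: real assume "0 < s" "(0, s) \<in> P \<omega>"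
      moreover obtain n where "s \<le> real n" using real_arch_simple by blast
      ultimately have "(0, s) \<in> P \<omega> \<inter> ({0} \<times> {0<..real n})" by simp
      then show False using elim by blast
    qed
  qed
qed

text \<open>
  By Borel--Cantelli, for all large \<open>N\<close> the chains from \<open>-16 (N + 1) / \<lambda>\<close> have fewer than \<open>2 N\<close> points while
  \<open>\<nu>\<close> has more than \<open>3 N\<close> atoms in \<open>(-16 N / \<lambda>, 0]\<close>. Monotonicity covers the starting points in
  between.
\<close>

lemma AE_growth_box:
  assumes "0 < X" "0 < T"
  shows "AE \<omega> in M. \<exists>Z. \<forall>z\<le>Z. \<forall>C. chain_in (P \<omega>) z X T C \<longrightarrow>
           signed_count (insert 0 (\<nu> \<omega>)) z + real (card C) < real_of_int K"
proof -
  define x where "x N = - (16 * real N / lam)" for N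
  define \<kappa> where "\<kappa> = lam / 32"
  have \<kappa>: "0 < \<kappa>" using lam_pos by (simp add: \<kappa>_def)
  have "\<exists>E\<in>events. prob E \<le> (exp (\<kappa> * (X - x (Suc N))) + exp (T / \<kappa>)) / 2 ^ N + (1 / 2) ^ N \<and>
    (\<forall>\<omega>\<in>space M - E. \<forall>C. chain_in (P \<omega>) (x (Suc N)) X T C \<longrightarrow> card C < 2 * N)" for N
  proof -
    have "x (Suc N) < 0" using lam_pos by (simp add: x_def)
    then show ?thesis using chain_length_tail[of "X - x (Suc N)" T \<kappa> "(1 / 2) ^ N" N X] assms \<kappa> by simp
  qed
  then obtain E where E: "\<And>N. E N \<in> events"
    "\<And>N. prob (E N) \<le> (exp (\<kappa> * (X - x (Suc N))) + exp (T / \<kappa>)) / 2 ^ N + (1 / 2) ^ N"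
    "\<And>N \<omega> C. \<omega> \<in> space M - E N \<Longrightarrow> chain_in (P \<omega>) (x (Suc N)) X T C \<Longrightarrow> card C < 2 * N"
    by metis
  define G where "G N = {\<omega> \<in> space M. card (\<nu> \<omega> \<inter> {x N<..0}) \<in> {..3 * N}}" for N
  have G: "G N \<in> events" for N unfolding G_def by (rule poisson_process_events[OF line_poisson]) auto
  have "x N \<le> 0" for N using lam_pos by (simp add: x_def)
  then have "measure (line_intensity lam) {x N<..0} = 16 * real N" for N
    using lam_pos by (subst measure_line_intensity) (auto simp: x_def)
  then have GP: "prob (G N) \<le> 2 ^ (3 * N) * exp (- (8 * real N))" for N
    using poisson_process_lower_tail[OF line_poisson, of "{x N<..0}" "3 * N"] by (simp add: G_def)
  define D where "D = exp (\<kappa> * X + 1 / 2)"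
  define bnd where "bnd N = D * (exp (1 / 2) / 2) ^ N + (exp (T / \<kappa>) + 1) * (1 / 2) ^ N + (8 * exp (-8)) ^ N" for N
  have bound: "prob (E N \<union> G N) \<le> bnd N" for N
  proof -
    have "\<kappa> * (X - x (Suc N)) = (\<kappa> * X + 1 / 2) + real N * (1 / 2)"
      using lam_pos by (simp add: \<kappa>_def x_def field_simps)
    then have "exp (\<kappa> * (X - x (Suc N))) = D * exp (1 / 2) ^ N"
      by (simp only: exp_add D_def exp_of_nat_mult)
    moreover have "2 ^ (3 * N) * exp (- (8 * real N)) = (8 * exp (-8)) ^ N"
    proof -
      have "(2 :: real) ^ (3 * N) = 8 ^ N" by (simp add: power_mult)
      then show ?thesis by (simp add: power_mult_distrib exp_of_nat_mult[symmetric] mult.commute)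
    qed
    ultimately have "prob (E N) + prob (G N) \<le> bnd N"
    proof -
      assume e: "exp (\<kappa> * (X - x (Suc N))) = D * exp (1 / 2) ^ N" and g: "2 ^ (3 * N) * exp (- (8 * real N)) = (8 * exp (-8)) ^ N"
      have "(D * exp (1 / 2) ^ N + exp (T / \<kappa>)) / 2 ^ N + (1 / 2) ^ N
          = D * (exp (1 / 2) / 2) ^ N + (exp (T / \<kappa>) + 1) * (1 / 2) ^ N"
        by (simp add: power_divide add_divide_distrib distrib_right)
      then show ?thesis using E(2)[of N] GP[of N] unfolding e g bnd_def by linarith
    qed
    then show ?thesis using measure_Un_le[OF E(1) G, of N N] by linarith
  qed
  have "summable bnd"
  proof -
    have "exp (1 / 2 :: real) / 2 < 1" using exp_half_less_2 by simp
    moreover have "8 * exp (- 8 :: real) < 1" using exp_ge_add_one_self[of "8 :: real"] by (simp add: exp_minus field_simps)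
    ultimately show ?thesis unfolding bnd_def by (intro summable_add summable_mult summable_geometric) auto
  qed
  then have "summable (\<lambda>N. prob (E N \<union> G N))"
    by (rule summable_comparison_test[rotated]) (use bound in auto)
  then have "AE \<omega> in M. \<forall>\<^sub>F N in sequentially. \<omega> \<in> space M - (E N \<union> G N)"
    using E(1) G by (intro borel_cantelli_AE1) (auto simp: emeasure_eq_measure)
  then show ?thesis
  proof eventually_elim
    case (elim \<omega>)
    then obtain N0 where N0: "\<And>N. N0 \<le> N \<Longrightarrow> \<omega> \<in> space M - (E N \<union> G N)" by (auto simp: eventually_sequentially)
    define N1 where "N1 = max (Suc N0) (nat (- K))"
    have N1: "1 \<le> N1" "N0 \<le> N1" "- real_of_int K \<le> real N1" by (auto simp: N1_def)
    show ?case
    proof (intro exI[of _ "x N1"] allI impI)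
      fix z C assume z: "z \<le> x N1" and C: "chain_in (P \<omega>) z X T C"
      define N where "N = nat \<lfloor>- z * lam / 16\<rfloor>"
      have "real N1 \<le> - z * lam / 16" using z lam_pos by (simp add: x_def field_simps)
      then have N: "real N \<le> - z * lam / 16" "- z * lam / 16 < real N + 1" "N1 \<le> N"
        unfolding N_def by (auto simp: le_nat_floor)
      have zN: "x (Suc N) \<le> z" "z \<le> x N" using N(1,2) lam_pos by (auto simp: x_def field_simps)
      have \<omega>: "\<omega> \<in> space M" "\<omega> \<notin> E N" "\<omega> \<notin> G N" using N0[of N] N(3) N1(2) by auto
      have "card C < 2 * N" using E(3)[of \<omega> N C] \<omega> chain_in_mono[OF C zN(1)] by simp
      moreover have "3 * N < card (\<nu> \<omega> \<inter> {x N<..0})" using \<omega> by (simp add: G_def)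
      moreover have "card (\<nu> \<omega> \<inter> {x N<..0}) \<le> card (insert 0 (\<nu> \<omega>) \<inter> {z<..0})"
      proof (rule card_mono)
        have "finite (\<nu> \<omega> \<inter> {z<..0})" by (rule finite_\<nu>[OF \<omega>(1)]) simp
        then show "finite (insert 0 (\<nu> \<omega>) \<inter> {z<..0})" by (simp add: Int_insert_left)
        show "\<nu> \<omega> \<inter> {x N<..0} \<subseteq> insert 0 (\<nu> \<omega>) \<inter> {z<..0}" using zN by auto
      qed
      moreover have "z < 0"
      proof -
        have "x N1 < 0" using N1(1) lam_pos by (simp add: x_def)
        then show ?thesis using z by simp
      qed
      then have "signed_count (insert 0 (\<nu> \<omega>)) z = - real (card (insert 0 (\<nu> \<omega>) \<inter> {z<..0}))"
        by (simp add: signed_count_def)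
      ultimately show "signed_count (insert 0 (\<nu> \<omega>)) z + real (card C) < real_of_int K"
        using N(3) N1(3) by linarith
    qed
  qed
qed

text \<open>
  Two points with a common coordinate, or a point above an atom, lie in a common strip of every grid, so they
  would make all grids on a large box crowded.
\<close>

lemma AE_hammersley_data: "AE \<omega> in M. 0 \<notin> \<nu> \<omega> \<and> hammersley_data (insert 0 (\<nu> \<omega>)) (P \<omega>)"
proof -
  define L where "L k = real (Suc k)" for k
  have L: "0 < L k" for k by (simp add: L_def)
  have "AE \<omega> in M. \<forall>k. \<exists>n>0. \<omega> \<notin> crowded (L k) (2 * L k) (L k) n"
    using AE_uncrowded L by (simp add: AE_all_countable)
  moreover have "AE \<omega> in M. \<forall>k K. \<exists>Z. \<forall>z\<le>Z. \<forall>C. chain_in (P \<omega>) z (L k) (L k) C \<longrightarrow>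
           signed_count (insert 0 (\<nu> \<omega>)) z + real (card C) < real_of_int K"
    using AE_growth_box[OF L L] by (simp add: AE_all_countable)
  ultimately show ?thesis using AE_origin_vacant AE_axis_vacant AE_space
  proof eventually_elim
    case (elim \<omega>)
    note uncrowded = elim(1) and growth = elim(2) and origin = elim(3) and axis = elim(4) and \<omega> = elim(5)
    have bigger: "\<exists>k. a \<le> L k" for a unfolding L_def using real_arch_simple[of a] by (metis le_SucI of_nat_le_iff order_refl order_trans)
    have box: "\<exists>k n. 0 < n \<and> \<omega> \<in> space M - crowded (L k) (2 * L k) (L k) n \<and> a \<le> L k" for a
      using bigger[of a] uncrowded \<omega> by blast
    have "hammersley_data (insert 0 (\<nu> \<omega>)) (P \<omega>)"
    proof
      fix A :: "real set" assume "bounded A"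
      then have "finite (\<nu> \<omega> \<inter> A)" by (rule finite_\<nu>[OF \<omega>])
      then show "finite (insert 0 (\<nu> \<omega>) \<inter> A)" by (simp add: Int_insert_left)
    next
      fix B :: "(real \<times> real) set" assume "bounded B"
      then show "finite (P \<omega> \<inter> B)" by (rule finite_P[OF \<omega>])
    next
      fix x s y assume P: "(x, s) \<in> P \<omega>" "(y, s) \<in> P \<omega>" "0 < s"
      obtain k n where n: "0 < n" and good: "\<omega> \<in> space M - crowded (L k) (2 * L k) (L k) n"
        and k: "\<bar>x\<bar> + \<bar>y\<bar> + s + 1 \<le> L k" using box by blast
      have s: "L k - L k < s" "s \<le> L k" using k P(3) by auto
      obtain i where i: "i < n" "s \<in> grid_cell (L k) (L k) n i"
        using grid_cell_exists[OF L[of k] n s] by auto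
      have "(x, s) = (y, s)"
        by (rule card_le_1_eqI[OF _ not_crowdedD(2)[OF good i(1)]]) (use P i k finite_P[OF \<omega>] in auto)
      then show "x = y" by simp
    next
      fix x s r assume P: "(x, s) \<in> P \<omega>" "(x, r) \<in> P \<omega>" "0 < s" "0 < r"
      obtain k n where n: "0 < n" and good: "\<omega> \<in> space M - crowded (L k) (2 * L k) (L k) n"
        and k: "\<bar>x\<bar> + s + r + 1 \<le> L k" using box by blast
      have x: "L k - 2 * L k < x" "x \<le> L k" using k P by auto
      obtain i where i: "i < n" "x \<in> grid_cell (L k) (2 * L k) n i"
        using grid_cell_exists[OF _ n x] L[of k] by auto
      have "card (P \<omega> \<inter> (grid_cell (L k) (2 * L k) n i \<times> {0<..L k})) \<le> 1"
        using not_crowdedD(1)[OF good i(1)] by linarith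
      then have "(x, s) = (x, r)"
        by (rule card_le_1_eqI[rotated]) (use P i k finite_P[OF \<omega>] in auto)
      then show "s = r" by simp
    next
      fix x s assume P: "(x, s) \<in> P \<omega>" "0 < s"
      show "x \<notin> insert 0 (\<nu> \<omega>)"
      proof
        assume "x \<in> insert 0 (\<nu> \<omega>)"
        then have "x \<in> \<nu> \<omega>" using P axis by auto
        obtain k n where n: "0 < n" and good: "\<omega> \<in> space M - crowded (L k) (2 * L k) (L k) n"
          and k: "\<bar>x\<bar> + s + 1 \<le> L k" using box by blast
        have x: "L k - 2 * L k < x" "x \<le> L k" using k P by auto
        obtain i where i: "i < n" "x \<in> grid_cell (L k) (2 * L k) n i"
          using grid_cell_exists[OF _ n x] L[of k] by auto
        have "0 < card (\<nu> \<omega> \<inter> grid_cell (L k) (2 * L k) n i)"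
          using \<open>x \<in> \<nu> \<omega>\<close> i finite_\<nu>[OF \<omega>] by (auto simp: card_gt_0_iff)
        moreover have "(x, s) \<in> P \<omega> \<inter> (grid_cell (L k) (2 * L k) n i \<times> {0<..L k})"
          using P i k by auto
        then have "0 < card (P \<omega> \<inter> (grid_cell (L k) (2 * L k) n i \<times> {0<..L k}))"
          using finite_P[OF \<omega> box_bounded] unfolding card_gt_0_iff by blast
        ultimately show False using not_crowdedD(1)[OF good i(1)] by linarith
      qed
    next
      fix X T :: real and K :: int
      obtain k where k: "max X T \<le> L k" using bigger by blast
      obtain Z where Z: "\<And>z C. z \<le> Z \<Longrightarrow> chain_in (P \<omega>) z (L k) (L k) C \<Longrightarrow>
           signed_count (insert 0 (\<nu> \<omega>)) z + real (card C) < real_of_int K" using growth by blast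
      show "\<exists>Z. \<forall>z\<le>Z. \<forall>C. chain_in (P \<omega>) z X T C \<longrightarrow>
           signed_count (insert 0 (\<nu> \<omega>)) z + real (card C) < real_of_int K"
        using Z chain_in_mono[where P = "P \<omega>", of _ X T _ _ "L k" "L k"] k
        by (intro exI[of _ Z] allI impI) (metis max.bounded_iff order_refl)
    qed
    then show ?case using origin by simp
  qed
qed

theorem tagged_position_prob:
  assumes "x < 0" "0 < t"
  shows "measure (completion M) {\<omega> \<in> space M. particle_position (insert 0 (\<nu> \<omega>)) (P \<omega>) 0 t \<le> x}
       = exceedance (poisson_pmf (lam * (0 - x))) (poisson_pmf (t / lam))"
  unfolding overtaking_prob(2)[OF assms, symmetric]
proof (rule measure_completion_cong_AE)
  show "AE \<omega> in M. \<omega> \<in> {\<omega> \<in> space M. particle_position (insert 0 (\<nu> \<omega>)) (P \<omega>) 0 t \<le> x} \<longleftrightarrow>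
    \<omega> \<in> {\<omega> \<in> space M. \<exists>z C. z \<le> x \<and> chain_in (P \<omega>) z x t C \<and> card (\<nu> \<omega> \<inter> {z<..0}) + 1 \<le> card C}"
    using AE_hammersley_data AE_space
  proof eventually_elim
    case (elim \<omega>)
    interpret hammersley_data "insert 0 (\<nu> \<omega>)" "P \<omega>" using elim by simp
    have count: "signed_count (insert 0 (\<nu> \<omega>)) z = - real (card (\<nu> \<omega> \<inter> {z<..0}) + 1)" if "z \<le> x" for z
    proof -
      have "insert 0 (\<nu> \<omega>) \<inter> {z<..0} = insert 0 (\<nu> \<omega> \<inter> {z<..0})" using that assms(1) by auto
      moreover have "finite (\<nu> \<omega> \<inter> {z<..0})" by (rule finite_\<nu>[OF elim(2)]) simp
      ultimately show ?thesis using elim(1) that assms(1) by (simp add: signed_count_def)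
    qed
    have "particle_position (insert 0 (\<nu> \<omega>)) (P \<omega>) 0 t = tagged t"
      using tagged_path assms(2) by (intro particle_position_eqI) auto
    then have "particle_position (insert 0 (\<nu> \<omega>)) (P \<omega>) 0 t \<le> x \<longleftrightarrow> reach (insert 0 (\<nu> \<omega>)) (P \<omega>) 0 x t"
      by (simp add: tagged_le_iff reach_iff_level)
    also have "\<dots> \<longleftrightarrow> (\<exists>z C. z \<le> x \<and> chain_in (P \<omega>) z x t C \<and> card (\<nu> \<omega> \<inter> {z<..0}) + 1 \<le> card C)"
    proof -
      have "(z \<le> x \<and> chain_in (P \<omega>) z x t C \<and> real_of_int 0 \<le> signed_count (insert 0 (\<nu> \<omega>)) z + real (card C)) \<longleftrightarrow>
          (z \<le> x \<and> chain_in (P \<omega>) z x t C \<and> card (\<nu> \<omega> \<inter> {z<..0}) + 1 \<le> card C)" for z C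
        using count[of z] by (cases "z \<le> x") (simp_all, linarith)
      then show ?thesis unfolding reach_def by blast
    qed
    finally show ?case using elim(2) by simp
  qed
qed (use overtaking_prob(1)[OF assms] in auto)

end

theorem corollary1:
  fixes M :: "'w measure"
    and \<nu> :: "'w \<Rightarrow> real set"
    and P :: "'w \<Rightarrow> (real \<times> real) set"
    and lam \<mu>\<^sub>1 \<sigma>\<^sub>1 u :: real
  assumes "prob_space M"
    and "lam > 0"
    and "poisson_process M (scale_measure (ennreal lam) lborel) \<nu>"
    and "poisson_process M (density lborel (indicator (UNIV \<times> {0<..}))) P"
    and "indep_configs M \<nu> P"
    and "\<mu>\<^sub>1 = - 1 / lam\<^sup>2"
    and "\<sigma>\<^sub>1 = sqrt (2 / lam ^ 3)"
  shows "((\<lambda>t. measure (completion M)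
            {\<omega> \<in> space M. particle_position (insert 0 (\<nu> \<omega>)) (P \<omega>) 0 t
                            \<le> \<mu>\<^sub>1 * t + (\<sigma>\<^sub>1 * sqrt t) * u})
          \<longlongrightarrow> cdf std_normal_distribution u) at_top"
proof -
  interpret poisson_system M \<nu> P lam
    using assms(1-5) by (simp add: poisson_system_def poisson_system_axioms_def)
  define s where "s t = sqrt (2 * t / lam)" for t
  define F where "F s = exceedance (poisson_pmf (s\<^sup>2 / 2 - s * u)) (poisson_pmf (s\<^sup>2 / 2))" for s
  have "filterlim s at_top at_top" unfolding s_def using \<open>lam > 0\<close> by real_asymp
  then have "((\<lambda>t. F (s t)) \<longlongrightarrow> cdf std_normal_distribution u) at_top"
    using poisson_difference_clt[of u] unfolding F_def by (rule filterlim_compose[rotated])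
  moreover have "\<forall>\<^sub>F t in at_top. \<mu>\<^sub>1 * t + (\<sigma>\<^sub>1 * sqrt t) * u < 0"
  proof -
    have "\<mu>\<^sub>1 < 0" using assms(2,6) by simp
    then show ?thesis by real_asymp
  qed
  then have "\<forall>\<^sub>F t in at_top. F (s t) = measure (completion M)
      {\<omega> \<in> space M. particle_position (insert 0 (\<nu> \<omega>)) (P \<omega>) 0 t \<le> \<mu>\<^sub>1 * t + (\<sigma>\<^sub>1 * sqrt t) * u}"
    using eventually_gt_at_top[of 0]
  proof eventually_elim
    case (elim t)
    have s2: "(s t)\<^sup>2 / 2 = t / lam" using elim \<open>lam > 0\<close> by (simp add: s_def)
    \<comment> \<open>\<open>\<sigma>\<^sub>1\<close> is the constant for which the deviation of \<open>\<lambda> |x|\<close> from \<open>t / \<lambda>\<close> is \<open>s t * u\<close>.\<close>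
    have "lam * (\<sigma>\<^sub>1 * sqrt t) = sqrt (lam\<^sup>2 * (2 / lam ^ 3) * t)"
    proof -
      have "lam = sqrt (lam\<^sup>2)" using \<open>lam > 0\<close> by simp
      then show ?thesis unfolding assms(7) by (simp only: real_sqrt_mult mult.assoc)
    qed
    also have "lam\<^sup>2 * (2 / lam ^ 3) * t = 2 * t / lam"
      using \<open>lam > 0\<close> by (simp add: power2_eq_square power3_eq_cube field_simps)
    finally have "lam * (\<sigma>\<^sub>1 * sqrt t) = s t" by (simp add: s_def)
    moreover have "lam * \<mu>\<^sub>1 * t = - (t / lam)"
      using \<open>lam > 0\<close> unfolding assms(6) by (simp add: power2_eq_square field_simps)
    ultimately have "lam * (0 - (\<mu>\<^sub>1 * t + (\<sigma>\<^sub>1 * sqrt t) * u)) = (s t)\<^sup>2 / 2 - s t * u"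
      unfolding s2 by (simp add: algebra_simps)
    then show ?case using tagged_position_prob[OF elim] by (simp add: F_def s2)
  qed
  ultimately show ?thesis by (rule Lim_transform_eventually)
qed

end
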